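(* Let $\mathcal M$ be a compact complex supermanifold. The topological group $\mathrm{Aut}_{\bar 0}(\mathcal M)$ has no small subgroups, i.e. there is a neighbourhood of the identity which contains no non-trivial subgroup.
   Context: A complex supermanifold $\mathcal M=(M,\mathcal O_{\mathcal M})$ of dimension $(m|n)$ is a complex manifold $M$ with a sheaf $\mathcal O_{\mathcal M}$ of $\mathbb Z_2$-graded algebras which is locally, on small open $U\subset M$, isomorphic to $\mathcal O_U\otimes\bigwedge\mathbb C^n$, with $\mathcal O_U$ the sheaf of holomorphic functions; it is compact if $M$ is compact. A morphism $\varphi$ has underlying map $\tilde\varphi$ and parity-preserving pullback $\varphi^*$. $\mathrm{Aut}_{\bar 0}(\mathcal M)$ is the group of automorphisms (biholomorphic morphisms $\mathcal M\to\mathcal M$) under composition, with the topology generated by the following subbase. For $K\subseteq M$ compact contained in a coordinate domain with odd coordinates $\theta_1,\dots,\theta_n$, $U\subseteq M$ open, $f\in\mathcal O_{\mathcal M}(U)$, and $U_\nu\subseteq\mathbb C$ open ($\nu\in(\mathbb Z_2)^n$), the set of all $\varphi$ with $\tilde\varphi(K)\subseteq U$ and $\varphi_{f,\nu}(K)\subseteq U_\nu$ for all $\nu$, where $\varphi^*(f)=\sum_\nu\varphi_{f,\nu}\theta^\nu$ near $K$ with $\varphi_{f,\nu}$ holomorphic. *)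

theory Defs
  imports
    "HOL-Analysis.Analysis"
    "HOL-Library.Z2"
    "HOL-Algebra.Algebraic_Closure_Type"
begin

section \<open>Complex manifolds\<close>

text \<open>
  The dimensions of a supermanifold may be zero, so \<open>\<complex>\<^sup>m\<close> is modelled inside \<open>nat \<Rightarrow> complex\<close>,
  in the same way as \<^const>\<open>Euclidean_space\<close>.
\<close>

definition Complex_space :: "nat \<Rightarrow> (nat \<Rightarrow> complex) topology" where
  "Complex_space m =
     subtopology (product_topology (\<lambda>i. euclidean) UNIV) {z. \<forall>i\<ge>m. z i = 0}"

text \<open>
  Complex (Frechet) differentiability at every point of \<open>S \<subseteq> \<complex>\<^sup>m\<close>; it is only used for open \<open>S\<close>.
\<close>

definition holomorphic_Cn :: "nat \<Rightarrow> (nat \<Rightarrow> complex) set \<Rightarrow> ((nat \<Rightarrow> complex) \<Rightarrow> complex) \<Rightarrow> bool" where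
  "holomorphic_Cn m S f \<longleftrightarrow>
     (\<forall>z\<in>S. \<exists>a :: nat \<Rightarrow> complex. \<forall>e>0. \<exists>d>0. \<forall>w\<in>S.
        (\<forall>i<m. cmod (w i - z i) < d) \<longrightarrow>
        cmod (f w - f z - (\<Sum>i<m. a i * (w i - z i))) \<le> e * (\<Sum>i<m. cmod (w i - z i)))"

type_synonym 'p chart = "'p set \<times> ('p \<Rightarrow> nat \<Rightarrow> complex)"

record 'p cmanifold =
  mtop :: "'p topology"
  mdim :: nat
  atlas :: "'p chart set"

definition topological_chart :: "('p, 'x) cmanifold_scheme \<Rightarrow> 'p chart \<Rightarrow> bool" where
  "topological_chart M = (\<lambda>(U, \<psi>).
     openin (mtop M) U \<and>
     openin (Complex_space (mdim M)) (\<psi> ` U) \<and>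
     homeomorphic_map (subtopology (mtop M) U) (subtopology (Complex_space (mdim M)) (\<psi> ` U)) \<psi>)"

definition holomorphic_transition :: "nat \<Rightarrow> 'p chart \<Rightarrow> 'p chart \<Rightarrow> bool" where
  "holomorphic_transition m = (\<lambda>(U, \<psi>) (V, \<psi>').
     \<forall>i<m. holomorphic_Cn m (\<psi> ` (U \<inter> V)) (\<lambda>z. \<psi>' (inv_into U \<psi> z) i))"

definition complex_manifold :: "('p, 'x) cmanifold_scheme \<Rightarrow> bool" where
  "complex_manifold M \<longleftrightarrow>
     Hausdorff_space (mtop M) \<and> second_countable (mtop M) \<and>
     \<Union> (fst ` atlas M) = topspace (mtop M) \<and>
     (\<forall>c\<in>atlas M. topological_chart M c) \<and>
     (\<forall>c\<in>atlas M. \<forall>c'\<in>atlas M. holomorphic_transition (mdim M) c c')"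

text \<open>The charts of the maximal atlas, which need not belong to the given one.\<close>

definition holomorphic_chart :: "('p, 'x) cmanifold_scheme \<Rightarrow> 'p chart \<Rightarrow> bool" where
  "holomorphic_chart M c \<longleftrightarrow>
     topological_chart M c \<and>
     (\<forall>c'\<in>atlas M. holomorphic_transition (mdim M) c c' \<and> holomorphic_transition (mdim M) c' c)"

definition holomorphic_fun :: "('p, 'x) cmanifold_scheme \<Rightarrow> 'p set \<Rightarrow> ('p \<Rightarrow> complex) \<Rightarrow> bool" where
  "holomorphic_fun M V g \<longleftrightarrow>
     (\<forall>(U, \<psi>)\<in>atlas M. holomorphic_Cn (mdim M) (\<psi> ` (U \<inter> V)) (\<lambda>z. g (inv_into U \<psi> z)))"

definition holomorphic_map :: "('p, 'x) cmanifold_scheme \<Rightarrow> ('p \<Rightarrow> 'p) \<Rightarrow> bool" where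
  "holomorphic_map M h \<longleftrightarrow>
     continuous_map (mtop M) (mtop M) h \<and>
     (\<forall>(U, \<psi>)\<in>atlas M. \<forall>i<mdim M.
        holomorphic_fun M (h -` U \<inter> topspace (mtop M)) (\<lambda>x. \<psi> (h x) i))"


section \<open>Sheaves of superalgebras\<close>

record 's superalgebra = "(complex, 's) module" +
  part :: "bit \<Rightarrow> 's set"

definition superalgebra :: "('s, 'x) superalgebra_scheme \<Rightarrow> bool" where
  "superalgebra A \<longleftrightarrow>
     Ring.ring A \<and> Module.module (ring_of_type_algebra :: complex ring) A \<and>
     (\<forall>c. \<forall>x\<in>carrier A. \<forall>y\<in>carrier A.
        (c \<odot>\<^bsub>A\<^esub> x) \<otimes>\<^bsub>A\<^esub> y = c \<odot>\<^bsub>A\<^esub> (x \<otimes>\<^bsub>A\<^esub> y) \<and>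
        x \<otimes>\<^bsub>A\<^esub> (c \<odot>\<^bsub>A\<^esub> y) = c \<odot>\<^bsub>A\<^esub> (x \<otimes>\<^bsub>A\<^esub> y)) \<and>
     (\<forall>i. submodule (part A i) (ring_of_type_algebra :: complex ring) A) \<and>
     (\<forall>x\<in>carrier A. \<exists>!(y, z). y \<in> part A 0 \<and> z \<in> part A 1 \<and> x = y \<oplus>\<^bsub>A\<^esub> z) \<and>
     \<one>\<^bsub>A\<^esub> \<in> part A 0 \<and>
     (\<forall>i j. \<forall>x\<in>part A i. \<forall>y\<in>part A j. x \<otimes>\<^bsub>A\<^esub> y \<in> part A (i + j))"

definition superalgebra_hom ::
  "('s, 'x) superalgebra_scheme \<Rightarrow> ('t, 'y) superalgebra_scheme \<Rightarrow> ('s \<Rightarrow> 't) set" where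
  "superalgebra_hom A B =
     {h \<in> ring_hom A B.
        (\<forall>c. \<forall>x\<in>carrier A. h (c \<odot>\<^bsub>A\<^esub> x) = c \<odot>\<^bsub>B\<^esub> h x) \<and>
        (\<forall>i. h ` part A i \<subseteq> part B i)}"

text \<open>\<open>res F U V\<close> is the restriction map from \<open>sec F U\<close> to \<open>sec F V\<close>.\<close>

record ('p, 's) presheaf =
  sec :: "'p set \<Rightarrow> 's superalgebra"
  res :: "'p set \<Rightarrow> 'p set \<Rightarrow> 's \<Rightarrow> 's"

definition superalgebra_presheaf :: "'p topology \<Rightarrow> ('p, 's) presheaf \<Rightarrow> bool" where
  "superalgebra_presheaf T F \<longleftrightarrow>
     (\<forall>U. openin T U \<longrightarrow> superalgebra (sec F U)) \<and>
     (\<forall>U V. openin T U \<and> openin T V \<and> V \<subseteq> U \<longrightarrow>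
        res F U V \<in> superalgebra_hom (sec F U) (sec F V)) \<and>
     (\<forall>U. openin T U \<longrightarrow> (\<forall>s\<in>carrier (sec F U). res F U U s = s)) \<and>
     (\<forall>U V W. openin T U \<and> openin T V \<and> openin T W \<and> W \<subseteq> V \<and> V \<subseteq> U \<longrightarrow>
        (\<forall>s\<in>carrier (sec F U). res F V W (res F U V s) = res F U W s))"

definition superalgebra_sheaf :: "'p topology \<Rightarrow> ('p, 's) presheaf \<Rightarrow> bool" where
  "superalgebra_sheaf T F \<longleftrightarrow>
     superalgebra_presheaf T F \<and>
     (\<forall>\<U> s. (\<forall>U\<in>\<U>. openin T U \<and> s U \<in> carrier (sec F U)) \<and>
            (\<forall>U\<in>\<U>. \<forall>V\<in>\<U>. res F U (U \<inter> V) (s U) = res F V (U \<inter> V) (s V)) \<longrightarrow>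
        (\<exists>!t. t \<in> carrier (sec F (\<Union>\<U>)) \<and> (\<forall>U\<in>\<U>. res F (\<Union>\<U>) U t = s U)))"

text \<open>\<open>\<Phi>\<close> is an isomorphism of the restrictions of \<open>F\<close> and \<open>G\<close> to \<open>W\<close>, given by its components.\<close>

definition sheaf_iso_on ::
  "'p topology \<Rightarrow> 'p set \<Rightarrow> ('p, 's) presheaf \<Rightarrow> ('p, 't) presheaf \<Rightarrow> ('p set \<Rightarrow> 's \<Rightarrow> 't) \<Rightarrow> bool" where
  "sheaf_iso_on T W F G \<Phi> \<longleftrightarrow>
     (\<forall>U. openin T U \<and> U \<subseteq> W \<longrightarrow>
        \<Phi> U \<in> superalgebra_hom (sec F U) (sec G U) \<and>
        bij_betw (\<Phi> U) (carrier (sec F U)) (carrier (sec G U)) \<and>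
        (\<forall>i. \<Phi> U ` part (sec F U) i = part (sec G U) i)) \<and>
     (\<forall>U V. openin T U \<and> openin T V \<and> V \<subseteq> U \<and> U \<subseteq> W \<longrightarrow>
        (\<forall>s\<in>carrier (sec F U). \<Phi> V (res F U V s) = res G U V (\<Phi> U s)))"


section \<open>The local model\<close>

text \<open>
  A section of \<open>\<O>\<^sub>U \<otimes> \<Lambda>\<complex>\<^sup>n\<close> is the family of its coefficients \<open>f \<nu>\<close> in \<open>\<Sum>\<^sub>\<nu> f \<nu> \<theta>\<^sup>\<nu>\<close>. An index
  \<open>\<nu> \<in> (\<int>\<^sub>2)\<^sup>n\<close> is represented by the set of those \<open>i < n\<close> with \<open>\<nu>\<^sub>i = 1\<close>, and \<open>\<theta>\<^sup>\<nu>\<close> is the product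
  of the \<open>\<theta>\<^sub>i\<close>, \<open>i \<in> \<nu>\<close>, in increasing order. Coefficients vanish outside \<open>U\<close> and for all other
  indices, so that a section is determined by its values. For disjoint \<open>\<alpha>\<close> and \<open>\<beta>\<close> one has
  \<open>\<theta>\<^sup>\<alpha> \<theta>\<^sup>\<beta> = grassmann_sign \<alpha> \<beta> \<theta>\<^bsup>\<alpha>\<union>\<beta>\<^esup>\<close>.
\<close>

definition grassmann_sign :: "nat set \<Rightarrow> nat set \<Rightarrow> complex" where
  "grassmann_sign \<alpha> \<beta> = (-1) ^ card {(i, j). i \<in> \<alpha> \<and> j \<in> \<beta> \<and> j < i}"

type_synonym 'p grassmann = "nat set \<Rightarrow> 'p \<Rightarrow> complex"

definition model_sections :: "('p, 'x) cmanifold_scheme \<Rightarrow> nat \<Rightarrow> 'p set \<Rightarrow> 'p grassmann set" where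
  "model_sections M n U =
     {f. (\<forall>\<nu>. \<nu> \<subseteq> {..<n} \<longrightarrow> holomorphic_fun M U (f \<nu>) \<and> (\<forall>x. x \<notin> U \<longrightarrow> f \<nu> x = 0)) \<and>
         (\<forall>\<nu>. \<not> \<nu> \<subseteq> {..<n} \<longrightarrow> f \<nu> = (\<lambda>x. 0))}"

definition model_superalgebra ::
  "('p, 'x) cmanifold_scheme \<Rightarrow> nat \<Rightarrow> 'p set \<Rightarrow> 'p grassmann superalgebra" where
  "model_superalgebra M n U = \<lparr>
     carrier = model_sections M n U,
     mult = (\<lambda>f g \<nu> x. \<Sum>\<alpha>\<in>Pow \<nu>. grassmann_sign \<alpha> (\<nu> - \<alpha>) * f \<alpha> x * g (\<nu> - \<alpha>) x),
     one = (\<lambda>\<nu> x. if \<nu> = {} \<and> x \<in> U then 1 else 0),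
     zero = (\<lambda>\<nu> x. 0),
     add = (\<lambda>f g \<nu> x. f \<nu> x + g \<nu> x),
     smult = (\<lambda>c f \<nu> x. c * f \<nu> x),
     part = (\<lambda>i. {f \<in> model_sections M n U. \<forall>\<nu>. f \<nu> \<noteq> (\<lambda>x. 0) \<longrightarrow> of_nat (card \<nu>) = i}) \<rparr>"

definition model_sheaf :: "('p, 'x) cmanifold_scheme \<Rightarrow> nat \<Rightarrow> ('p, 'p grassmann) presheaf" where
  "model_sheaf M n = \<lparr>
     sec = model_superalgebra M n,
     res = (\<lambda>U V f \<nu> x. if x \<in> V then f \<nu> x else 0) \<rparr>"


section \<open>Complex supermanifolds\<close>

record ('p, 's) supermanifold = "'p cmanifold" +
  odim :: nat
  sheaf :: "('p, 's) presheaf"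

definition complex_supermanifold :: "('p, 's) supermanifold \<Rightarrow> bool" where
  "complex_supermanifold M \<longleftrightarrow>
     complex_manifold M \<and> superalgebra_sheaf (mtop M) (sheaf M) \<and>
     (\<forall>p\<in>topspace (mtop M). \<exists>U \<Phi>. openin (mtop M) U \<and> p \<in> U \<and>
        sheaf_iso_on (mtop M) U (sheaf M) (model_sheaf M (odim M)) \<Phi>)"

text \<open>
  Even and odd coordinates on \<open>W\<close> amount to a holomorphic chart on \<open>W\<close> together with an
  isomorphism \<open>\<Phi>\<close> of the structure sheaf with the local model on \<open>W\<close>: the odd coordinate
  \<open>\<theta>\<^sub>j\<close> is the preimage under \<open>\<Phi> W\<close> of the \<open>j\<close>-th generator, and \<open>\<Phi> U s \<nu>\<close> is the
  coefficient of \<open>\<theta>\<^sup>\<nu>\<close> in \<open>s\<close>.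
\<close>

definition coordinate_domain ::
  "('p, 's) supermanifold \<Rightarrow> 'p set \<Rightarrow> ('p set \<Rightarrow> 's \<Rightarrow> 'p grassmann) \<Rightarrow> bool" where
  "coordinate_domain M W \<Phi> \<longleftrightarrow>
     (\<exists>\<psi>. holomorphic_chart M (W, \<psi>)) \<and>
     sheaf_iso_on (mtop M) W (sheaf M) (model_sheaf M (odim M)) \<Phi>"


section \<open>Automorphisms\<close>

text \<open>
  A morphism \<open>\<phi>\<close> is the pair of its underlying map and its pullback, whose component
  \<open>snd \<phi> U\<close> maps sections over \<open>U\<close> to sections over the preimage of \<open>U\<close>. Both are
  \<open>undefined\<close> outside their domains, so that equality of pairs is equality of morphisms.
  That the pullback induces \<open>g \<mapsto> g \<circ> fst \<phi>\<close> on the reduced functions need not be required: a unital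
  \<open>\<complex>\<close>-algebra homomorphism preserves invertibility of \<open>s - c\<close>, hence values at points.
\<close>

type_synonym ('p, 's) morphism = "('p \<Rightarrow> 'p) \<times> ('p set \<Rightarrow> 's \<Rightarrow> 's)"

definition preimage :: "('p, 's) supermanifold \<Rightarrow> ('p \<Rightarrow> 'p) \<Rightarrow> 'p set \<Rightarrow> 'p set" where
  "preimage M h U = h -` U \<inter> topspace (mtop M)"

definition endomorphisms :: "('p, 's) supermanifold \<Rightarrow> ('p, 's) morphism set" where
  "endomorphisms M = {(h, r).
     h \<in> extensional (topspace (mtop M)) \<and> holomorphic_map M h \<and>
     r \<in> extensional {U. openin (mtop M) U} \<and>
     (\<forall>U. openin (mtop M) U \<longrightarrow>
        r U \<in> extensional (carrier (sec (sheaf M) U)) \<and>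
        r U \<in> superalgebra_hom (sec (sheaf M) U) (sec (sheaf M) (preimage M h U))) \<and>
     (\<forall>U V. openin (mtop M) U \<and> openin (mtop M) V \<and> V \<subseteq> U \<longrightarrow>
        (\<forall>s\<in>carrier (sec (sheaf M) U).
           r V (res (sheaf M) U V s) =
           res (sheaf M) (preimage M h U) (preimage M h V) (r U s)))}"

definition compose_morphisms ::
  "('p, 's) supermanifold \<Rightarrow> ('p, 's) morphism \<Rightarrow> ('p, 's) morphism \<Rightarrow> ('p, 's) morphism" where
  "compose_morphisms M \<phi> \<psi> =
     (compose (topspace (mtop M)) (fst \<phi>) (fst \<psi>),
      \<lambda>U\<in>{U. openin (mtop M) U}.
        compose (carrier (sec (sheaf M) U)) (snd \<psi> (preimage M (fst \<phi>) U)) (snd \<phi> U))"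

definition End_monoid :: "('p, 's) supermanifold \<Rightarrow> ('p, 's) morphism monoid" where
  "End_monoid M = \<lparr>
     carrier = endomorphisms M,
     mult = compose_morphisms M,
     one = (\<lambda>x\<in>topspace (mtop M). x,
            \<lambda>U\<in>{U. openin (mtop M) U}. \<lambda>s\<in>carrier (sec (sheaf M) U). s) \<rparr>"

definition Aut_group :: "('p, 's) supermanifold \<Rightarrow> ('p, 's) morphism monoid" where
  "Aut_group M = units_of (End_monoid M)"

definition Aut_subbasic ::
  "('p, 's) supermanifold \<Rightarrow> 'p set \<Rightarrow> 'p set \<Rightarrow> ('p set \<Rightarrow> 's \<Rightarrow> 'p grassmann) \<Rightarrow>
   'p set \<Rightarrow> 's \<Rightarrow> (nat set \<Rightarrow> complex set) \<Rightarrow> ('p, 's) morphism set" where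
  "Aut_subbasic M K W \<Phi> U f \<Omega> =
     {\<phi> \<in> carrier (Aut_group M).
        fst \<phi> ` K \<subseteq> U \<and>
        (let D = preimage M (fst \<phi>) U
         in \<forall>\<nu>. \<nu> \<subseteq> {..<odim M} \<longrightarrow>
              \<Phi> (D \<inter> W) (res (sheaf M) D (D \<inter> W) (snd \<phi> U f)) \<nu> ` K \<subseteq> \<Omega> \<nu>)}"

definition Aut_subbase :: "('p, 's) supermanifold \<Rightarrow> ('p, 's) morphism set set" where
  "Aut_subbase M = {Aut_subbasic M K W \<Phi> U f \<Omega> | K W \<Phi> U f \<Omega>.
     coordinate_domain M W \<Phi> \<and> compactin (mtop M) K \<and> K \<subseteq> W \<and>
     openin (mtop M) U \<and> f \<in> carrier (sec (sheaf M) U) \<and>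
     (\<forall>\<nu>. \<nu> \<subseteq> {..<odim M} \<longrightarrow> open (\<Omega> \<nu>))}"

text \<open>The whole group is inserted as the intersection of the empty subfamily of the subbase.\<close>

definition Aut_topology :: "('p, 's) supermanifold \<Rightarrow> ('p, 's) morphism topology" where
  "Aut_topology M = topology_generated_by (insert (carrier (Aut_group M)) (Aut_subbase M))"

definition no_small_subgroups :: "('g, 'x) monoid_scheme \<Rightarrow> 'g topology \<Rightarrow> bool" where
  "no_small_subgroups G T \<longleftrightarrow>
     (\<exists>N. (\<exists>V. openin T V \<and> \<one>\<^bsub>G\<^esub> \<in> V \<and> V \<subseteq> N) \<and>
          (\<forall>H. subgroup H G \<and> H \<subseteq> N \<longrightarrow> H = {\<one>\<^bsub>G\<^esub>}))"

end

theory Submission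
  imports Defs "HOL-Complex_Analysis.Complex_Analysis" "HOL-Real_Asymp.Real_Asymp"
begin

text \<open>
The whole proof rests on one elementary remark. If \<open>h\<close> moves a point by a small amount \<open>v\<close>, and the
displacement \<open>h - id\<close> has a small Lipschitz constant, then \<open>h \<circ> h\<close> moves the point by about \<open>2 v\<close>, in
any case by at least \<open>3/2 |v|\<close>. In a subgroup that stays close to the identity the squares, fourth powers,
and so on, remain close to the identity, so repeated squaring forces \<open>v = 0\<close>
(\<open>no_bounded_expansion\<close>). The remark is applied twice.

First it is applied to the underlying maps. In a chart the displacement is a holomorphic function that is
uniformly small on a polydisc, so on a smaller polydisc its Lipschitz constant is small by the
Schwarz lemma on complex lines (\<open>displacement_expands\<close>). Finitely many such polydiscs cover
the compact manifold, so all elements of a small subgroup have trivial underlying map.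

An automorphism \<open>\<phi>\<close> over the identity map induces in odd coordinates an endomorphism \<open>\<sigma>\<close> of
\<open>\<O> \<otimes> \<Lambda>\<complex>\<^sup>n\<close>. It does not change the reduction \<open>b\<close> of a section, because a
unital homomorphism preserves invertibility of \<open>b - c\<close> (\<open>sigma_body\<close>). Filter the
exterior algebra by degree. If \<open>\<sigma>\<close> moves all coordinates \<open>z\<^sub>i\<close> and \<open>\<theta>\<^sub>j\<close> only in degrees at least \<open>q\<close>, for all
elements of the group, then in degree \<open>q\<close> the displacement of a coordinate again doubles up to a small error when
\<open>\<sigma>\<close> is squared, and hence vanishes. Induction on \<open>q\<close> shows that \<open>\<sigma>\<close> fixes the coordinates
(\<open>small_endomorphisms_fix_generators\<close>). No continuity of \<open>\<sigma>\<close> is known, so it remains to see that an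
endomorphism fixing the coordinates fixes every section. This follows from the Hadamard expansion
\<open>b = b(p) + \<Sum>\<^sub>i (z\<^sub>i - z\<^sub>i(p)) g\<^sub>i\<close> with holomorphic \<open>g\<^sub>i\<close>: all terms but the first vanish at \<open>p\<close> after
applying \<open>\<sigma>\<close> (\<open>identity_from_generators\<close>).

The Hadamard expansion in several variables is proved from one-variable theory: the divided difference in one
coordinate is holomorphic off a hyperplane and along complex lines, with uniform Taylor estimates, and its gradient
on the hyperplane is a limit of nearby gradients (\<open>holomorphic_Hadamard\<close>).
\<close>


section \<open>Holomorphic functions on subsets of \<open>\<complex>\<^sup>m\<close>\<close>

text \<open>
The Schwarz lemma, rescaled to a disc of radius \<open>R\<close>. It is the only source of Lipschitz estimates below: the
constant \<open>2 B / R\<close> becomes small when the function is small on a disc of fixed radius.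
\<close>

lemma schwarz_disc:
  assumes hol: "\<gamma> holomorphic_on ball 0 R" and R: "R > 0"
    and B: "\<And>t. t \<in> ball 0 R \<Longrightarrow> cmod (\<gamma> t) < B"
  shows "t \<in> ball 0 R \<Longrightarrow> cmod (\<gamma> t - \<gamma> 0) \<le> 2 * B / R * cmod t"
    and "cmod (deriv \<gamma> 0) \<le> 2 * B / R"
proof -
  have B0: "B > 0"
    using B[of 0] R by (smt (verit) centre_in_ball norm_ge_zero)
  define h where "h = (\<lambda>s. (\<gamma> (of_real R * s) - \<gamma> 0) / of_real (2 * B))"
  have maps: "of_real R * s \<in> ball 0 R" if "cmod s < 1" for s :: complex
    using that R by (simp add: norm_mult)
  have hol_h: "h holomorphic_on ball 0 1"
    unfolding h_def
    by (intro holomorphic_intros holomorphic_on_compose_gen[OF _ hol, unfolded o_def])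
       (use maps B0 in auto)
  have h0: "h 0 = 0"
    by (simp add: h_def)
  have h1: "cmod (h s) < 1" if "cmod s < 1" for s
  proof -
    have "cmod (\<gamma> (of_real R * s) - \<gamma> 0) < 2 * B"
      using B[OF maps[OF that]] B[of 0] R norm_triangle_ineq4[of "\<gamma> (of_real R * s)" "\<gamma> 0"] by simp
    then show ?thesis
      using B0 by (simp add: h_def norm_divide norm_mult)
  qed
  show "cmod (\<gamma> t - \<gamma> 0) \<le> 2 * B / R * cmod t" if "t \<in> ball 0 R"
  proof -
    have "cmod (t / of_real R) < 1"
      using that R by (simp add: norm_divide)
    from Schwarz_Lemma(1)[OF hol_h h0 h1 this]
    show ?thesis
      using R B0 by (simp add: h_def norm_divide norm_mult field_simps)
  qed
  have "\<gamma> field_differentiable at 0"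
    using hol R by (auto intro: holomorphic_on_imp_differentiable_at)
  then have "(\<gamma> has_field_derivative deriv \<gamma> 0) (at (of_real R * 0))"
    by (simp add: DERIV_deriv_iff_field_differentiable)
  from DERIV_chain2[OF this DERIV_cmult[OF DERIV_ident]]
  have "((\<lambda>s. \<gamma> (of_real R * s)) has_field_derivative deriv \<gamma> 0 * of_real R) (at 0)"
    by (simp add: ac_simps)
  then have "(h has_field_derivative (deriv \<gamma> 0 * of_real R - 0) / of_real (2 * B)) (at 0)"
    unfolding h_def by (intro DERIV_cdivide DERIV_diff DERIV_const)
  then have "deriv h 0 = deriv \<gamma> 0 * of_real R / of_real (2 * B)"
    by (simp add: DERIV_imp_deriv)
  with Schwarz_Lemma(2)[OF hol_h h0 h1, of 0]
  show "cmod (deriv \<gamma> 0) \<le> 2 * B / R"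
    using R B0 by (simp add: norm_divide norm_mult field_simps)
qed

text \<open>
The Schwarz estimate, applied once more to the difference quotient \<open>(\<gamma> t - \<gamma> 0) / t\<close>, whose
singularity at 0 is removable.
\<close>

lemma taylor_remainder_disc:
  assumes hol: "\<gamma> holomorphic_on ball 0 R" and R: "R > 1"
    and B: "\<And>t. t \<in> ball 0 R \<Longrightarrow> cmod (\<gamma> t) < B"
  shows "cmod (\<gamma> 1 - \<gamma> 0 - deriv \<gamma> 0) \<le> 8 * B / R\<^sup>2"
proof -
  have B0: "B > 0"
    using B[of 0] R by (smt (verit) centre_in_ball norm_ge_zero)
  define k where "k = (\<lambda>t. if t = 0 then deriv \<gamma> 0 else (\<gamma> t - \<gamma> 0) / (t - 0))"
  have hol_k: "k holomorphic_on ball 0 R"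
    unfolding k_def by (rule pole_lemma_open[OF hol]) simp
  have "cmod (k t) < 4 * B / R" if t: "t \<in> ball 0 R" for t
  proof -
    have "cmod (k t) \<le> 2 * B / R"
    proof (cases "t = 0")
      case True
      then show ?thesis
        using schwarz_disc(2)[OF hol _ B] R by (simp add: k_def)
    next
      case False
      then show ?thesis
        using schwarz_disc(1)[OF hol _ B t] R by (simp add: k_def norm_divide divide_simps)
    qed
    also have "\<dots> < 4 * B / R"
      using B0 R by (simp add: divide_simps)
    finally show ?thesis .
  qed
  from schwarz_disc(1)[OF hol_k _ this, of 1] R
  show ?thesis
    by (simp add: k_def power2_eq_square)
qed

text \<open>
Convergence along this filter expresses nearness in the first \<open>m\<close> coordinates, so that differentiability on a
subset of \<open>nat \<Rightarrow> complex\<close>, which carries no norm, can be treated with the calculus of limits.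
\<close>

definition near :: "nat \<Rightarrow> (nat \<Rightarrow> complex) set \<Rightarrow> (nat \<Rightarrow> complex) \<Rightarrow> (nat \<Rightarrow> complex) filter" where
  "near m S z = (INF d\<in>{0<..}. principal {w \<in> S. \<forall>i<m. cmod (w i - z i) < d})"

lemma eventually_near:
  "eventually P (near m S z) \<longleftrightarrow> (\<exists>d>0. \<forall>w\<in>S. (\<forall>i<m. cmod (w i - z i) < d) \<longrightarrow> P w)"
  unfolding near_def
proof (subst eventually_INF_base, goal_cases)
  case 1
  have "(1::real) \<in> {0<..}"
    by simp
  then show ?case
    by blast
next
  case (2 a b)
  then show ?case
    by (intro bexI[of _ "min a b"]) auto
next
  case 3
  then show ?case
    by (auto simp: eventually_principal)
qed

lemma eventually_near_in: "eventually (\<lambda>w. w \<in> S) (near m S z)"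
  unfolding eventually_near by (intro exI[of _ 1]) auto

lemma tendsto_near_coordinate: "i < m \<Longrightarrow> ((\<lambda>w. w i) \<longlongrightarrow> z i) (near m S z)"
  unfolding tendsto_iff eventually_near by (auto simp: dist_norm)

lemma near_mono: "T \<subseteq> S \<Longrightarrow> near m T z \<le> near m S z"
  unfolding le_filter_def eventually_near by blast

lemma filterlim_near:
  assumes "eventually (\<lambda>x. h x \<in> S) F" and "\<And>i. i < m \<Longrightarrow> ((\<lambda>x. h x i) \<longlongrightarrow> z i) F"
  shows "filterlim h (near m S z) F"
  unfolding filterlim_iff eventually_near
proof (intro allI impI)
  fix P
  assume "\<exists>d>0. \<forall>w\<in>S. (\<forall>i<m. cmod (w i - z i) < d) \<longrightarrow> P w"
  then obtain d where d: "d > 0" "\<And>w. w \<in> S \<Longrightarrow> (\<forall>i<m. cmod (w i - z i) < d) \<Longrightarrow> P w"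
    by blast
  have "eventually (\<lambda>x. \<forall>i\<in>{..<m}. cmod (h x i - z i) < d) F"
    using assms(2) d(1) by (intro eventually_ball_finite) (auto simp: tendsto_iff dist_norm)
  then show "eventually (\<lambda>x. P (h x)) F"
    using assms(1) by eventually_elim (auto intro: d(2))
qed

text \<open>
Caratheodory's form of differentiability: the coefficients \<open>q\<close> may depend on \<open>w\<close> and converge to the gradient.
In this form sums, products and compositions reduce to rules for limits.
\<close>

definition has_gradient ::
  "nat \<Rightarrow> (nat \<Rightarrow> complex) set \<Rightarrow> ((nat \<Rightarrow> complex) \<Rightarrow> complex) \<Rightarrow> (nat \<Rightarrow> complex) \<Rightarrow> (nat \<Rightarrow> complex) \<Rightarrow> bool" where
  "has_gradient m S f a z \<longleftrightarrow>
     (\<exists>q. (\<forall>w\<in>S. f w - f z = (\<Sum>i<m. q i w * (w i - z i))) \<and>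
          (\<forall>i<m. (q i \<longlongrightarrow> a i) (near m S z)))"

lemma has_gradientE:
  assumes "has_gradient m S f a z"
  obtains q where "\<forall>w\<in>S. f w - f z = (\<Sum>i<m. q i w * (w i - z i))"
    and "\<forall>i<m. (q i \<longlongrightarrow> a i) (near m S z)"
  using assms unfolding has_gradient_def by blast

text \<open>
For the converse direction the error \<open>\<rho> w\<close> is distributed over the coordinates in proportion to
\<open>|w i - z i|\<close>, so that each coefficient changes by at most \<open>|\<rho> w| / \<Sum>|w i - z i|\<close>, which tends to 0.
\<close>

lemma has_gradient_iff:
  "has_gradient m S f a z \<longleftrightarrow>
     (\<forall>e>0. eventually (\<lambda>w. cmod (f w - f z - (\<Sum>i<m. a i * (w i - z i)))
        \<le> e * (\<Sum>i<m. cmod (w i - z i))) (near m S z))"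
    (is "_ \<longleftrightarrow> ?eps")
proof
  assume "has_gradient m S f a z"
  then obtain q where q: "\<And>w. w \<in> S \<Longrightarrow> f w - f z = (\<Sum>i<m. q i w * (w i - z i))"
      "\<And>i. i < m \<Longrightarrow> (q i \<longlongrightarrow> a i) (near m S z)"
    unfolding has_gradient_def by blast
  show ?eps
  proof (intro allI impI)
    fix e :: real
    assume e: "e > 0"
    have "eventually (\<lambda>w. \<forall>i\<in>{..<m}. cmod (q i w - a i) < e) (near m S z)"
      using q(2) e by (intro eventually_ball_finite) (auto simp: tendsto_iff dist_norm)
    then show "eventually (\<lambda>w. cmod (f w - f z - (\<Sum>i<m. a i * (w i - z i)))
        \<le> e * (\<Sum>i<m. cmod (w i - z i))) (near m S z)"
      using eventually_near_in
    proof eventually_elim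
      case (elim w)
      have "f w - f z - (\<Sum>i<m. a i * (w i - z i)) = (\<Sum>i<m. (q i w - a i) * (w i - z i))"
        using q(1)[OF elim(2)] by (simp add: left_diff_distrib sum_subtractf)
      also have "cmod \<dots> \<le> (\<Sum>i<m. cmod (q i w - a i) * cmod (w i - z i))"
        by (rule sum_norm_le) (simp add: norm_mult)
      also have "\<dots> \<le> (\<Sum>i<m. e * cmod (w i - z i))"
        using elim(1) by (intro sum_mono mult_right_mono) (auto intro: less_imp_le)
      finally show ?case
        by (simp add: sum_distrib_left)
    qed
  qed
next
  assume eps: ?eps
  define \<rho> where "\<rho> = (\<lambda>w. f w - f z - (\<Sum>i<m. a i * (w i - z i)))"
  define D where "D = (\<lambda>w. \<Sum>i<m. cmod (w i - z i))"
  define q where "q = (\<lambda>i w. a i + (if w i = z i then 0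
      else \<rho> w * of_real (cmod (w i - z i)) / (w i - z i) / of_real (D w)))"
  have ev: "eventually (\<lambda>w. cmod (\<rho> w) \<le> e * D w) (near m S z)" if "e > 0" for e
    using eps that by (simp add: \<rho>_def D_def)
  have lim: "(q i \<longlongrightarrow> a i) (near m S z)" if "i < m" for i
    unfolding tendsto_iff
  proof (intro allI impI)
    fix e :: real
    assume e: "e > 0"
    then have "eventually (\<lambda>w. cmod (\<rho> w) \<le> e / 2 * D w) (near m S z)"
      by (intro ev) simp
    then show "eventually (\<lambda>w. dist (q i w) (a i) < e) (near m S z)"
    proof eventually_elim
      case (elim w)
      show ?case
      proof (cases "w i = z i")
        case False
        have "D w \<ge> cmod (w i - z i)"
          unfolding D_def using that by (intro member_le_sum) auto
        then have "D w > 0"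
          using False by (smt (verit) norm_le_zero_iff right_minus_eq)
        moreover have "cmod (q i w - a i) = cmod (\<rho> w) / D w"
          using False \<open>D w > 0\<close> by (simp add: q_def norm_mult norm_divide)
        ultimately show ?thesis
          using elim e by (simp add: dist_norm divide_less_eq)
            (smt (verit) mult_pos_pos)
      qed (simp add: q_def e)
    qed
  qed
  from ev[of 1] obtain d where d: "d > 0"
      "\<And>w. w \<in> S \<Longrightarrow> (\<forall>i<m. cmod (w i - z i) < d) \<Longrightarrow> cmod (\<rho> w) \<le> D w"
    unfolding eventually_near by auto
  have eq: "f w - f z = (\<Sum>i<m. q i w * (w i - z i))" if "w \<in> S" for w
  proof -
    have "(\<Sum>i<m. q i w * (w i - z i)) =
        (\<Sum>i<m. a i * (w i - z i) + \<rho> w / of_real (D w) * of_real (cmod (w i - z i)))"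
      by (intro sum.cong) (auto simp: q_def divide_simps algebra_simps)
    also have "\<dots> = (\<Sum>i<m. a i * (w i - z i)) + \<rho> w / of_real (D w) * of_real (D w)"
      by (simp add: sum.distrib D_def sum_distrib_left)
    also have "\<rho> w / of_real (D w) * of_real (D w) = \<rho> w"
    proof (cases "D w = 0")
      case True
      then have "\<forall>i<m. cmod (w i - z i) = 0"
        unfolding D_def by (subst (asm) sum_nonneg_eq_0_iff) auto
      with d(2)[OF that] d(1) True show ?thesis
        by simp
    qed auto
    finally show ?thesis
      by (simp add: \<rho>_def)
  qed
  show "has_gradient m S f a z"
    unfolding has_gradient_def using eq lim by blast
qed

lemma holomorphic_Cn_iff: "holomorphic_Cn m S f \<longleftrightarrow> (\<forall>z\<in>S. \<exists>a. has_gradient m S f a z)"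
  unfolding holomorphic_Cn_def has_gradient_iff eventually_near ..

lemma has_gradient_subset:
  assumes "has_gradient m S f a z" and "T \<subseteq> S"
  shows "has_gradient m T f a z"
proof -
  from assms(1) obtain q where "\<forall>w\<in>S. f w - f z = (\<Sum>i<m. q i w * (w i - z i))"
      "\<forall>i<m. (q i \<longlongrightarrow> a i) (near m S z)"
    by (rule has_gradientE)
  then show ?thesis
    unfolding has_gradient_def using assms(2) tendsto_mono[OF near_mono[OF assms(2)]] by blast
qed

lemma holomorphic_Cn_subset: "holomorphic_Cn m S f \<Longrightarrow> T \<subseteq> S \<Longrightarrow> holomorphic_Cn m T f"
  unfolding holomorphic_Cn_iff using has_gradient_subset by blast

lemma has_gradient_cong:
  assumes "has_gradient m S f a z" and "\<And>w. w \<in> S \<Longrightarrow> f w = g w" and "z \<in> S"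
  shows "has_gradient m S g a z"
proof -
  from assms(1) obtain q where "\<forall>w\<in>S. f w - f z = (\<Sum>i<m. q i w * (w i - z i))"
      "\<forall>i<m. (q i \<longlongrightarrow> a i) (near m S z)"
    by (rule has_gradientE)
  moreover from this(1) have "\<forall>w\<in>S. g w - g z = (\<Sum>i<m. q i w * (w i - z i))"
    using assms(2)[OF assms(3)] assms(2) by metis
  ultimately show ?thesis
    unfolding has_gradient_def by blast
qed

lemma holomorphic_Cn_cong:
  assumes "\<And>w. w \<in> S \<Longrightarrow> f w = g w"
  shows "holomorphic_Cn m S f \<longleftrightarrow> holomorphic_Cn m S g"
proof -
  have "holomorphic_Cn m S g" if "holomorphic_Cn m S f" "\<And>w. w \<in> S \<Longrightarrow> f w = g w" for f g
    using that has_gradient_cong[of m S f _ _ g] unfolding holomorphic_Cn_iff by blast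
  from this[of f g] this[of g f] assms show ?thesis
    by auto
qed

lemma has_gradient_local:
  assumes a: "\<exists>a. has_gradient m T f a z" and d: "d > 0"
    and sub: "\<And>w. w \<in> S \<Longrightarrow> \<forall>i<m. cmod (w i - z i) < d \<Longrightarrow> w \<in> T"
  shows "\<exists>a. has_gradient m S f a z"
proof -
  have "near m S z \<le> near m T z"
    unfolding le_filter_def eventually_near
  proof (intro allI impI, elim exE conjE)
    fix P d'
    assume "d' > 0" "\<forall>w\<in>T. (\<forall>i<m. cmod (w i - z i) < d') \<longrightarrow> P w"
    then show "\<exists>d>0. \<forall>w\<in>S. (\<forall>i<m. cmod (w i - z i) < d) \<longrightarrow> P w"
      using d sub by (intro exI[of _ "min d d'"]) auto
  qed
  then show ?thesis
    using a unfolding has_gradient_iff le_filter_def by blast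
qed

lemma has_gradient_tendsto:
  assumes "has_gradient m S f a z"
  shows "(f \<longlongrightarrow> f z) (near m S z)"
proof -
  obtain q where q: "\<And>w. w \<in> S \<Longrightarrow> f w - f z = (\<Sum>i<m. q i w * (w i - z i))"
      "\<And>i. i < m \<Longrightarrow> (q i \<longlongrightarrow> a i) (near m S z)"
    using assms unfolding has_gradient_def by blast
  have "((\<lambda>w. f z + (\<Sum>i<m. q i w * (w i - z i))) \<longlongrightarrow> f z + (\<Sum>i<m. a i * (z i - z i))) (near m S z)"
    by (intro tendsto_intros q(2) tendsto_near_coordinate) auto
  then have "((\<lambda>w. f z + (\<Sum>i<m. q i w * (w i - z i))) \<longlongrightarrow> f z) (near m S z)"
    by simp
  moreover have "eventually (\<lambda>w. f z + (\<Sum>i<m. q i w * (w i - z i)) = f w) (near m S z)"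
    using eventually_near_in by eventually_elim (simp flip: q(1))
  ultimately show ?thesis
    by (rule Lim_transform_eventually)
qed

lemma holomorphic_Cn_const: "holomorphic_Cn m S (\<lambda>z. c)"
  unfolding holomorphic_Cn_iff has_gradient_def
  by (intro ballI exI[of _ "\<lambda>i. 0"] exI[of _ "\<lambda>i w. 0"]) auto

lemma holomorphic_Cn_coordinate: "i < m \<Longrightarrow> holomorphic_Cn m S (\<lambda>z. z i)"
  unfolding holomorphic_Cn_iff has_gradient_def
  by (intro ballI exI[of _ "\<lambda>j. if j = i then 1 else 0"] exI[of _ "\<lambda>j w. if j = i then 1 else 0"])
     (auto simp: if_distrib[where f = "\<lambda>x. x * _"] cong: if_cong)

lemma holomorphic_Cn_diff:
  assumes "holomorphic_Cn m S f" and "holomorphic_Cn m S g"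
  shows "holomorphic_Cn m S (\<lambda>z. f z - g z)"
  unfolding holomorphic_Cn_iff
proof
  fix z
  assume "z \<in> S"
  with assms obtain a b where ab: "has_gradient m S f a z" "has_gradient m S g b z"
    unfolding holomorphic_Cn_iff by blast
  from ab(1) obtain p where p: "\<forall>w\<in>S. f w - f z = (\<Sum>i<m. p i w * (w i - z i))"
      "\<forall>i<m. (p i \<longlongrightarrow> a i) (near m S z)"
    by (rule has_gradientE)
  from ab(2) obtain q where q: "\<forall>w\<in>S. g w - g z = (\<Sum>i<m. q i w * (w i - z i))"
      "\<forall>i<m. (q i \<longlongrightarrow> b i) (near m S z)"
    by (rule has_gradientE)
  show "\<exists>a. has_gradient m S (\<lambda>z. f z - g z) a z"
    unfolding has_gradient_def
  proof (intro exI[of _ "\<lambda>i. a i - b i"] exI[of _ "\<lambda>i w. p i w - q i w"] conjI ballI allI impI)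
    fix w
    assume "w \<in> S"
    have "(f w - g w) - (f z - g z) = (f w - f z) - (g w - g z)"
      by simp
    then show "(f w - g w) - (f z - g z) = (\<Sum>i<m. (p i w - q i w) * (w i - z i))"
      using p(1)[rule_format, OF \<open>w \<in> S\<close>] q(1)[rule_format, OF \<open>w \<in> S\<close>]
      by (simp add: sum_subtractf left_diff_distrib)
  qed (intro tendsto_intros p(2)[rule_format] q(2)[rule_format])
qed

lemma holomorphic_Cn_mult:
  assumes "holomorphic_Cn m S f" and "holomorphic_Cn m S g"
  shows "holomorphic_Cn m S (\<lambda>z. f z * g z)"
  unfolding holomorphic_Cn_iff
proof
  fix z
  assume "z \<in> S"
  with assms obtain a b where ab: "has_gradient m S f a z" "has_gradient m S g b z"
    unfolding holomorphic_Cn_iff by blast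
  from ab(1) obtain p where p: "\<forall>w\<in>S. f w - f z = (\<Sum>i<m. p i w * (w i - z i))"
      "\<forall>i<m. (p i \<longlongrightarrow> a i) (near m S z)"
    by (rule has_gradientE)
  from ab(2) obtain q where q: "\<forall>w\<in>S. g w - g z = (\<Sum>i<m. q i w * (w i - z i))"
      "\<forall>i<m. (q i \<longlongrightarrow> b i) (near m S z)"
    by (rule has_gradientE)
  show "\<exists>a. has_gradient m S (\<lambda>z. f z * g z) a z"
    unfolding has_gradient_def
  proof (intro exI[of _ "\<lambda>i. f z * b i + g z * a i"] exI[of _ "\<lambda>i w. f w * q i w + g z * p i w"]
      conjI ballI allI impI)
    fix w
    assume "w \<in> S"
    have "f w * g w - f z * g z = f w * (g w - g z) + g z * (f w - f z)"
      by (simp add: algebra_simps)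
    then show "f w * g w - f z * g z = (\<Sum>i<m. (f w * q i w + g z * p i w) * (w i - z i))"
      using p(1)[rule_format, OF \<open>w \<in> S\<close>] q(1)[rule_format, OF \<open>w \<in> S\<close>]
      by (simp add: sum.distrib sum_distrib_left distrib_right mult.assoc)
  qed (intro tendsto_intros p(2)[rule_format] q(2)[rule_format] has_gradient_tendsto[OF ab(1)])
qed

lemma holomorphic_Cn_inverse:
  assumes "holomorphic_Cn m S f" and nz: "\<And>z. z \<in> S \<Longrightarrow> f z \<noteq> 0"
  shows "holomorphic_Cn m S (\<lambda>z. 1 / f z)"
  unfolding holomorphic_Cn_iff
proof
  fix z
  assume z: "z \<in> S"
  with assms obtain a where a: "has_gradient m S f a z"
    unfolding holomorphic_Cn_iff by blast
  then obtain p where p: "\<forall>w\<in>S. f w - f z = (\<Sum>i<m. p i w * (w i - z i))"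
      "\<forall>i<m. (p i \<longlongrightarrow> a i) (near m S z)"
    by (rule has_gradientE)
  show "\<exists>a. has_gradient m S (\<lambda>z. 1 / f z) a z"
    unfolding has_gradient_def
  proof (intro exI[of _ "\<lambda>i. - (1 / (f z * f z)) * a i"] exI[of _ "\<lambda>i w. - (1 / (f w * f z)) * p i w"]
      conjI ballI allI impI)
    fix w
    assume w: "w \<in> S"
    have "1 / f w - 1 / f z = - (1 / (f w * f z)) * (f w - f z)"
      using nz[OF w] nz[OF z] by (simp add: field_simps)
    then show "1 / f w - 1 / f z = (\<Sum>i<m. - (1 / (f w * f z)) * p i w * (w i - z i))"
      by (simp only: p(1)[rule_format, OF w] sum_distrib_left mult.assoc)
  qed (use nz[OF z] in \<open>intro tendsto_intros p(2)[rule_format] has_gradient_tendsto[OF a]; simp\<close>)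
qed

lemma holomorphic_Cn_compose:
  assumes f: "holomorphic_Cn m T f" and g: "\<And>j. j < m \<Longrightarrow> holomorphic_Cn k S (\<lambda>z. g z j)"
    and ST: "\<And>z. z \<in> S \<Longrightarrow> g z \<in> T"
  shows "holomorphic_Cn k S (\<lambda>z. f (g z))"
  unfolding holomorphic_Cn_iff
proof
  fix z
  assume z: "z \<in> S"
  with f ST obtain a where a: "has_gradient m T f a (g z)"
    unfolding holomorphic_Cn_iff by blast
  then obtain p where p: "\<forall>w\<in>T. f w - f (g z) = (\<Sum>i<m. p i w * (w i - g z i))"
      "\<forall>i<m. (p i \<longlongrightarrow> a i) (near m T (g z))"
    by (rule has_gradientE)
  have "\<forall>j. \<exists>b. j < m \<longrightarrow> has_gradient k S (\<lambda>z. g z j) b z"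
    using g z unfolding holomorphic_Cn_iff by blast
  then obtain b where b: "\<And>j. j < m \<Longrightarrow> has_gradient k S (\<lambda>z. g z j) (b j) z"
    by metis
  then have "\<forall>j\<in>{..<m}. \<exists>q. (\<forall>w\<in>S. g w j - g z j = (\<Sum>i<k. q i w * (w i - z i))) \<and>
          (\<forall>i<k. (q i \<longlongrightarrow> b j i) (near k S z))"
    unfolding has_gradient_def by blast
  from bchoice[OF this] obtain q where "\<forall>j\<in>{..<m}. (\<forall>w\<in>S. g w j - g z j = (\<Sum>i<k. q j i w * (w i - z i))) \<and>
          (\<forall>i<k. (q j i \<longlongrightarrow> b j i) (near k S z))" ..
  then have q: "\<And>j w. j < m \<Longrightarrow> w \<in> S \<Longrightarrow> g w j - g z j = (\<Sum>i<k. q j i w * (w i - z i))"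
      "\<And>j i. j < m \<Longrightarrow> i < k \<Longrightarrow> (q j i \<longlongrightarrow> b j i) (near k S z)"
    by auto
  have lim: "filterlim g (near m T (g z)) (near k S z)"
  proof (rule filterlim_near)
    show "\<forall>\<^sub>F x in near k S z. g x \<in> T"
      using eventually_near_in by eventually_elim (rule ST)
  qed (use has_gradient_tendsto[OF b] in simp)
  show "\<exists>a. has_gradient k S (\<lambda>z. f (g z)) a z"
    unfolding has_gradient_def
  proof (intro exI[of _ "\<lambda>i. \<Sum>j<m. a j * b j i"] exI[of _ "\<lambda>i w. \<Sum>j<m. p j (g w) * q j i w"]
      conjI ballI allI impI)
    fix w
    assume w: "w \<in> S"
    have "f (g w) - f (g z) = (\<Sum>j<m. p j (g w) * (\<Sum>i<k. q j i w * (w i - z i)))"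
      using p(1)[rule_format, OF ST[OF w]] q(1)[OF _ w] by simp
    also have "\<dots> = (\<Sum>j<m. \<Sum>i<k. p j (g w) * q j i w * (w i - z i))"
      by (simp add: sum_distrib_left mult.assoc)
    also have "\<dots> = (\<Sum>i<k. (\<Sum>j<m. p j (g w) * q j i w) * (w i - z i))"
      by (subst sum.swap) (simp add: sum_distrib_right)
    finally show "f (g w) - f (g z) = (\<Sum>i<k. (\<Sum>j<m. p j (g w) * q j i w) * (w i - z i))" .
  next
    fix i
    assume i: "i < k"
    show "((\<lambda>w. \<Sum>j<m. p j (g w) * q j i w) \<longlongrightarrow> (\<Sum>j<m. a j * b j i)) (near k S z)"
      by (intro tendsto_intros q(2) i filterlim_compose[OF p(2)[rule_format] lim]) auto
  qed
qed

lemma has_gradient_line: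
  assumes grad: "has_gradient m S f a (\<lambda>i. z i + t * v i)"
    and S: "\<And>s. s \<in> T \<Longrightarrow> (\<lambda>i. z i + s * v i) \<in> S"
  shows "((\<lambda>s. f (\<lambda>i. z i + s * v i)) has_field_derivative (\<Sum>i<m. a i * v i)) (at t within T)"
proof -
  obtain q where q: "\<And>w. w \<in> S \<Longrightarrow> f w - f (\<lambda>i. z i + t * v i) = (\<Sum>i<m. q i w * (w i - (z i + t * v i)))"
      "\<And>i. i < m \<Longrightarrow> (q i \<longlongrightarrow> a i) (near m S (\<lambda>i. z i + t * v i))"
    using grad unfolding has_gradient_def by blast
  have T: "eventually (\<lambda>s. s \<in> T) (at t within T)"
    by (simp add: eventually_at_filter)
  have lim: "filterlim (\<lambda>s i. z i + s * v i) (near m S (\<lambda>i. z i + t * v i)) (at t within T)"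
  proof (rule filterlim_near)
    show "\<forall>\<^sub>F s in at t within T. (\<lambda>i. z i + s * v i) \<in> S"
      using T by eventually_elim (rule S)
  qed (intro tendsto_intros)
  have "((\<lambda>s. \<Sum>i<m. q i (\<lambda>i. z i + s * v i) * v i) \<longlongrightarrow> (\<Sum>i<m. a i * v i)) (at t within T)"
    by (intro tendsto_intros filterlim_compose[OF q(2) lim]) auto
  moreover have "eventually (\<lambda>s. (\<Sum>i<m. q i (\<lambda>i. z i + s * v i) * v i) =
      (f (\<lambda>i. z i + s * v i) - f (\<lambda>i. z i + t * v i)) / (s - t)) (at t within T)"
  proof -
    have "eventually (\<lambda>s. s \<in> T \<and> s \<noteq> t) (at t within T)"
      by (simp add: eventually_at_filter)
    then show ?thesis
    proof eventually_elim
      case (elim s)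
      have "f (\<lambda>i. z i + s * v i) - f (\<lambda>i. z i + t * v i) =
          (\<Sum>i<m. q i (\<lambda>i. z i + s * v i) * (z i + s * v i - (z i + t * v i)))"
        using q(1)[OF S] elim by blast
      also have "\<dots> = (\<Sum>i<m. (q i (\<lambda>i. z i + s * v i) * v i) * (s - t))"
        by (intro sum.cong) (auto simp: algebra_simps)
      also have "\<dots> = (\<Sum>i<m. q i (\<lambda>i. z i + s * v i) * v i) * (s - t)"
        by (simp add: sum_distrib_right)
      finally show ?case
        using elim by simp
    qed
  qed
  ultimately show ?thesis
    unfolding has_field_derivative_iff by (rule Lim_transform_eventually)
qed

lemma holomorphic_Cn_line:
  assumes "holomorphic_Cn m S f" and "\<And>s. s \<in> T \<Longrightarrow> (\<lambda>i. z i + s * v i) \<in> S"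
  shows "(\<lambda>s. f (\<lambda>i. z i + s * v i)) holomorphic_on T"
  unfolding holomorphic_on_def field_differentiable_def
proof
  fix t
  assume "t \<in> T"
  then obtain a where "has_gradient m S f a (\<lambda>i. z i + t * v i)"
    using assms unfolding holomorphic_Cn_iff by blast
  from has_gradient_line[OF this assms(2)]
  show "\<exists>f'. ((\<lambda>s. f (\<lambda>i. z i + s * v i)) has_field_derivative f') (at t within T)"
    by blast
qed

section \<open>Divided differences and the Hadamard expansion\<close>

definition polydisc :: "nat \<Rightarrow> (nat \<Rightarrow> complex) \<Rightarrow> real \<Rightarrow> (nat \<Rightarrow> complex) set" where
  "polydisc m c r = {z. (\<forall>i<m. cmod (z i - c i) < r) \<and> (\<forall>i\<ge>m. z i = 0)}"

lemma polydisc_mono: "r \<le> s \<Longrightarrow> polydisc m c r \<subseteq> polydisc m c s"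
  unfolding polydisc_def by force

lemma polydisc_absorb:
  assumes "z \<in> polydisc m c r"
  obtains s where "s > 0" and "polydisc m z s \<subseteq> polydisc m c r"
proof
  define s where "s = Min (insert 1 ((\<lambda>i. r - cmod (z i - c i)) ` {..<m}))"
  show "s > 0"
    using assms by (auto simp: s_def polydisc_def)
  have s: "s \<le> r - cmod (z i - c i)" if "i < m" for i
    unfolding s_def using that by (intro Min_le) auto
  show "polydisc m z s \<subseteq> polydisc m c r"
  proof
    fix w
    assume w: "w \<in> polydisc m z s"
    have "cmod (w i - c i) < r" if "i < m" for i
    proof -
      have "cmod (w i - c i) \<le> cmod (w i - z i) + cmod (z i - c i)"
        using norm_triangle_ineq[of "w i - z i" "z i - c i"] by simp
      with s[OF that] w that show ?thesis
        by (auto simp: polydisc_def)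
    qed
    with w show "w \<in> polydisc m c r"
      by (simp add: polydisc_def)
  qed
qed

lemma holomorphic_Cn_locally_bounded:
  assumes "holomorphic_Cn m (polydisc m c r) f" and z: "z \<in> polydisc m c r"
  obtains s B where "s > 0" and "polydisc m z s \<subseteq> polydisc m c r"
    and "\<And>w. w \<in> polydisc m z s \<Longrightarrow> cmod (f w) < B"
proof -
  from assms obtain a where "has_gradient m (polydisc m c r) f a z"
    unfolding holomorphic_Cn_iff by blast
  from has_gradient_tendsto[OF this]
  have "eventually (\<lambda>w. dist (f w) (f z) < 1) (near m (polydisc m c r) z)"
    by (simp add: tendsto_iff)
  then obtain d where d: "d > 0"
      "\<forall>w\<in>polydisc m c r. (\<forall>i<m. cmod (w i - z i) < d) \<longrightarrow> dist (f w) (f z) < 1"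
    unfolding eventually_near by blast
  obtain s where s: "s > 0" "polydisc m z s \<subseteq> polydisc m c r"
    by (rule polydisc_absorb[OF z])
  show ?thesis
  proof (rule that[of "min s d" "cmod (f z) + 1"])
    show "min s d > 0"
      using s d by simp
    show sub: "polydisc m z (min s d) \<subseteq> polydisc m c r"
      using s(2) polydisc_mono[of "min s d" s] by fastforce
    fix w
    assume w: "w \<in> polydisc m z (min s d)"
    then have "dist (f w) (f z) < 1"
      using d(2) sub by (auto simp: polydisc_def)
    then show "cmod (f w) < cmod (f z) + 1"
      by (smt (verit) dist_norm norm_triangle_sub)
  qed
qed

lemma line_in_polydisc:
  assumes z: "z \<in> polydisc m c r" and v: "\<And>i. i \<ge> m \<Longrightarrow> v i = 0"
    and R: "\<And>i. i < m \<Longrightarrow> cmod (z i - c i) + R * cmod (v i) \<le> r" and t: "t \<in> ball 0 R"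
  shows "(\<lambda>i. z i + t * v i) \<in> polydisc m c r"
proof -
  have "cmod (z i + t * v i - c i) < r" if "i < m" for i
  proof (cases "v i = 0")
    case True
    then show ?thesis
      using z that by (simp add: polydisc_def)
  next
    case False
    have "cmod (z i + t * v i - c i) \<le> cmod (z i - c i) + cmod (t * v i)"
      using norm_triangle_ineq[of "z i - c i" "t * v i"] by (simp add: algebra_simps)
    also have "\<dots> < cmod (z i - c i) + R * cmod (v i)"
      using False t by (simp add: norm_mult)
    finally show ?thesis
      using R[OF that] by simp
  qed
  then show ?thesis
    using z v by (auto simp: polydisc_def)
qed

lemma gradient_as_line_derivative:
  assumes "has_gradient m S f a z" and "open T" "0 \<in> T"
    and "\<And>s. s \<in> T \<Longrightarrow> (\<lambda>i. z i + s * v i) \<in> S"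
  shows "deriv (\<lambda>s. f (\<lambda>i. z i + s * v i)) 0 = (\<Sum>i<m. a i * v i)"
  using has_gradient_line[of m S f a z 0 v T] assms
  by (simp add: at_within_open[of 0 T] DERIV_imp_deriv)

text \<open>
By compactness the bounded coefficient vectors \<open>a k\<close> have a limit point, and the common quadratic error bound
survives the passage to the limit, so that this limit point is a gradient at \<open>z\<close>.
\<close>

lemma has_gradient_limit:
  fixes G :: "(nat \<Rightarrow> complex) \<Rightarrow> complex"
  assumes s: "s > 0" and S: "\<And>w. w \<in> S \<Longrightarrow> (\<forall>i<m. cmod (w i - z i) < s) \<Longrightarrow> w \<in> S'"
    and quad: "\<And>k w. w \<in> S' \<Longrightarrow>
      cmod (G w - G (y k) - (\<Sum>i<m. a k i * (w i - y k i))) \<le> C * (\<Sum>i<m. cmod (w i - y k i))\<^sup>2"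
    and bound: "\<And>k i. i < m \<Longrightarrow> cmod (a k i) \<le> B"
    and lim: "\<And>i. i < m \<Longrightarrow> (\<lambda>k. y k i) \<longlonglongrightarrow> z i" and limG: "(\<lambda>k. G (y k)) \<longlonglongrightarrow> G z"
  shows "\<exists>a. has_gradient m S G a z"
proof -
  \<comment> \<open>Coefficients beyond \<open>m\<close> are arbitrary; setting them to 0 puts all sequences in a product of discs.\<close>
  define a' where "a' = (\<lambda>k i. if i < m then a k i else 0)"
  have "compactin (product_topology (\<lambda>i. euclidean) UNIV) (PiE UNIV (\<lambda>i::nat. cball (0::complex) (\<bar>B\<bar>)))"
    by (simp add: compactin_PiE)
  then have "compact (PiE UNIV (\<lambda>i::nat. cball (0::complex) (\<bar>B\<bar>)))"
    by (simp add: euclidean_product_topology)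
  then have "seq_compact (PiE UNIV (\<lambda>i::nat. cball (0::complex) (\<bar>B\<bar>)))"
    by (rule compact_imp_seq_compact)
  moreover have "a' k \<in> PiE UNIV (\<lambda>i::nat. cball (0::complex) (\<bar>B\<bar>))" for k
  proof -
    have "cmod (a' k i) \<le> \<bar>B\<bar>" for i
      using bound[of i k] by (auto simp: a'_def)
    then show ?thesis
      by auto
  qed
  ultimately obtain l \<rho> where \<rho>: "strict_mono (\<rho> :: nat \<Rightarrow> nat)" "(a' \<circ> \<rho>) \<longlonglongrightarrow> l"
    unfolding seq_compact_def by metis
  have l: "(\<lambda>k. a' (\<rho> k) i) \<longlonglongrightarrow> l i" for i
  proof -
    have "isCont (\<lambda>f::nat \<Rightarrow> complex. f i) l"
      by (metis continuous_on_eq_continuous_at continuous_on_product_coordinates open_UNIV UNIV_I)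
    from isCont_tendsto_compose[OF this \<rho>(2)] show ?thesis
      by (simp add: o_def)
  qed
  have l': "(\<lambda>k. a (\<rho> k) i) \<longlonglongrightarrow> l i" if "i < m" for i
    using l[of i] that by (simp add: a'_def)
  have y': "(\<lambda>k. y (\<rho> k) i) \<longlonglongrightarrow> z i" if "i < m" for i
    using LIMSEQ_subseq_LIMSEQ[OF lim[OF that] \<rho>(1)] by (simp add: o_def)
  have G': "(\<lambda>k. G (y (\<rho> k))) \<longlonglongrightarrow> G z"
    using LIMSEQ_subseq_LIMSEQ[OF limG \<rho>(1)] by (simp add: o_def)
  have quad_lim: "cmod (G w - G z - (\<Sum>i<m. l i * (w i - z i))) \<le> C * (\<Sum>i<m. cmod (w i - z i))\<^sup>2"
    if "w \<in> S'" for w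
  proof (rule tendsto_le[OF sequentially_bot])
    show "(\<lambda>k. C * (\<Sum>i<m. cmod (w i - y (\<rho> k) i))\<^sup>2) \<longlonglongrightarrow> C * (\<Sum>i<m. cmod (w i - z i))\<^sup>2"
      by (intro tendsto_intros y') auto
    show "(\<lambda>k. cmod (G w - G (y (\<rho> k)) - (\<Sum>i<m. a (\<rho> k) i * (w i - y (\<rho> k) i))))
        \<longlonglongrightarrow> cmod (G w - G z - (\<Sum>i<m. l i * (w i - z i)))"
      by (intro tendsto_intros y' l' G') auto
  qed (use quad[OF that] in auto)
  have "has_gradient m S G l z"
    unfolding has_gradient_iff
  proof (intro allI impI)
    fix e :: real
    assume e: "e > 0"
    define d where "d = min s (e / ((\<bar>C\<bar> + 1) * (real m + 1)))"
    have "d > 0"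
      using s e by (simp add: d_def)
    moreover have "cmod (G w - G z - (\<Sum>i<m. l i * (w i - z i))) \<le> e * (\<Sum>i<m. cmod (w i - z i))"
      if w: "w \<in> S" "\<forall>i<m. cmod (w i - z i) < d" for w
    proof -
      let ?D = "\<Sum>i<m. cmod (w i - z i)"
      have "?D \<le> (\<Sum>i<m. d)"
        using w(2) by (intro sum_mono) (auto intro: less_imp_le)
      also have "\<dots> = real m * d"
        by simp
      also have "\<dots> \<le> (real m + 1) * (e / ((\<bar>C\<bar> + 1) * (real m + 1)))"
      proof (rule mult_mono)
        show "d \<le> e / ((\<bar>C\<bar> + 1) * (real m + 1))"
          unfolding d_def by (rule min.cobounded2)
      qed (use \<open>d > 0\<close> in auto)
      also have "\<dots> = e / (\<bar>C\<bar> + 1)"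
        by simp
      finally have D: "(\<bar>C\<bar> + 1) * ?D \<le> e"
        by (simp add: field_simps)
      have D0: "?D \<ge> 0"
        by (intro sum_nonneg) auto
      have "w \<in> S'"
        using w by (intro S) (auto simp: d_def)
      from quad_lim[OF this]
      have "cmod (G w - G z - (\<Sum>i<m. l i * (w i - z i))) \<le> C * ?D\<^sup>2" .
      also have "\<dots> \<le> ((\<bar>C\<bar> + 1) * ?D) * ?D"
        using D0 by (simp add: power2_eq_square mult.assoc) (intro mult_right_mono; simp)
      also have "\<dots> \<le> e * ?D"
        using D D0 by (intro mult_right_mono) auto
      finally show ?thesis .
    qed
    ultimately show "eventually (\<lambda>w. cmod (G w - G z - (\<Sum>i<m. l i * (w i - z i)))
        \<le> e * (\<Sum>i<m. cmod (w i - z i))) (near m S z)"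
      unfolding eventually_near by blast
  qed
  then show ?thesis
    by blast
qed

lemma holomorphic_Cn_update:
  assumes "holomorphic_Cn m (polydisc m c r) F" and "i < m" and "r > 0"
  shows "holomorphic_Cn m (polydisc m c r) (\<lambda>z. F (z(i := c i)))"
proof (rule holomorphic_Cn_compose[OF assms(1)])
  fix j
  assume "j < m"
  then show "holomorphic_Cn m (polydisc m c r) (\<lambda>z. (z(i := c i)) j)"
    by (cases "j = i") (auto intro: holomorphic_Cn_const holomorphic_Cn_coordinate)
qed (use assms in \<open>auto simp: polydisc_def\<close>)

text \<open>
The divided difference of \<open>F\<close> in the direction of the coordinate \<open>i\<close>, with base value \<open>c i\<close>. The gradients of \<open>F\<close>
supply its values on the hyperplane \<open>z i = c i\<close>.
\<close>

locale divided_difference =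
  fixes m :: nat and c :: "nat \<Rightarrow> complex" and r :: real and F :: "(nat \<Rightarrow> complex) \<Rightarrow> complex"
    and i :: nat and A :: "(nat \<Rightarrow> complex) \<Rightarrow> nat \<Rightarrow> complex"
  assumes r: "r > 0" and i: "i < m"
    and grad: "\<And>z. z \<in> polydisc m c r \<Longrightarrow> has_gradient m (polydisc m c r) F (A z) z"
begin

abbreviation "P \<equiv> polydisc m c r"

definition quotient :: "(nat \<Rightarrow> complex) \<Rightarrow> complex" where
  "quotient z = (if z i = c i then A z i else (F z - F (z(i := c i))) / (z i - c i))"

lemma hol: "holomorphic_Cn m P F"
  using grad holomorphic_Cn_iff by blast

lemma update_in: "z \<in> P \<Longrightarrow> z(i := c i) \<in> P"
  using r i by (auto simp: polydisc_def)

lemma quotient_off_hyperplane: "holomorphic_Cn m {z \<in> P. z i \<noteq> c i} quotient"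
proof -
  have "holomorphic_Cn m {z \<in> P. z i \<noteq> c i}
      (\<lambda>z. (F z - F (z(i := c i))) * (1 / (z i - c i)))"
    using i
    by (intro holomorphic_Cn_mult holomorphic_Cn_diff holomorphic_Cn_inverse holomorphic_Cn_const
        holomorphic_Cn_coordinate holomorphic_Cn_subset[OF hol]
        holomorphic_Cn_subset[OF holomorphic_Cn_update[OF hol i r]]) auto
  then show ?thesis
    by (rule holomorphic_Cn_cong[THEN iffD1, rotated]) (simp add: quotient_def)
qed

text \<open>
A line through a point off the hyperplane meets it at most once, and the singularity there is removable; the removable
value is the derivative of the numerator divided by \<open>v i\<close>, which is the \<open>i\<close>-th partial derivative of \<open>F\<close>.
\<close>

lemma quotient_on_lines:
  assumes z: "z \<in> P" "z i \<noteq> c i" and R: "R > 0"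
    and line: "\<And>t. t \<in> ball 0 R \<Longrightarrow> (\<lambda>j. z j + t * v j) \<in> P"
  shows "(\<lambda>t. quotient (\<lambda>j. z j + t * v j)) holomorphic_on ball 0 R"
proof -
  define z' v' where "z' = z(i := c i)" and "v' = v(i := 0)"
  define N where "N = (\<lambda>t. F (\<lambda>j. z j + t * v j) - F (\<lambda>j. z' j + t * v' j))"
  have upd: "(\<lambda>j. z' j + t * v' j) = (\<lambda>j. z j + t * v j)(i := c i)" for t
    by (auto simp: z'_def v'_def)
  have line': "(\<lambda>j. z' j + t * v' j) \<in> P" if "t \<in> ball 0 R" for t
    unfolding upd by (rule update_in[OF line[OF that]])
  have hol_N: "N holomorphic_on ball 0 R"
    unfolding N_def by (intro holomorphic_intros holomorphic_Cn_line[OF hol] line line')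
  have quotient_eq: "quotient (\<lambda>j. z j + t * v j) = N t / (z i - c i + t * v i)" if "z i + t * v i \<noteq> c i" for t
    using that by (simp add: quotient_def N_def upd algebra_simps)
  show ?thesis
  proof (cases "\<exists>t0\<in>ball 0 R. z i + t0 * v i = c i")
    case False
    then have "(\<lambda>t. N t / (z i - c i + t * v i)) holomorphic_on ball 0 R"
      by (intro holomorphic_intros hol_N) (auto simp: algebra_simps)
    then show ?thesis
      by (rule holomorphic_transform) (use False quotient_eq in auto)
  next
    case True
    then obtain t0 where t0: "t0 \<in> ball 0 R" "z i + t0 * v i = c i"
      by blast
    then have vi: "v i \<noteq> 0"
      using z(2) by auto
    have same: "(\<lambda>j. z' j + t0 * v' j) = (\<lambda>j. z j + t0 * v j)"
      unfolding upd using t0(2) by auto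
    have N0: "N t0 = 0"
      by (simp add: N_def same)
    let ?u = "\<lambda>j. z j + t0 * v j"
    have gu: "has_gradient m P F (A ?u) ?u"
      by (rule grad[OF line[OF t0(1)]])
    have "(N has_field_derivative (\<Sum>j<m. A ?u j * v j) - (\<Sum>j<m. A ?u j * v' j)) (at t0 within ball 0 R)"
      unfolding N_def
      by (intro DERIV_diff has_gradient_line[of m P F] line line')
         (use gu in \<open>simp_all only: same\<close>)
    moreover have "(\<Sum>j<m. A ?u j * v j) - (\<Sum>j<m. A ?u j * v' j) = A ?u i * v i"
    proof -
      have "(\<Sum>j<m. A ?u j * v j) - (\<Sum>j<m. A ?u j * v' j) = (\<Sum>j<m. if j = i then A ?u i * v i else 0)"
        by (simp only: flip: sum_subtractf) (intro sum.cong, auto simp: v'_def)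
      then show ?thesis
        using i by simp
    qed
    ultimately have dN: "deriv N t0 = A ?u i * v i"
      using t0(1) by (simp add: at_within_open[of t0 "ball 0 R"] DERIV_imp_deriv)
    have "(\<lambda>t. (if t = t0 then deriv N t0 else (N t - N t0) / (t - t0)) / v i) holomorphic_on ball 0 R"
      using vi by (intro holomorphic_intros pole_lemma_open hol_N) auto
    then show ?thesis
    proof (rule holomorphic_transform)
      fix t :: complex
      show "(if t = t0 then deriv N t0 else (N t - N t0) / (t - t0)) / v i = quotient (\<lambda>j. z j + t * v j)"
      proof (cases "t = t0")
        case True
        then show ?thesis
          using vi t0(2) by (simp add: dN quotient_def)
      next
        case False
        have eq: "z i - c i + t * v i = (t - t0) * v i"
          using t0(2) by (simp add: algebra_simps)
        then have "z i + t * v i \<noteq> c i"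
          using False vi by (metis add_diff_eq diff_add_eq eq_iff_diff_eq_0 mult_eq_0_iff add.commute)
        from quotient_eq[OF this] show ?thesis
          using False vi by (simp add: eq N0)
      qed
    qed
  qed
qed

lemma quotient_on_axis:
  assumes z: "z \<in> P" "z i = c i" and R: "R > 0"
    and line: "\<And>t. t \<in> ball 0 R \<Longrightarrow> z(i := z i + t) \<in> P"
  shows "(\<lambda>t. F (z(i := z i + t))) holomorphic_on ball 0 R"
    and "t \<in> ball 0 R \<Longrightarrow> quotient (z(i := z i + t)) =
      (if t = 0 then deriv (\<lambda>t. F (z(i := z i + t))) 0 else (F (z(i := z i + t)) - F z) / t)"
proof -
  define v :: "nat \<Rightarrow> complex" where "v = (\<lambda>j. if j = i then 1 else 0)"
  have upd: "z(i := z i + t) = (\<lambda>j. z j + t * v j)" for t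
    by (auto simp: v_def)
  show "(\<lambda>t. F (z(i := z i + t))) holomorphic_on ball 0 R"
    unfolding upd by (rule holomorphic_Cn_line[OF hol]) (use line in \<open>simp add: upd\<close>)
  have "deriv (\<lambda>t. F (\<lambda>j. z j + t * v j)) 0 = (\<Sum>j<m. A z j * v j)"
    by (rule gradient_as_line_derivative[OF grad[OF z(1)], of "ball 0 R"])
       (use line R in \<open>simp_all add: upd\<close>)
  also have "\<dots> = A z i"
    using i by (simp add: v_def if_distrib[where f = "\<lambda>x. _ * x"] cong: if_cong)
  finally have d: "deriv (\<lambda>t. F (z(i := z i + t))) 0 = A z i"
    by (simp only: upd)
  show "quotient (z(i := z i + t)) =
      (if t = 0 then deriv (\<lambda>t. F (z(i := z i + t))) 0 else (F (z(i := z i + t)) - F z) / t)"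
    if "t \<in> ball 0 R"
  proof -
    have "z(i := c i) = z"
      using z(2) by auto
    then show ?thesis
      using d z(2) by (simp add: quotient_def)
  qed
qed

text \<open>
Moving only the coordinate \<open>i\<close> away from the hyperplane, the Schwarz lemma bounds the difference quotient by the
size of \<open>F\<close>.
\<close>

lemma quotient_locally_bounded:
  assumes z: "z \<in> P" "z i = c i"
  obtains s B where "s > 0" and "polydisc m z s \<subseteq> P"
    and "\<And>w. w \<in> polydisc m z s \<Longrightarrow> cmod (quotient w) < B"
proof -
  from holomorphic_Cn_locally_bounded[OF hol z(1)] obtain s B where s: "s > 0"
    and sub: "polydisc m z s \<subseteq> P"
    and B: "\<And>w. w \<in> polydisc m z s \<Longrightarrow> cmod (F w) < B"
    by metis
  show ?thesis
  proof (rule that[of "s" "2 * B / s + 1"])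
    fix w
    assume w: "w \<in> polydisc m z s"
    define w0 where "w0 = w(i := z i)"
    have w_eq: "w = w0(i := w0 i + (w i - z i))"
      by (simp add: w0_def)
    have line: "w0(i := w0 i + t) \<in> polydisc m z s" if "t \<in> ball 0 s" for t
      using w that i by (auto simp: w0_def polydisc_def)
    have w0: "w0 \<in> P" "w0 i = c i"
      using line[of 0] s sub z(2) by (auto simp: w0_def)
    have t: "w i - z i \<in> ball 0 s"
      using w i by (auto simp: polydisc_def)
    let ?\<gamma> = "\<lambda>t. F (w0(i := w0 i + t))"
    have hol_\<gamma>: "?\<gamma> holomorphic_on ball 0 s"
      by (rule quotient_on_axis(1)[OF w0 s]) (use line sub in blast)
    have quotient_w: "quotient w = (if w i - z i = 0 then deriv ?\<gamma> 0 else (?\<gamma> (w i - z i) - F w0) / (w i - z i))"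
      by (subst w_eq, rule quotient_on_axis(2)[OF w0 s _ t]) (use line sub in blast)
    have "cmod (quotient w) \<le> 2 * B / s"
    proof (cases "w i - z i = 0")
      case True
      then show ?thesis
        using schwarz_disc(2)[OF hol_\<gamma> s B[OF line]] quotient_w by simp
    next
      case False
      then have "cmod (quotient w) = cmod (?\<gamma> (w i - z i) - ?\<gamma> 0) / cmod (w i - z i)"
        using quotient_w by (simp add: norm_divide)
      also have "\<dots> \<le> 2 * B / s"
        using schwarz_disc(1)[OF hol_\<gamma> s B[OF line] t] False by (simp add: divide_le_eq)
      finally show ?thesis .
    qed
    then show "cmod (quotient w) < 2 * B / s + 1"
      by simp
  qed (fact s sub)+
qed

text \<open>
The constants do not depend on the distance of \<open>y\<close> from the hyperplane: every line through \<open>y\<close> can be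
followed for the length \<open>3 s\<close> in the larger polydisc, and the quotient is holomorphic and bounded by \<open>B\<close> along it.
\<close>

lemma quotient_taylor_estimate:
  assumes y': "y \<in> polydisc m z (s / (real m + 1))" "y i \<noteq> c i"
    and sub: "polydisc m z (4 * s) \<subseteq> P"
    and s: "s > 0" and B: "\<forall>w\<in>polydisc m z (4 * s). cmod (quotient w) < B"
  shows "\<exists>a. (\<forall>w\<in>polydisc m z (s / (real m + 1)).
        cmod (quotient w - quotient y - (\<Sum>j<m. a j * (w j - y j))) \<le> 8 * B / (9 * s\<^sup>2) * (\<Sum>j<m. cmod (w j - y j))\<^sup>2) \<and>
      (\<forall>j<m. cmod (a j) \<le> 2 * B / (3 * s))"
proof -
  have "s / (real m + 1) \<le> s"
    using s by (simp add: divide_le_eq)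
  from polydisc_mono[OF this] have y: "y \<in> polydisc m z s" "y i \<noteq> c i"
    using y' by auto
  have y_in: "y \<in> P"
    using y(1) sub polydisc_mono[of s "4 * s" m z] s by auto
  obtain a where a: "has_gradient m {z \<in> P. z i \<noteq> c i} quotient a y"
    using quotient_off_hyperplane y_in y(2) unfolding holomorphic_Cn_iff by blast
  have line_in: "(\<lambda>j. y j + t * v j) \<in> polydisc m z (4 * s)"
    if v: "\<And>j. j \<ge> m \<Longrightarrow> v j = 0" "\<And>j. j < m \<Longrightarrow> R * cmod (v j) \<le> 3 * s" and t: "t \<in> ball 0 R" for v R t
  proof (rule line_in_polydisc[OF _ v(1) _ t])
    show "y \<in> polydisc m z (4 * s)"
      using y(1) polydisc_mono[of s "4 * s" m z] s by auto
    show "cmod (y j - z j) + R * cmod (v j) \<le> 4 * s" if "j < m" for j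
      using v(2)[OF that] y(1) that by (force simp: polydisc_def)
  qed
  have deriv: "deriv (\<lambda>t. quotient (\<lambda>j. y j + t * v j)) 0 = (\<Sum>j<m. a j * v j)"
    if v: "\<And>j. j \<ge> m \<Longrightarrow> v j = 0" "\<And>j. j < m \<Longrightarrow> R * cmod (v j) \<le> 3 * s" and R: "R > 0" for v R
  proof (rule gradient_as_line_derivative[OF a, of "ball 0 R \<inter> {t. y i + t * v i \<noteq> c i}"])
    show "open (ball 0 R \<inter> {t. y i + t * v i \<noteq> c i})"
      by (intro open_Int open_ball open_Collect_neq continuous_intros)
    show "(\<lambda>j. y j + t * v j) \<in> {z \<in> P. z i \<noteq> c i}"
      if "t \<in> ball 0 R \<inter> {t. y i + t * v i \<noteq> c i}" for t
      using line_in[OF v, where t = t] that sub by auto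
  qed (use R y in auto)
  have hol_line: "(\<lambda>t. quotient (\<lambda>j. y j + t * v j)) holomorphic_on ball 0 R"
    if v: "\<And>j. j \<ge> m \<Longrightarrow> v j = 0" "\<And>j. j < m \<Longrightarrow> R * cmod (v j) \<le> 3 * s" and R: "R > 0" for v R
    using line_in[OF v] sub by (intro quotient_on_lines[OF y_in y(2) R]) auto
  show ?thesis
  proof (intro exI[of _ a] conjI ballI allI impI)
    fix k
    assume k: "k < m"
    define v :: "nat \<Rightarrow> complex" where "v = (\<lambda>j. if j = k then 1 else 0)"
    have v: "\<And>j. j \<ge> m \<Longrightarrow> v j = 0" "\<And>j. j < m \<Longrightarrow> 3 * s * cmod (v j) \<le> 3 * s" "3 * s > 0"
      using k s by (auto simp: v_def)
    have "cmod (deriv (\<lambda>t. quotient (\<lambda>j. y j + t * v j)) 0) \<le> 2 * B / (3 * s)"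
    proof (rule schwarz_disc(2)[OF _ v(3)])
      show "(\<lambda>t. quotient (\<lambda>j. y j + t * v j)) holomorphic_on ball 0 (3 * s)"
        by (intro hol_line v)
      show "cmod (quotient (\<lambda>j. y j + t * v j)) < B" if "t \<in> ball 0 (3 * s)" for t
        using line_in[OF v(1,2) that] B by simp
    qed
    also have "deriv (\<lambda>t. quotient (\<lambda>j. y j + t * v j)) 0 = (\<Sum>j<m. a j * v j)"
      by (rule deriv[OF v])
    also have "\<dots> = a k"
      using k by (simp add: v_def if_distrib[where f = "\<lambda>x. _ * x"] cong: if_cong)
    finally show "cmod (a k) \<le> 2 * B / (3 * s)" .
  next
    fix w
    assume w: "w \<in> polydisc m z (s / (real m + 1))"
    define v where "v = (\<lambda>j. w j - y j)"
    define V where "V = (\<Sum>j<m. cmod (v j))"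
    have V: "cmod (v j) \<le> V" if "j < m" for j
      unfolding V_def using that by (intro member_le_sum) auto
    have v0: "v j = 0" if "j \<ge> m" for j
      using w y'(1) that by (simp add: v_def polydisc_def)
    have V0: "V \<ge> 0"
      unfolding V_def by (intro sum_nonneg) auto
    have V1: "V < 3 * s"
    proof -
      have "cmod (v j) \<le> 2 * (s / (real m + 1))" if "j < m" for j
      proof -
        have "cmod (v j) \<le> cmod (w j - z j) + cmod (y j - z j)"
          using norm_triangle_ineq4[of "w j - z j" "y j - z j"] by (simp add: v_def)
        then show ?thesis
          using w y'(1) that by (force simp: polydisc_def)
      qed
      then have "V \<le> (\<Sum>j<m. 2 * (s / (real m + 1)))"
        unfolding V_def by (intro sum_mono) auto
      also have "\<dots> < 3 * s"
        using s by (simp add: divide_less_eq)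
      finally show ?thesis .
    qed
    show "cmod (quotient w - quotient y - (\<Sum>j<m. a j * (w j - y j))) \<le> 8 * B / (9 * s\<^sup>2) * (\<Sum>j<m. cmod (w j - y j))\<^sup>2"
    proof (cases "V = 0")
      case True
      then have "v j = 0" for j
        using V[of j] v0[of j] by (cases "j < m") auto
      then have "w = y"
        by (auto simp: v_def)
      then show ?thesis
        by simp
    next
      case False
      define R where "R = 3 * s / V"
      have R: "R > 1"
        using False V0 V1 by (simp add: R_def)
      have v: "\<And>j. j \<ge> m \<Longrightarrow> v j = 0" "\<And>j. j < m \<Longrightarrow> R * cmod (v j) \<le> 3 * s"
        using v0 V False V0 s by (auto simp: R_def field_simps)
      have "cmod (quotient (\<lambda>j. y j + 1 * v j) - quotient (\<lambda>j. y j + 0 * v j) -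
          deriv (\<lambda>t. quotient (\<lambda>j. y j + t * v j)) 0) \<le> 8 * B / R\<^sup>2"
      proof (rule taylor_remainder_disc[OF _ R])
        show "(\<lambda>t. quotient (\<lambda>j. y j + t * v j)) holomorphic_on ball 0 R"
          using R by (intro hol_line v) auto
        show "cmod (quotient (\<lambda>j. y j + t * v j)) < B" if "t \<in> ball 0 R" for t
          using line_in[OF v that] B by simp
      qed
      also have "deriv (\<lambda>t. quotient (\<lambda>j. y j + t * v j)) 0 = (\<Sum>j<m. a j * v j)"
        using R by (intro deriv[OF v]) auto
      also have "8 * B / R\<^sup>2 = 8 * B / (9 * s\<^sup>2) * V\<^sup>2"
        by (simp add: R_def power_divide power_mult_distrib)
      finally show ?thesis
        by (simp add: v_def V_def)
    qed
  qed
qed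

text \<open>
Only the points of the hyperplane need an argument. They are approached by the points \<open>y k\<close>, shifted in the
coordinate \<open>i\<close>, where the Taylor estimate is uniform.
\<close>

lemma quotient_holomorphic: "holomorphic_Cn m P quotient"
  unfolding holomorphic_Cn_iff
proof
  fix z
  assume z: "z \<in> P"
  show "\<exists>a. has_gradient m P quotient a z"
  proof (cases "z i = c i")
    case False
    have "holomorphic_Cn m {w \<in> P. cmod (w i - z i) < cmod (z i - c i)} quotient"
      by (rule holomorphic_Cn_subset[OF quotient_off_hyperplane]) (auto simp: norm_minus_commute)
    then have "\<exists>a. has_gradient m {w \<in> P. cmod (w i - z i) < cmod (z i - c i)} quotient a z"
      using z False unfolding holomorphic_Cn_iff by simp
    then show ?thesis
      by (rule has_gradient_local[where d = "cmod (z i - c i)"]) (use False i in auto)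
  next
    case True
    obtain s4 B where "s4 > 0" "polydisc m z s4 \<subseteq> P"
        and B: "\<And>w. w \<in> polydisc m z s4 \<Longrightarrow> cmod (quotient w) < B"
      using quotient_locally_bounded[OF z True] by metis
    \<comment> \<open>Room for lines from points at distance \<open>s\<close> to run for length \<open>3 s\<close>.\<close>
    define s where "s = s4 / 4"
    have s: "s > 0" "polydisc m z (4 * s) \<subseteq> P"
        and B: "\<And>w. w \<in> polydisc m z (4 * s) \<Longrightarrow> cmod (quotient w) < B"
      using \<open>s4 > 0\<close> \<open>polydisc m z s4 \<subseteq> P\<close> B by (auto simp: s_def)
    \<comment> \<open>Keeps the sum of \<open>m\<close> coordinate differences below \<open>3 s\<close>, so the line parameter 1 is inside the disc.\<close>
    define \<sigma> where "\<sigma> = s / (real m + 1)"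
    have \<sigma>: "\<sigma> > 0" "\<sigma> \<le> s"
      using s(1) by (auto simp: \<sigma>_def divide_le_eq)
    define \<delta> :: "nat \<Rightarrow> complex" where "\<delta> = (\<lambda>k. of_real (\<sigma> / (real k + 2)))"
    define y where "y = (\<lambda>k. z(i := z i + \<delta> k))"
    have \<delta>\<sigma>: "cmod (\<delta> k) < \<sigma>" for k
      unfolding \<delta>_def norm_of_real using \<sigma>(1) by (simp add: divide_less_eq)
    have \<delta>0: "\<delta> k \<noteq> 0" for k
      unfolding \<delta>_def of_real_eq_0_iff using \<sigma>(1) by simp
    have "(\<lambda>k. \<sigma> / (real k + 2)) \<longlonglongrightarrow> 0"
      by real_asymp
    then have \<delta>_lim: "\<delta> \<longlonglongrightarrow> 0"
      unfolding \<delta>_def by (subst of_real_0[symmetric]) (rule tendsto_of_real)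
    have y_in: "y k \<in> polydisc m z \<sigma>" "y k i \<noteq> c i" for k
      using z True \<delta>0[of k] \<delta>\<sigma>[of k] \<sigma>(1) i by (auto simp: y_def polydisc_def)
    have "\<exists>a. (\<forall>w\<in>polydisc m z \<sigma>. cmod (quotient w - quotient (y k) - (\<Sum>j<m. a j * (w j - y k j)))
        \<le> 8 * B / (9 * s\<^sup>2) * (\<Sum>j<m. cmod (w j - y k j))\<^sup>2) \<and> (\<forall>j<m. cmod (a j) \<le> 2 * B / (3 * s))" for k
      using quotient_taylor_estimate[of "y k" z s B] y_in[of k] s B unfolding \<sigma>_def by blast
    then have "\<forall>k. \<exists>a. (\<forall>w\<in>polydisc m z \<sigma>. cmod (quotient w - quotient (y k) - (\<Sum>j<m. a j * (w j - y k j)))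
        \<le> 8 * B / (9 * s\<^sup>2) * (\<Sum>j<m. cmod (w j - y k j))\<^sup>2) \<and> (\<forall>j<m. cmod (a j) \<le> 2 * B / (3 * s))" ..
    from choice[OF this] obtain a where a:
      "\<forall>k. (\<forall>w\<in>polydisc m z \<sigma>. cmod (quotient w - quotient (y k) - (\<Sum>j<m. a k j * (w j - y k j)))
        \<le> 8 * B / (9 * s\<^sup>2) * (\<Sum>j<m. cmod (w j - y k j))\<^sup>2) \<and> (\<forall>j<m. cmod (a k j) \<le> 2 * B / (3 * s))" ..
    have line: "z(i := z i + t) \<in> P" if "t \<in> ball 0 s" for t
    proof -
      have "z(i := z i + t) \<in> polydisc m z (4 * s)"
        using that z i s(1) by (auto simp: polydisc_def)
      then show ?thesis
        using s(2) by blast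
    qed
    show ?thesis
    proof (rule has_gradient_limit[where S' = "polydisc m z \<sigma>" and a = a and y = y])
      show "\<sigma> > 0"
        by fact
      show "w \<in> polydisc m z \<sigma>" if "w \<in> P" "\<forall>i<m. cmod (w i - z i) < \<sigma>" for w
        using that by (simp add: polydisc_def)
      show "(\<lambda>k. y k j) \<longlonglongrightarrow> z j" for j
        using tendsto_add[OF tendsto_const \<delta>_lim, of "z i"] by (cases "j = i") (auto simp: y_def)
      let ?\<gamma> = "\<lambda>t. F (z(i := z i + t))"
      have "?\<gamma> field_differentiable at 0"
        using quotient_on_axis(1)[OF z True s(1) line] s(1) by (auto intro: holomorphic_on_imp_differentiable_at)
      then have "(?\<gamma> has_field_derivative deriv ?\<gamma> 0) (at 0)"
        by (simp add: DERIV_deriv_iff_field_differentiable)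
      then have "((\<lambda>t. (?\<gamma> (0 + t) - ?\<gamma> 0) / t) \<longlongrightarrow> deriv ?\<gamma> 0) (at 0)"
        by (simp add: DERIV_def)
      moreover have "filterlim \<delta> (at 0) sequentially"
        using \<delta>_lim \<delta>0 by (simp add: filterlim_at)
      ultimately have "(\<lambda>k. (?\<gamma> (0 + \<delta> k) - ?\<gamma> 0) / \<delta> k) \<longlonglongrightarrow> deriv ?\<gamma> 0"
        by (rule filterlim_compose)
      moreover have "(?\<gamma> (0 + \<delta> k) - ?\<gamma> 0) / \<delta> k = quotient (y k)" for k
      proof -
        have "\<delta> k \<in> ball 0 s"
          using \<delta>\<sigma>[of k] \<sigma>(2) by simp
        from quotient_on_axis(2)[OF z True s(1) line this] show ?thesis
          using \<delta>0[of k] by (simp add: y_def)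
      qed
      moreover have "deriv ?\<gamma> 0 = quotient z"
        using quotient_on_axis(2)[OF z True s(1) line, of 0] s(1) by simp
      ultimately show "(\<lambda>k. quotient (y k)) \<longlonglongrightarrow> quotient z"
        by simp
      show "cmod (quotient w - quotient (y k) - (\<Sum>j<m. a k j * (w j - y k j)))
        \<le> 8 * B / (9 * s\<^sup>2) * (\<Sum>j<m. cmod (w j - y k j))\<^sup>2" if "w \<in> polydisc m z \<sigma>" for k w
        using a that by blast
      show "cmod (a k j) \<le> 2 * B / (3 * s)" if "j < m" for k j
        using a that by blast
    qed
  qed
qed

end

lemma holomorphic_divided_difference:
  assumes F: "holomorphic_Cn m (polydisc m c r) F" and "i < m"
  obtains G where "holomorphic_Cn m (polydisc m c r) G"
    and "\<forall>z\<in>polydisc m c r. F z - F (z(i := c i)) = (z i - c i) * G z"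
proof (cases "r > 0")
  case True
  from F obtain A where A: "\<forall>z\<in>polydisc m c r. has_gradient m (polydisc m c r) F (A z) z"
    unfolding holomorphic_Cn_iff by metis
  then interpret divided_difference m c r F i A
    using True \<open>i < m\<close> by unfold_locales auto
  show ?thesis
  proof (rule that[OF quotient_holomorphic], intro ballI)
    fix z
    have "z(i := c i) = z" if "z i = c i"
      using that by auto
    then show "F z - F (z(i := c i)) = (z i - c i) * quotient z"
      by (auto simp: quotient_def)
  qed
next
  case False
  then have "polydisc m c r = {}"
    using \<open>i < m\<close> by (auto simp: polydisc_def) (smt (verit) norm_ge_zero)
  then show ?thesis
    using that[of F] F by simp
qed

text \<open>
The variables are moved from \<open>c\<close> to \<open>z\<close> one after the other, and each step contributes a divided difference.
\<close>

lemma holomorphic_Hadamard: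
  assumes f: "holomorphic_Cn m (polydisc m c r) f" and c: "c \<in> polydisc m c r"
  obtains g where "\<And>i. i < m \<Longrightarrow> holomorphic_Cn m (polydisc m c r) (g i)"
    and "\<And>z. z \<in> polydisc m c r \<Longrightarrow> f z = f c + (\<Sum>i<m. (z i - c i) * g i z)"
proof -
  define p where "p = (\<lambda>k (z :: nat \<Rightarrow> complex) j. if j < k then z j else c j)"
  have p_in: "p k z \<in> polydisc m c r" if "z \<in> polydisc m c r" for k z
    using that c by (auto simp: polydisc_def p_def)
  have "holomorphic_Cn m (polydisc m c r) (\<lambda>z. f (p (Suc i) z))" for i
  proof (rule holomorphic_Cn_compose[OF f])
    show "holomorphic_Cn m (polydisc m c r) (\<lambda>z. p (Suc i) z j)" if "j < m" for j
      using that by (cases "j < Suc i") (auto simp: p_def intro: holomorphic_Cn_const holomorphic_Cn_coordinate)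
  qed (rule p_in)
  note F = this
  have "\<exists>G. holomorphic_Cn m (polydisc m c r) G \<and>
      (\<forall>z\<in>polydisc m c r. f (p (Suc i) z) - f (p (Suc i) (z(i := c i))) = (z i - c i) * G z)"
    if "i < m" for i
    using holomorphic_divided_difference[OF F that] by metis
  then obtain g where g: "\<And>i. i < m \<Longrightarrow> holomorphic_Cn m (polydisc m c r) (g i)"
      "\<And>i z. i < m \<Longrightarrow> z \<in> polydisc m c r \<Longrightarrow>
        f (p (Suc i) z) - f (p (Suc i) (z(i := c i))) = (z i - c i) * g i z"
    by metis
  show ?thesis
  proof (rule that[OF g(1)])
    fix z
    assume z: "z \<in> polydisc m c r"
    have "p (Suc i) (z(i := c i)) = p i z" for i
      by (auto simp: p_def fun_eq_iff less_Suc_eq)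
    then have "(\<Sum>i<m. (z i - c i) * g i z) = (\<Sum>i<m. f (p (Suc i) z) - f (p i z))"
      using g(2)[OF _ z] by (intro sum.cong) auto
    also have "\<dots> = f (p m z) - f (p 0 z)"
      by (rule sum_lessThan_telescope)
    also have "p m z = z"
      using z c by (auto simp: p_def polydisc_def fun_eq_iff)
    also have "p 0 z = c"
      by (simp add: p_def)
    finally show "f z = f c + (\<Sum>i<m. (z i - c i) * g i z)"
      by simp
  qed
qed

section \<open>Charts of complex manifolds\<close>

definition closed_polydisc :: "nat \<Rightarrow> (nat \<Rightarrow> complex) \<Rightarrow> real \<Rightarrow> (nat \<Rightarrow> complex) set" where
  "closed_polydisc m c r = {z. (\<forall>i<m. cmod (z i - c i) \<le> r) \<and> (\<forall>i\<ge>m. z i = 0)}"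

lemma topspace_Complex_space: "topspace (Complex_space m) = {z. \<forall>i\<ge>m. z i = 0}"
  by (simp add: Complex_space_def)

lemma openin_Complex_space:
  "openin (Complex_space m) S \<longleftrightarrow> (\<exists>T. open T \<and> S = T \<inter> {z. \<forall>i\<ge>m. z i = 0})"
  unfolding Complex_space_def euclidean_product_topology by (auto simp: openin_subtopology)

lemma openin_polydisc: "openin (Complex_space m) (polydisc m c r)"
proof -
  have "open (\<Inter>i\<in>{..<m}. {z. cmod (z i - c i) < r})"
    by (intro open_INT ballI open_Collect_less continuous_intros) auto
  moreover have "polydisc m c r = (\<Inter>i\<in>{..<m}. {z. cmod (z i - c i) < r}) \<inter> {z. \<forall>i\<ge>m. z i = 0}"
    by (auto simp: polydisc_def)
  ultimately show ?thesis
    unfolding openin_Complex_space by blast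
qed

lemma openin_Complex_space_contains_polydisc:
  assumes "openin (Complex_space m) S" and "z \<in> S"
  obtains r where "r > 0" and "polydisc m z r \<subseteq> S"
proof -
  obtain T where T: "open T" "S = T \<inter> {z. \<forall>i\<ge>m. z i = 0}"
    using assms(1) unfolding openin_Complex_space by blast
  have "openin (product_topology (\<lambda>i. euclidean) UNIV) T"
    using T(1) by (simp add: euclidean_product_topology)
  from product_topology_open_contains_basis[OF this, of z] obtain Y
    where X: "z \<in> PiE UNIV Y" "\<And>i. open (Y i)" "PiE UNIV Y \<subseteq> T"
    using assms(2) T(2) by auto
  have "\<forall>i. \<exists>e>0. ball (z i) e \<subseteq> Y i"
    using X(1,2) openE by (metis PiE_mem UNIV_I)
  then obtain e where e: "\<And>i. e i > 0" "\<And>i. ball (z i) (e i) \<subseteq> Y i"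
    by metis
  define r where "r = Min (insert 1 (e ` {..<m}))"
  show ?thesis
  proof (rule that)
    show "r > 0"
      using e(1) by (auto simp: r_def)
    show "polydisc m z r \<subseteq> S"
    proof
      fix w
      assume w: "w \<in> polydisc m z r"
      have "w i \<in> Y i" for i
      proof (cases "i < m")
        case True
        then have "r \<le> e i"
          unfolding r_def by (intro Min_le) auto
        then have "w i \<in> ball (z i) (e i)"
          using w True by (auto simp: polydisc_def dist_norm norm_minus_commute)
        then show ?thesis
          using e(2) by blast
      next
        case False
        then have "w i = z i"
          using w assms(2) T(2) by (auto simp: polydisc_def)
        then show ?thesis
          using X(1) by auto
      qed
      then show "w \<in> S"
        using w X(3) T(2) by (auto simp: polydisc_def)
    qed
  qed
qed

lemma compactin_closed_polydisc: "compactin (Complex_space m) (closed_polydisc m c r)"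
proof -
  have "closed_polydisc m c r = PiE UNIV (\<lambda>i. if i < m then cball (c i) r else {0})"
    by (auto simp: closed_polydisc_def PiE_iff dist_norm norm_minus_commute split: if_splits)
  then have "compactin (product_topology (\<lambda>i. euclidean) UNIV) (closed_polydisc m c r)"
    by (simp add: compactin_PiE)
  then show ?thesis
    unfolding Complex_space_def compactin_subtopology by (auto simp: closed_polydisc_def)
qed

lemma closed_polydisc_subset: "r < s \<Longrightarrow> closed_polydisc m c r \<subseteq> polydisc m c s"
  by (force simp: closed_polydisc_def polydisc_def)

lemma polydisc_subset_closed: "polydisc m c r \<subseteq> closed_polydisc m c r"
  by (force simp: closed_polydisc_def polydisc_def)

lemma center_in_polydisc: "r > 0 \<Longrightarrow> (\<And>i. i \<ge> m \<Longrightarrow> c i = 0) \<Longrightarrow> c \<in> polydisc m c r"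
  by (simp add: polydisc_def)

locale manifold_chart =
  fixes M :: "('p, 'x) cmanifold_scheme" and U :: "'p set" and \<psi> :: "'p \<Rightarrow> nat \<Rightarrow> complex"
  assumes manifold: "complex_manifold M" and chart: "(U, \<psi>) \<in> atlas M"
begin

abbreviation "m \<equiv> mdim M"

lemma open_domain: "openin (mtop M) U"
  and open_image: "openin (Complex_space m) (\<psi> ` U)"
  and homeo: "homeomorphic_map (subtopology (mtop M) U) (subtopology (Complex_space m) (\<psi> ` U)) \<psi>"
  using manifold chart unfolding complex_manifold_def topological_chart_def by auto

lemma domain_subset: "U \<subseteq> topspace (mtop M)"
  using open_domain by (rule openin_subset)

lemma inj: "inj_on \<psi> U"
  using homeomorphic_imp_injective_map[OF homeo] domain_subset by (simp add: Int_absorb1)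

lemma inv_chart: "x \<in> U \<Longrightarrow> inv_into U \<psi> (\<psi> x) = x"
  using inj by simp

lemma open_image_of: "openin (mtop M) V \<Longrightarrow> V \<subseteq> U \<Longrightarrow> openin (Complex_space m) (\<psi> ` V)"
  using homeomorphic_imp_open_map[OF homeo] open_image
  by (metis open_map_def openin_open_subtopology open_domain)

lemma open_preimage: "openin (Complex_space m) P \<Longrightarrow> openin (mtop M) {x \<in> U. \<psi> x \<in> P}"
proof -
  assume P: "openin (Complex_space m) P"
  have "continuous_map (subtopology (mtop M) U) (Complex_space m) \<psi>"
    using homeomorphic_imp_continuous_map[OF homeo] by (simp add: continuous_map_in_subtopology)
  from openin_continuous_map_preimage[OF this P] show ?thesis
    using domain_subset open_domain by (simp add: Int_absorb1 openin_open_subtopology)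
qed

lemma compact_preimage:
  assumes "compactin (Complex_space m) C" and "C \<subseteq> \<psi> ` U"
  shows "compactin (mtop M) {x \<in> U. \<psi> x \<in> C}"
proof -
  have "\<psi> ` {x \<in> U. \<psi> x \<in> C} = C"
    using assms(2) by auto
  then have "compactin (subtopology (mtop M) U) {x \<in> U. \<psi> x \<in> C}"
    using homeomorphic_map_compactness[OF homeo, of "{x \<in> U. \<psi> x \<in> C}"] assms domain_subset
    by (auto simp: compactin_subtopology)
  then show ?thesis
    by (simp add: compactin_subtopology)
qed

lemma chart_zero: "x \<in> U \<Longrightarrow> i \<ge> m \<Longrightarrow> \<psi> x i = 0"
  using openin_subset[OF open_image] by (auto simp: topspace_Complex_space)

lemma small_polydisc:
  assumes "openin (mtop M) V" and "V \<subseteq> U" and "p \<in> V"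
  obtains r where "r > 0" and "polydisc m (\<psi> p) r \<subseteq> \<psi> ` V"
  using openin_Complex_space_contains_polydisc[OF open_image_of[OF assms(1,2)], of "\<psi> p"] assms(3)
  by blast

lemma transition:
  "(U', \<psi>') \<in> atlas M \<Longrightarrow> i < m \<Longrightarrow> holomorphic_Cn m (\<psi>' ` (U' \<inter> U)) (\<lambda>z. \<psi> (inv_into U' \<psi>' z) i)"
  using manifold chart unfolding complex_manifold_def holomorphic_transition_def by fast

lemma holomorphic_fun_in_chart:
  assumes "holomorphic_fun M V g" and "V \<subseteq> U"
  shows "holomorphic_Cn m (\<psi> ` V) (\<lambda>z. g (inv_into U \<psi> z))"
  using assms chart unfolding holomorphic_fun_def by (auto simp: Int_absorb1)

text \<open>
Holomorphy in one chart suffices on its domain, since transition functions are holomorphic.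
\<close>

lemma holomorphic_fun_from_chart:
  assumes hol: "holomorphic_Cn m (\<psi> ` V) (\<lambda>z. g (inv_into U \<psi> z))" and V: "V \<subseteq> U"
  shows "holomorphic_fun M V g"
  unfolding holomorphic_fun_def
proof (clarify)
  fix U' \<psi>'
  assume U': "(U', \<psi>') \<in> atlas M"
  interpret c': manifold_chart M U' \<psi>'
    using manifold U' by unfold_locales
  have "holomorphic_Cn m (\<psi>' ` (U' \<inter> V)) (\<lambda>z. g (inv_into U \<psi> (\<psi> (inv_into U' \<psi>' z))))"
  proof (rule holomorphic_Cn_compose[OF hol])
    show "holomorphic_Cn m (\<psi>' ` (U' \<inter> V)) (\<lambda>z. \<psi> (inv_into U' \<psi>' z) j)" if "j < m" for j
      using V by (intro holomorphic_Cn_subset[OF transition[OF U' that]]) auto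
    show "\<psi> (inv_into U' \<psi>' z) \<in> \<psi> ` V" if "z \<in> \<psi>' ` (U' \<inter> V)" for z
      using that c'.inv_chart by auto
  qed
  then show "holomorphic_Cn m (\<psi>' ` (U' \<inter> V)) (\<lambda>z. g (inv_into U' \<psi>' z))"
    by (rule holomorphic_Cn_cong[THEN iffD1, rotated]) (use V inv_chart c'.inv_chart in auto)
qed

lemma holomorphic_coordinate:
  assumes "i < m" and "V \<subseteq> U"
  shows "holomorphic_fun M V (\<lambda>x. \<psi> x i)"
proof (rule holomorphic_fun_from_chart[OF _ assms(2)])
  show "holomorphic_Cn m (\<psi> ` V) (\<lambda>z. \<psi> (inv_into U \<psi> z) i)"
    by (rule holomorphic_Cn_cong[THEN iffD1, OF _ holomorphic_Cn_coordinate[OF assms(1)]])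
       (use assms(2) inv_chart in auto)
qed

lemma continuous_coordinate: "continuous_map (subtopology (mtop M) U) euclidean (\<lambda>x. \<psi> x i)"
proof -
  have "continuous_map (subtopology (mtop M) U) (product_topology (\<lambda>i. euclidean) UNIV) \<psi>"
    using homeomorphic_imp_continuous_map[OF homeo]
    by (simp add: continuous_map_in_subtopology Complex_space_def)
  then show ?thesis
    by (simp add: continuous_map_componentwise_UNIV)
qed

end

lemma holomorphic_fun_const: "holomorphic_fun M V (\<lambda>x. c)"
  unfolding holomorphic_fun_def by (auto intro: holomorphic_Cn_const)

lemma holomorphic_fun_cong:
  assumes M: "complex_manifold M" and "holomorphic_fun M V f" and "\<And>x. x \<in> V \<Longrightarrow> f x = g x"
  shows "holomorphic_fun M V g"
  unfolding holomorphic_fun_def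
proof (clarify)
  fix U \<psi>
  assume U: "(U, \<psi>) \<in> atlas M"
  interpret manifold_chart M U \<psi>
    using M U by unfold_locales
  have "holomorphic_Cn m (\<psi> ` (U \<inter> V)) (\<lambda>z. f (inv_into U \<psi> z))"
    using assms(2) U by (auto simp: holomorphic_fun_def)
  then show "holomorphic_Cn m (\<psi> ` (U \<inter> V)) (\<lambda>z. g (inv_into U \<psi> z))"
    by (rule holomorphic_Cn_cong[THEN iffD1, rotated]) (use assms(3) inv_chart in auto)
qed

lemma holomorphic_fun_subset:
  assumes "holomorphic_fun M V f" and "V' \<subseteq> V"
  shows "holomorphic_fun M V' f"
  using assms unfolding holomorphic_fun_def
  by (auto elim!: ballE intro: holomorphic_Cn_subset)

lemma holomorphic_fun_reciprocal:
  assumes M: "complex_manifold M" and f: "holomorphic_fun M V f" and nz: "\<And>x. x \<in> V \<Longrightarrow> f x \<noteq> c"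
  shows "holomorphic_fun M V (\<lambda>x. 1 / (f x - c))"
  unfolding holomorphic_fun_def
proof (clarify)
  fix U \<psi>
  assume U: "(U, \<psi>) \<in> atlas M"
  interpret manifold_chart M U \<psi>
    using M U by unfold_locales
  have "holomorphic_Cn m (\<psi> ` (U \<inter> V)) (\<lambda>z. f (inv_into U \<psi> z))"
    using f U by (auto simp: holomorphic_fun_def)
  moreover have "f (inv_into U \<psi> z) - c \<noteq> 0" if "z \<in> \<psi> ` (U \<inter> V)" for z
    using that nz inv_chart by force
  ultimately show "holomorphic_Cn m (\<psi> ` (U \<inter> V)) (\<lambda>z. 1 / (f (inv_into U \<psi> z) - c))"
    by (intro holomorphic_Cn_inverse holomorphic_Cn_diff holomorphic_Cn_const)
qed

text \<open>
This provides the open sets on which \<open>f - c\<close> is invertible.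
\<close>

lemma holomorphic_fun_neq_open:
  assumes M: "complex_manifold M" and V: "openin (mtop M) V" and f: "holomorphic_fun M V f"
    and p: "p \<in> V" "f p \<noteq> c"
  obtains V' where "openin (mtop M) V'" and "p \<in> V'" and "V' \<subseteq> V" and "\<And>x. x \<in> V' \<Longrightarrow> f x \<noteq> c"
proof -
  have "p \<in> \<Union> (fst ` atlas M)"
    using M p(1) openin_subset[OF V] by (auto simp: complex_manifold_def)
  then obtain U \<psi> where U: "(U, \<psi>) \<in> atlas M" "p \<in> U"
    by auto
  interpret manifold_chart M U \<psi>
    using M U by unfold_locales
  have pV: "p \<in> V \<inter> U" and VU: "openin (mtop M) (V \<inter> U)" "V \<inter> U \<subseteq> U"
    using p U V open_domain by auto
  have "holomorphic_Cn m (\<psi> ` (V \<inter> U)) (\<lambda>z. f (inv_into U \<psi> z))"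
    by (rule holomorphic_fun_in_chart[OF holomorphic_fun_subset[OF f]]) auto
  then obtain a where "has_gradient m (\<psi> ` (V \<inter> U)) (\<lambda>z. f (inv_into U \<psi> z)) a (\<psi> p)"
    using pV unfolding holomorphic_Cn_iff by blast
  from has_gradient_tendsto[OF this]
  have "((\<lambda>z. f (inv_into U \<psi> z)) \<longlongrightarrow> f p) (near m (\<psi> ` (V \<inter> U)) (\<psi> p))"
    using U inv_chart by simp
  from tendsto_imp_eventually_ne[OF this p(2)]
  obtain d where d: "d > 0"
    "\<forall>w\<in>\<psi> ` (V \<inter> U). (\<forall>i<m. cmod (w i - \<psi> p i) < d) \<longrightarrow> f (inv_into U \<psi> w) \<noteq> c"
    unfolding eventually_near by blast
  define V' where "V' = V \<inter> {x \<in> U. \<psi> x \<in> polydisc m (\<psi> p) d}"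
  show ?thesis
  proof (rule that[of V'])
    show "openin (mtop M) V'"
      unfolding V'_def by (intro openin_Int V open_preimage openin_polydisc)
    show "p \<in> V'"
      using p U d(1) chart_zero by (auto simp: V'_def polydisc_def)
    show "V' \<subseteq> V"
      by (auto simp: V'_def)
    show "f x \<noteq> c" if "x \<in> V'" for x
      using d(2)[rule_format, of "\<psi> x"] that inv_chart by (auto simp: V'_def polydisc_def)
  qed
qed

section \<open>Expansion under squaring\<close>

text \<open>
Otherwise \<open>d\<close> would exceed every bound along the iterated squares of \<open>h\<close>. In the applications \<open>H\<close> is a small
subgroup and \<open>d\<close> measures a displacement.
\<close>

lemma no_bounded_expansion:
  fixes d :: "'h \<Rightarrow> real"
  assumes sq: "\<And>h. h \<in> H \<Longrightarrow> sq h \<in> H" and bound: "\<And>h. h \<in> H \<Longrightarrow> d h \<le> B"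
    and expand: "\<And>h. h \<in> H \<Longrightarrow> 3 / 2 * d h \<le> d (sq h)" and h: "h \<in> H"
  shows "d h \<le> 0"
proof (rule ccontr)
  assume "\<not> d h \<le> 0"
  have "(3 / 2) ^ k * d h \<le> d ((sq ^^ k) h) \<and> (sq ^^ k) h \<in> H" for k
  proof (induction k)
    case (Suc k)
    then have "3 / 2 * ((3 / 2) ^ k * d h) \<le> 3 / 2 * d ((sq ^^ k) h)"
      by (intro mult_left_mono) auto
    also have "\<dots> \<le> d (sq ((sq ^^ k) h))"
      using Suc by (intro expand) auto
    finally show ?case
      using Suc by (auto intro: sq)
  qed (use h in auto)
  then have le: "(3 / 2) ^ k * d h \<le> B" for k
    using bound by (meson order_trans)
  obtain k where "B / d h < (3 / 2) ^ k"
    using real_arch_pow[of "3 / 2" "B / d h"] by auto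
  with le[of k] \<open>\<not> d h \<le> 0\<close> show False
    by (simp add: divide_less_eq)
qed

section \<open>Grassmann algebra and endomorphisms of the local model\<close>

definition grassmann_mult :: "(nat set \<Rightarrow> complex) \<Rightarrow> (nat set \<Rightarrow> complex) \<Rightarrow> nat set \<Rightarrow> complex" where
  "grassmann_mult a b \<nu> = (\<Sum>\<alpha>\<in>Pow \<nu>. grassmann_sign \<alpha> (\<nu> - \<alpha>) * a \<alpha> * b (\<nu> - \<alpha>))"

text \<open>
Membership in the \<open>q\<close>-th power of the ideal generated by the odd generators. Only coefficients with index inside
\<open>{..<n}\<close> are constrained, as all others vanish in sections of the local model.
\<close>

definition of_order :: "nat \<Rightarrow> nat \<Rightarrow> (nat set \<Rightarrow> complex) \<Rightarrow> bool" where
  "of_order n q a \<longleftrightarrow> (\<forall>\<mu>. \<mu> \<subseteq> {..<n} \<longrightarrow> card \<mu> < q \<longrightarrow> a \<mu> = 0)"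

lemma grassmann_sign_empty: "grassmann_sign {} \<beta> = 1"
  by (simp add: grassmann_sign_def)

lemma grassmann_mult_body: "grassmann_mult a b {} = a {} * b {}"
  by (simp add: grassmann_mult_def grassmann_sign_empty)

lemma grassmann_mult_zero: "grassmann_mult (\<lambda>\<nu>. 0) b \<mu> = 0"
  by (simp add: grassmann_mult_def)

lemma grassmann_mult_diff:
  "grassmann_mult a b \<mu> - grassmann_mult a' b' \<mu> =
     grassmann_mult (\<lambda>\<nu>. a \<nu> - a' \<nu>) b \<mu> + grassmann_mult a' (\<lambda>\<nu>. b \<nu> - b' \<nu>) \<mu>"
  by (simp add: grassmann_mult_def algebra_simps flip: sum_subtractf sum.distrib)

lemma grassmann_mult_scalar:
  assumes "finite \<mu>"
  shows "grassmann_mult (\<lambda>\<nu>. if \<nu> = {} then c else 0) b \<mu> = c * b \<mu>"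
proof -
  have "grassmann_mult (\<lambda>\<nu>. if \<nu> = {} then c else 0) b \<mu> = (\<Sum>\<alpha>\<in>Pow \<mu>. if \<alpha> = {} then c * b \<mu> else 0)"
    unfolding grassmann_mult_def by (intro sum.cong) (auto simp: grassmann_sign_empty)
  then show ?thesis
    using assms by simp
qed

lemma of_order_mult:
  assumes "of_order n q a" and "of_order n r b"
  shows "of_order n (q + r) (grassmann_mult a b)"
  unfolding of_order_def
proof (intro allI impI)
  fix \<mu>
  assume \<mu>: "\<mu> \<subseteq> {..<n}" "card \<mu> < q + r"
  have "grassmann_sign \<alpha> (\<mu> - \<alpha>) * a \<alpha> * b (\<mu> - \<alpha>) = 0" if "\<alpha> \<in> Pow \<mu>" for \<alpha>
  proof -
    have "finite \<mu>"
      using \<mu>(1) by (rule finite_subset) simp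
    then have "card \<alpha> + card (\<mu> - \<alpha>) = card \<mu>"
      using that by (metis PowD card_Diff_subset card_mono finite_subset le_add_diff_inverse)
    then have "card \<alpha> < q \<or> card (\<mu> - \<alpha>) < r"
      using \<mu>(2) by linarith
    then show ?thesis
      using assms \<mu>(1) that unfolding of_order_def by (metis Diff_subset PowD mult_zero_left mult_zero_right subset_trans)
  qed
  then show "grassmann_mult a b \<mu> = 0"
    unfolding grassmann_mult_def by (intro sum.neutral) blast
qed

text \<open>
In the lowest degree of \<open>b\<close>, multiplication by \<open>a\<close> only sees the body of \<open>a\<close>.
\<close>

lemma grassmann_mult_leading:
  assumes b: "of_order n (card \<mu>) b" and \<mu>: "\<mu> \<subseteq> {..<n}"
  shows "grassmann_mult a b \<mu> = a {} * b \<mu>"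
proof -
  have fin: "finite \<mu>"
    using \<mu> by (rule finite_subset) simp
  have "b (\<mu> - \<alpha>) = 0" if "\<alpha> \<subseteq> \<mu>" "\<alpha> \<noteq> {}" for \<alpha>
  proof -
    have "card (\<mu> - \<alpha>) < card \<mu>"
      using that fin by (intro psubset_card_mono) auto
    then show ?thesis
      using b \<mu> unfolding of_order_def by blast
  qed
  then have "grassmann_mult a b \<mu> = (\<Sum>\<alpha>\<in>Pow \<mu>. if \<alpha> = {} then a {} * b \<mu> else 0)"
    unfolding grassmann_mult_def by (intro sum.cong) (auto simp: grassmann_sign_empty)
  then show ?thesis
    using fin by simp
qed

definition body_section :: "'p set \<Rightarrow> ('p \<Rightarrow> complex) \<Rightarrow> 'p grassmann" where
  "body_section U b = (\<lambda>\<nu> x. if \<nu> = {} \<and> x \<in> U then b x else 0)"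

definition theta_section :: "'p set \<Rightarrow> nat set \<Rightarrow> 'p grassmann" where
  "theta_section U \<nu> = (\<lambda>\<mu> x. if \<mu> = \<nu> \<and> x \<in> U then 1 else 0)"

lemma model_superalgebra_simps:
  "carrier (model_superalgebra M n U) = model_sections M n U"
  "(f \<otimes>\<^bsub>model_superalgebra M n U\<^esub> g) \<nu> x = grassmann_mult (\<lambda>\<mu>. f \<mu> x) (\<lambda>\<mu>. g \<mu> x) \<nu>"
  "(f \<oplus>\<^bsub>model_superalgebra M n U\<^esub> g) \<nu> x = f \<nu> x + g \<nu> x"
  "(c \<odot>\<^bsub>model_superalgebra M n U\<^esub> f) \<nu> x = c * f \<nu> x"
  "\<one>\<^bsub>model_superalgebra M n U\<^esub> = theta_section U {}"
  by (simp_all add: model_superalgebra_def grassmann_mult_def theta_section_def fun_eq_iff)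

lemma model_sheaf_simps:
  "sec (model_sheaf M n) = model_superalgebra M n"
  "res (model_sheaf M n) U V f \<nu> x = (if x \<in> V then f \<nu> x else 0)"
  by (simp_all add: model_sheaf_def)

lemma model_sections_outside:
  assumes "f \<in> model_sections M n U"
  shows "x \<notin> U \<Longrightarrow> f \<nu> x = 0" and "\<not> \<nu> \<subseteq> {..<n} \<Longrightarrow> f \<nu> x = 0"
  using assms by (auto simp: model_sections_def) (metis (no_types))

text \<open>
Peeling off the least index produces no sign, so products of the generators can be built by induction on the minimum.
\<close>

lemma theta_mult:
  assumes "\<forall>k\<in>\<nu>. j < k" and "finite \<nu>"
  shows "theta_section U {j} \<otimes>\<^bsub>model_superalgebra M n U\<^esub> theta_section U \<nu> = theta_section U (insert j \<nu>)"
proof (intro ext)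
  fix \<mu> x
  have j: "j \<notin> \<nu>"
    using assms(1) by blast
  have sign: "grassmann_sign {j} \<nu> = 1"
  proof -
    have "{(i, k). i \<in> {j} \<and> k \<in> \<nu> \<and> k < i} = {}"
      using assms(1) by force
    then show ?thesis
      unfolding grassmann_sign_def by (simp only: card.empty power_0)
  qed
  have "grassmann_mult (\<lambda>\<mu>. theta_section U {j} \<mu> x) (\<lambda>\<mu>. theta_section U \<nu> \<mu> x) \<mu> =
      (\<Sum>\<alpha>\<in>Pow \<mu>. if \<alpha> = {j} then (if \<mu> = insert j \<nu> \<and> x \<in> U then 1 else 0) else 0)"
    unfolding grassmann_mult_def
  proof (intro sum.cong refl)
    fix \<alpha>
    assume "\<alpha> \<in> Pow \<mu>"
    then have "\<mu> - \<alpha> = \<nu> \<longleftrightarrow> \<mu> = insert j \<nu>" if "\<alpha> = {j}"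
      using that j by auto
    then show "grassmann_sign \<alpha> (\<mu> - \<alpha>) * theta_section U {j} \<alpha> x * theta_section U \<nu> (\<mu> - \<alpha>) x =
        (if \<alpha> = {j} then (if \<mu> = insert j \<nu> \<and> x \<in> U then 1 else 0) else 0)"
      using sign by (auto simp: theta_section_def)
  qed
  also have "\<dots> = theta_section U (insert j \<nu>) \<mu> x"
    using assms(2) by (cases "finite \<mu>") (auto simp: theta_section_def)
  finally show "(theta_section U {j} \<otimes>\<^bsub>model_superalgebra M n U\<^esub> theta_section U \<nu>) \<mu> x = theta_section U (insert j \<nu>) \<mu> x"
    by (simp add: model_superalgebra_simps)
qed

lemma theta_square: "grassmann_mult (\<lambda>\<mu>. theta_section U {j} \<mu> x) (\<lambda>\<mu>. theta_section U {j} \<mu> x) \<mu> = 0"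
  unfolding grassmann_mult_def by (intro sum.neutral) (auto simp: theta_section_def)

lemma grassmann_mult_body_section:
  assumes "finite \<mu>"
  shows "grassmann_mult (\<lambda>\<nu>. body_section U b \<nu> x) a \<mu> = (if x \<in> U then b x * a \<mu> else 0)"
  using grassmann_mult_scalar[OF assms, of "b x" a] grassmann_mult_zero[of a \<mu>]
  by (simp add: body_section_def)

lemma body_section_in_model_sections:
  assumes manifold: "complex_manifold M" and b: "holomorphic_fun M U b"
  shows "body_section U b \<in> model_sections M n U"
proof -
  have "holomorphic_fun M U (body_section U b \<mu>)" for \<mu>
  proof (cases "\<mu> = {}")
    case True
    then show ?thesis
      by (intro holomorphic_fun_cong[OF manifold b]) (simp add: body_section_def)
  next
    case False
    then show ?thesis
      by (simp add: body_section_def holomorphic_fun_const)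
  qed
  moreover have "body_section U b \<mu> = (\<lambda>x. 0)" if "\<not> \<mu> \<subseteq> {..<n}" for \<mu>
  proof -
    have "\<mu> \<noteq> {}"
      using that by blast
    then show ?thesis
      by (simp add: body_section_def)
  qed
  ultimately show ?thesis
    by (simp add: model_sections_def) (simp add: body_section_def)
qed

lemma theta_section_in_model_sections:
  assumes manifold: "complex_manifold M" and \<nu>: "\<nu> \<subseteq> {..<n}"
  shows "theta_section U \<nu> \<in> model_sections M n U"
proof -
  have "holomorphic_fun M U (theta_section U \<nu> \<mu>)" for \<mu>
    by (rule holomorphic_fun_cong[OF manifold holomorphic_fun_const[of M U "if \<mu> = \<nu> then 1 else 0"]])
       (simp add: theta_section_def)
  moreover have "theta_section U \<nu> \<mu> = (\<lambda>x. 0)" if "\<not> \<mu> \<subseteq> {..<n}" for \<mu>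
  proof -
    have "\<mu> \<noteq> \<nu>"
      using that \<nu> by blast
    then show ?thesis
      by (simp add: theta_section_def)
  qed
  ultimately show ?thesis
    by (simp add: model_sections_def) (simp add: theta_section_def)
qed

text \<open>
What an automorphism over the identity map induces on the local model over \<open>V\<close>. Closure of the sections under
sums and products is part of the assumptions; it is inherited through the isomorphism with the structure sheaf.
\<close>

locale model_endomorphism =
  fixes M :: "('p, 'x) cmanifold_scheme" and n :: nat and V :: "'p set"
    and \<sigma> :: "'p set \<Rightarrow> 'p grassmann \<Rightarrow> 'p grassmann"
  assumes manifold: "complex_manifold M" and open_V: "openin (mtop M) V"
    and closed: "\<And>U f g. openin (mtop M) U \<Longrightarrow> U \<subseteq> V \<Longrightarrow> f \<in> model_sections M n U \<Longrightarrow> g \<in> model_sections M n U \<Longrightarrow>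
        f \<oplus>\<^bsub>model_superalgebra M n U\<^esub> g \<in> model_sections M n U \<and>
        f \<otimes>\<^bsub>model_superalgebra M n U\<^esub> g \<in> model_sections M n U"
    and hom: "\<And>U. openin (mtop M) U \<Longrightarrow> U \<subseteq> V \<Longrightarrow>
        \<sigma> U \<in> ring_hom (model_superalgebra M n U) (model_superalgebra M n U)"
    and scalar: "\<And>U c f. openin (mtop M) U \<Longrightarrow> U \<subseteq> V \<Longrightarrow> f \<in> model_sections M n U \<Longrightarrow>
        \<sigma> U (c \<odot>\<^bsub>model_superalgebra M n U\<^esub> f) = c \<odot>\<^bsub>model_superalgebra M n U\<^esub> \<sigma> U f"
    and restrict: "\<And>U U' f. openin (mtop M) U \<Longrightarrow> openin (mtop M) U' \<Longrightarrow> U' \<subseteq> U \<Longrightarrow> U \<subseteq> V \<Longrightarrow>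
        f \<in> model_sections M n U \<Longrightarrow>
        \<sigma> U' (res (model_sheaf M n) U U' f) = res (model_sheaf M n) U U' (\<sigma> U f)"
begin

abbreviation "S \<equiv> model_sections M n"
abbreviation "A \<equiv> model_superalgebra M n"

definition is_open :: "'p set \<Rightarrow> bool" where
  "is_open U \<longleftrightarrow> openin (mtop M) U \<and> U \<subseteq> V"

lemma is_open_V: "is_open V"
  by (simp add: is_open_def open_V)

lemma sigma_closed: "is_open U \<Longrightarrow> f \<in> S U \<Longrightarrow> \<sigma> U f \<in> S U"
  using hom[of U] by (auto simp: is_open_def ring_hom_def model_superalgebra_simps)

lemma sigma_mult: "is_open U \<Longrightarrow> f \<in> S U \<Longrightarrow> g \<in> S U \<Longrightarrow>
    \<sigma> U (f \<otimes>\<^bsub>A U\<^esub> g) \<mu> x = grassmann_mult (\<lambda>\<nu>. \<sigma> U f \<nu> x) (\<lambda>\<nu>. \<sigma> U g \<nu> x) \<mu>"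
  using hom[of U] by (simp add: is_open_def ring_hom_def model_superalgebra_simps)

lemma sigma_add: "is_open U \<Longrightarrow> f \<in> S U \<Longrightarrow> g \<in> S U \<Longrightarrow>
    \<sigma> U (f \<oplus>\<^bsub>A U\<^esub> g) \<mu> x = \<sigma> U f \<mu> x + \<sigma> U g \<mu> x"
  using hom[of U] by (simp add: is_open_def ring_hom_def model_superalgebra_simps)

lemma sigma_smult: "is_open U \<Longrightarrow> f \<in> S U \<Longrightarrow> \<sigma> U (c \<odot>\<^bsub>A U\<^esub> f) \<mu> x = c * \<sigma> U f \<mu> x"
  using scalar[of U] by (simp add: is_open_def model_superalgebra_simps)

lemma sigma_one: "is_open U \<Longrightarrow> \<sigma> U (theta_section U {}) = theta_section U {}"
  using hom[of U] by (simp add: is_open_def ring_hom_def model_superalgebra_simps)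

lemma sigma_restrict:
  assumes "is_open U" "is_open U'" "U' \<subseteq> U" "f \<in> S U" "x \<in> U'"
    and "\<And>\<nu> x. f' \<nu> x = (if x \<in> U' then f \<nu> x else 0)"
  shows "\<sigma> U' f' \<mu> x = \<sigma> U f \<mu> x"
proof -
  have "f' = res (model_sheaf M n) U U' f"
    by (simp add: fun_eq_iff model_sheaf_simps assms(6))
  then show ?thesis
    using restrict[of U U' f] assms by (simp add: is_open_def model_sheaf_simps)
qed

lemma body_section_in_S: "is_open U \<Longrightarrow> holomorphic_fun M U b \<Longrightarrow> body_section U b \<in> S U"
  by (rule body_section_in_model_sections[OF manifold])

lemma theta_section_in_S: "\<nu> \<subseteq> {..<n} \<Longrightarrow> theta_section U \<nu> \<in> S U"
  by (rule theta_section_in_model_sections[OF manifold])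

lemma smult_in_S:
  assumes U: "is_open U" and f: "f \<in> S U"
  shows "c \<odot>\<^bsub>A U\<^esub> f \<in> S U"
proof -
  have "c \<odot>\<^bsub>A U\<^esub> f = body_section U (\<lambda>x. c) \<otimes>\<^bsub>A U\<^esub> f"
  proof (intro ext)
    fix \<mu> x
    show "(c \<odot>\<^bsub>A U\<^esub> f) \<mu> x = (body_section U (\<lambda>x. c) \<otimes>\<^bsub>A U\<^esub> f) \<mu> x"
    proof (cases "finite \<mu>")
      case True
      then show ?thesis
        using model_sections_outside(1)[OF f, of x \<mu>]
        by (simp add: model_superalgebra_simps grassmann_mult_body_section)
    next
      case False
      then have "\<not> \<mu> \<subseteq> {..<n}"
        using finite_subset by blast
      from model_sections_outside(2)[OF f this] False show ?thesis
        by (simp add: model_superalgebra_simps grassmann_mult_def)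
    qed
  qed
  also have "\<dots> \<in> S U"
    using closed[of U] U f body_section_in_S[OF U holomorphic_fun_const] by (simp add: is_open_def)
  finally show ?thesis .
qed

lemma zero_in_S: "(\<lambda>\<mu> x. 0) \<in> S U"
  by (simp add: model_sections_def holomorphic_fun_const)

lemma sigma_zero:
  assumes U: "is_open U"
  shows "\<sigma> U (\<lambda>\<mu> x. 0) \<mu> x = 0"
proof -
  have "0 \<odot>\<^bsub>A U\<^esub> theta_section U {} = (\<lambda>\<mu> x. 0)"
    by (simp add: fun_eq_iff model_superalgebra_simps)
  then show ?thesis
    using sigma_smult[OF U theta_section_in_S[of "{}" U], of 0 \<mu> x] by simp
qed

lemma sigma_sum:
  assumes U: "is_open U" and "finite I" and "\<And>i. i \<in> I \<Longrightarrow> f i \<in> S U"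
  shows "(\<lambda>\<mu> x. \<Sum>i\<in>I. f i \<mu> x) \<in> S U \<and>
    (\<forall>\<mu> x. \<sigma> U (\<lambda>\<mu> x. \<Sum>i\<in>I. f i \<mu> x) \<mu> x = (\<Sum>i\<in>I. \<sigma> U (f i) \<mu> x))"
  using assms(2,3)
proof (induction I rule: finite_induct)
  case empty
  then show ?case
    by (simp add: zero_in_S sigma_zero[OF U])
next
  case (insert i I)
  then have IH: "f i \<in> S U" "(\<lambda>\<mu> x. \<Sum>i\<in>I. f i \<mu> x) \<in> S U"
      "\<forall>\<mu> x. \<sigma> U (\<lambda>\<mu> x. \<Sum>i\<in>I. f i \<mu> x) \<mu> x = (\<Sum>i\<in>I. \<sigma> U (f i) \<mu> x)"
    by auto
  have "(\<lambda>\<mu> x. \<Sum>i\<in>insert i I. f i \<mu> x) = f i \<oplus>\<^bsub>A U\<^esub> (\<lambda>\<mu> x. \<Sum>i\<in>I. f i \<mu> x)"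
    using insert by (simp add: fun_eq_iff model_superalgebra_simps)
  then show ?case
    using IH insert closed[of U] U sigma_add[OF U IH(1,2)] by (simp add: is_open_def)
qed

lemma body_theta_product:
  assumes "finite \<nu>"
  shows "(body_section U b \<otimes>\<^bsub>A U\<^esub> theta_section U \<nu>) \<mu> x = (if \<mu> = \<nu> \<and> x \<in> U then b x else 0)"
proof (cases "finite \<mu>")
  case True
  then show ?thesis
    by (simp add: model_superalgebra_simps grassmann_mult_body_section theta_section_def)
next
  case False
  then show ?thesis
    using assms by (auto simp: model_superalgebra_simps grassmann_mult_def)
qed

text \<open>
A section is the sum of its coefficients times the monomials in the odd generators, so \<open>\<sigma>\<close> is determined by its
effect on both.
\<close>

lemma sigma_expand:
  assumes U: "is_open U" and f: "f \<in> S U"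
  shows "\<sigma> U f \<mu> x = (\<Sum>\<nu>\<in>Pow {..<n}. grassmann_mult
      (\<lambda>\<alpha>. \<sigma> U (body_section U (f \<nu>)) \<alpha> x) (\<lambda>\<alpha>. \<sigma> U (theta_section U \<nu>) \<alpha> x) \<mu>)"
proof -
  have fin: "finite \<nu>" if "\<nu> \<in> Pow {..<n}" for \<nu>
    using that finite_subset by blast
  have hol: "holomorphic_fun M U (f \<nu>)" if "\<nu> \<in> Pow {..<n}" for \<nu>
    using f that by (simp add: model_sections_def)
  have "f = (\<lambda>\<mu> x. \<Sum>\<nu>\<in>Pow {..<n}. (body_section U (f \<nu>) \<otimes>\<^bsub>A U\<^esub> theta_section U \<nu>) \<mu> x)"
  proof (intro ext)
    fix \<mu> x
    have "(\<Sum>\<nu>\<in>Pow {..<n}. (body_section U (f \<nu>) \<otimes>\<^bsub>A U\<^esub> theta_section U \<nu>) \<mu> x) =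
        (\<Sum>\<nu>\<in>Pow {..<n}. if \<nu> = \<mu> then (if x \<in> U then f \<mu> x else 0) else 0)"
      by (intro sum.cong refl) (auto simp: body_theta_product fin)
    also have "\<dots> = f \<mu> x"
      using model_sections_outside[OF f] by (auto simp: model_sections_outside)
    finally show "f \<mu> x = (\<Sum>\<nu>\<in>Pow {..<n}. (body_section U (f \<nu>) \<otimes>\<^bsub>A U\<^esub> theta_section U \<nu>) \<mu> x)"
      by simp
  qed
  then have "\<sigma> U f \<mu> x = \<sigma> U (\<lambda>\<mu> x. \<Sum>\<nu>\<in>Pow {..<n}. (body_section U (f \<nu>) \<otimes>\<^bsub>A U\<^esub> theta_section U \<nu>) \<mu> x) \<mu> x"
    by simp
  also have "\<dots> = (\<Sum>\<nu>\<in>Pow {..<n}. \<sigma> U (body_section U (f \<nu>) \<otimes>\<^bsub>A U\<^esub> theta_section U \<nu>) \<mu> x)"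
    using closed[of U] U body_section_in_S[OF U hol] theta_section_in_S
    by (subst sigma_sum[OF U, THEN conjunct2, rule_format]) (auto simp: is_open_def)
  also have "\<dots> = (\<Sum>\<nu>\<in>Pow {..<n}. grassmann_mult
      (\<lambda>\<alpha>. \<sigma> U (body_section U (f \<nu>)) \<alpha> x) (\<lambda>\<alpha>. \<sigma> U (theta_section U \<nu>) \<alpha> x) \<mu>)"
    using body_section_in_S[OF U hol] theta_section_in_S by (intro sum.cong refl sigma_mult[OF U]) auto
  finally show ?thesis .
qed

text \<open>
If the body of \<open>\<sigma> b\<close> had at \<open>x\<close> a value \<open>c \<noteq> b x\<close>, then \<open>b - c\<close> would be invertible near \<open>x\<close>, while its
image has body 0 at \<open>x\<close> and is not.
\<close>

lemma sigma_body:
  assumes U: "is_open U" and b: "holomorphic_fun M U b" and x: "x \<in> U"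
  shows "\<sigma> U (body_section U b) {} x = b x"
proof (rule ccontr)
  define c where "c = \<sigma> U (body_section U b) {} x"
  assume "\<sigma> U (body_section U b) {} x \<noteq> b x"
  then have "b x \<noteq> c"
    by (simp add: c_def)
  then obtain U' where U': "openin (mtop M) U'" "x \<in> U'" "U' \<subseteq> U" "\<And>y. y \<in> U' \<Longrightarrow> b y \<noteq> c"
    using holomorphic_fun_neq_open[OF manifold _ b x] U by (metis is_open_def)
  have o': "is_open U'"
    using U U' by (auto simp: is_open_def)
  have b': "holomorphic_fun M U' b"
    using b U'(3) by (rule holomorphic_fun_subset)
  define f where "f = body_section U' b \<oplus>\<^bsub>A U'\<^esub> ((- c) \<odot>\<^bsub>A U'\<^esub> theta_section U' {})"
  define g where "g = body_section U' (\<lambda>y. 1 / (b y - c))"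
  have one: "theta_section U' {} \<in> S U'"
    by (rule theta_section_in_S) simp
  have f: "f \<in> S U'"
    unfolding f_def using closed[of U'] o' body_section_in_S[OF o' b'] smult_in_S[OF o' one]
    by (simp add: is_open_def)
  have g: "g \<in> S U'"
    unfolding g_def using U'(4) by (intro body_section_in_S o' holomorphic_fun_reciprocal manifold b')
  have f_eq: "f = body_section U' (\<lambda>y. b y - c)"
    by (auto simp: f_def fun_eq_iff model_superalgebra_simps body_section_def theta_section_def)
  have "f \<otimes>\<^bsub>A U'\<^esub> g = theta_section U' {}"
  proof (intro ext)
    fix \<mu> y
    show "(f \<otimes>\<^bsub>A U'\<^esub> g) \<mu> y = theta_section U' {} \<mu> y"
    proof (cases "finite \<mu>")
      case True
      then show ?thesis
        using U'(4)[of y]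
        by (simp add: f_eq model_superalgebra_simps grassmann_mult_body_section g_def)
           (simp add: body_section_def theta_section_def)
    next
      case False
      then show ?thesis
        by (auto simp: model_superalgebra_simps grassmann_mult_def theta_section_def)
    qed
  qed
  then have "\<sigma> U' f {} x * \<sigma> U' g {} x = 1"
    using sigma_mult[OF o' f g, of "{}" x] sigma_one[OF o'] U'(2)
    by (simp add: grassmann_mult_body) (simp add: theta_section_def)
  moreover have "\<sigma> U' f {} x = 0"
  proof -
    have "\<sigma> U' f {} x = \<sigma> U' (body_section U' b) {} x + (- c) * theta_section U' {} {} x"
      unfolding f_def
      by (simp add: sigma_add[OF o' body_section_in_S[OF o' b'] smult_in_S[OF o' one]]
          sigma_smult[OF o' one] sigma_one[OF o'])
    also have "\<sigma> U' (body_section U' b) {} x = c"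
      unfolding c_def using U'(2,3)
      by (intro sigma_restrict[OF U o' U'(3) body_section_in_S[OF U b]]) (auto simp: body_section_def)
    finally show ?thesis
      using U'(2) by (simp add: theta_section_def)
  qed
  ultimately show False
    by simp
qed

text \<open>
An odd generator squares to zero, hence so does the body of its image.
\<close>

lemma sigma_theta_order1:
  assumes U: "is_open U" and j: "j < n"
  shows "of_order n 1 (\<lambda>\<mu>. \<sigma> U (theta_section U {j}) \<mu> x)"
proof -
  have th: "theta_section U {j} \<in> S U"
    using j by (intro theta_section_in_S) auto
  have "theta_section U {j} \<otimes>\<^bsub>A U\<^esub> theta_section U {j} = (\<lambda>\<mu> x. 0)"
    by (simp add: fun_eq_iff model_superalgebra_simps theta_square)
  with sigma_mult[OF U th th, of "{}" x] have "\<sigma> U (theta_section U {j}) {} x = 0"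
    by (simp add: grassmann_mult_body sigma_zero[OF U])
  then show ?thesis
    unfolding of_order_def
    by (metis card_0_eq finite_lessThan finite_subset less_one)
qed

lemma sigma_theta_insert:
  assumes U: "is_open U" and "finite \<nu>" "\<forall>k\<in>\<nu>. j < k" "insert j \<nu> \<subseteq> {..<n}"
  shows "\<sigma> U (theta_section U (insert j \<nu>)) \<mu> x =
    grassmann_mult (\<lambda>\<alpha>. \<sigma> U (theta_section U {j}) \<alpha> x) (\<lambda>\<alpha>. \<sigma> U (theta_section U \<nu>) \<alpha> x) \<mu>"
  using sigma_mult[OF U theta_section_in_S theta_section_in_S, of "{j}" \<nu>] assms
    theta_mult[OF assms(3,2), where U = U and M = M and n = n] by simp

lemma sigma_theta_order:
  assumes U: "is_open U" and "\<nu> \<subseteq> {..<n}"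
  shows "of_order n (card \<nu>) (\<lambda>\<mu>. \<sigma> U (theta_section U \<nu>) \<mu> x)"
proof -
  have "finite \<nu>"
    using assms(2) finite_subset by blast
  then show ?thesis
    using assms(2)
  proof (induction \<nu> rule: finite_linorder_min_induct)
    case empty
    then show ?case
      by (simp add: of_order_def)
  next
    case (insert j \<nu>)
    then have "of_order n (1 + card \<nu>) (grassmann_mult
        (\<lambda>\<alpha>. \<sigma> U (theta_section U {j}) \<alpha> x) (\<lambda>\<alpha>. \<sigma> U (theta_section U \<nu>) \<alpha> x))"
      by (intro of_order_mult sigma_theta_order1[OF U]) auto
    moreover have "card (insert j \<nu>) = 1 + card \<nu>"
      using insert by (auto simp: card_insert_if)
    ultimately show ?case
      using sigma_theta_insert[OF U insert(1,2)] insert.prems by (simp add: of_order_def)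
  qed
qed

text \<open>
By the Leibniz-type identity \<open>a b - a' b' = (a - a') b + a' (b - b')\<close>: each further factor raises the order
by one, while the displacement of one factor has order \<open>q\<close>.
\<close>

lemma sigma_theta_diff_order:
  assumes q: "q \<ge> 1" and \<nu>: "\<nu> \<subseteq> {..<n}"
    and diff: "\<And>j. j < n \<Longrightarrow> of_order n q (\<lambda>\<mu>. \<sigma> V (theta_section V {j}) \<mu> x - theta_section V {j} \<mu> x)"
  shows "of_order n (card \<nu> + q - 1) (\<lambda>\<mu>. \<sigma> V (theta_section V \<nu>) \<mu> x - theta_section V \<nu> \<mu> x)"
proof -
  have "finite \<nu>"
    using \<nu> finite_subset by blast
  then show ?thesis
    using \<nu>
  proof (induction \<nu> rule: finite_linorder_min_induct)
    case empty
    then show ?case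
      by (simp add: of_order_def sigma_one[OF is_open_V])
  next
    case (insert j \<nu>)
    let ?a = "\<lambda>\<mu>. \<sigma> V (theta_section V {j}) \<mu> x" and ?a' = "\<lambda>\<mu>. theta_section V {j} \<mu> x"
    let ?b = "\<lambda>\<mu>. \<sigma> V (theta_section V \<nu>) \<mu> x" and ?b' = "\<lambda>\<mu>. theta_section V \<nu> \<mu> x"
    have sub: "j < n" "\<nu> \<subseteq> {..<n}"
      using insert.prems by auto
    have card: "card (insert j \<nu>) + q - 1 = q + card \<nu>"
      using insert(1,2) q by (auto simp: card_insert_if)
    have "of_order n (q + card \<nu>) (grassmann_mult (\<lambda>\<mu>. ?a \<mu> - ?a' \<mu>) ?b)"
      by (intro of_order_mult diff sigma_theta_order is_open_V sub)
    moreover have "of_order n (1 + (card \<nu> + q - 1)) (grassmann_mult ?a' (\<lambda>\<mu>. ?b \<mu> - ?b' \<mu>))"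
      by (intro of_order_mult insert.IH sub) (auto simp: of_order_def theta_section_def)
    moreover have "1 + (card \<nu> + q - 1) = q + card \<nu>"
      using q by simp
    moreover have "theta_section V (insert j \<nu>) \<mu> x = grassmann_mult ?a' ?b' \<mu>" for \<mu>
      by (subst theta_mult[OF insert(2,1), where M = M and n = n, symmetric]) (rule model_superalgebra_simps(2))
    ultimately show ?case
      unfolding card of_order_def sigma_theta_insert[OF is_open_V insert(1,2) insert.prems]
      by (simp add: grassmann_mult_diff)
  qed
qed

end

section \<open>Endomorphisms close to the identity\<close>

context model_endomorphism
begin

text \<open>
In the lowest degree of \<open>\<eta>\<close>, the coefficients enter only through their bodies, which \<open>\<sigma>\<close> preserves, so
\<open>\<sigma>\<close> acts linearly there.
\<close>

lemma sigma_leading: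
  assumes \<eta>: "\<eta> \<in> S V" and order: "\<And>y. y \<in> V \<Longrightarrow> of_order n q (\<lambda>\<mu>. \<eta> \<mu> y)"
    and x: "x \<in> V" and \<mu>: "\<mu> \<subseteq> {..<n}" "card \<mu> = q"
  shows "\<sigma> V \<eta> \<mu> x = (\<Sum>\<nu> | \<nu> \<subseteq> {..<n} \<and> card \<nu> = q. \<eta> \<nu> x * \<sigma> V (theta_section V \<nu>) \<mu> x)"
proof -
  let ?t = "\<lambda>\<nu>. grassmann_mult (\<lambda>\<alpha>. \<sigma> V (body_section V (\<eta> \<nu>)) \<alpha> x) (\<lambda>\<alpha>. \<sigma> V (theta_section V \<nu>) \<alpha> x) \<mu>"
  have "?t \<nu> = 0" if \<nu>: "\<nu> \<subseteq> {..<n}" "card \<nu> \<noteq> q" for \<nu>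
  proof (cases "card \<nu> < q")
    case True
    then have "body_section V (\<eta> \<nu>) = (\<lambda>\<mu> x. 0)"
      using order \<nu> by (auto simp: body_section_def of_order_def fun_eq_iff)
    then show ?thesis
      by (simp add: sigma_zero[OF is_open_V] grassmann_mult_zero)
  next
    case False
    have "of_order n (0 + card \<nu>) (grassmann_mult (\<lambda>\<alpha>. \<sigma> V (body_section V (\<eta> \<nu>)) \<alpha> x)
        (\<lambda>\<alpha>. \<sigma> V (theta_section V \<nu>) \<alpha> x))"
      by (intro of_order_mult sigma_theta_order is_open_V \<nu>) (simp add: of_order_def)
    then show ?thesis
      using False \<nu> \<mu> by (auto simp: of_order_def)
  qed
  moreover have "?t \<nu> = \<eta> \<nu> x * \<sigma> V (theta_section V \<nu>) \<mu> x" if \<nu>: "\<nu> \<subseteq> {..<n}" "card \<nu> = q" for \<nu>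
  proof -
    have "holomorphic_fun M V (\<eta> \<nu>)"
      using \<eta> \<nu> by (simp add: model_sections_def)
    moreover have "of_order n (card \<mu>) (\<lambda>\<alpha>. \<sigma> V (theta_section V \<nu>) \<alpha> x)"
      using sigma_theta_order[OF is_open_V \<nu>(1), of x] \<nu>(2) \<mu>(2) by simp
    ultimately show ?thesis
      using grassmann_mult_leading[OF _ \<mu>(1)] sigma_body[OF is_open_V _ x] by metis
  qed
  ultimately have "(\<Sum>\<nu>\<in>Pow {..<n}. ?t \<nu>) =
      (\<Sum>\<nu> | \<nu> \<subseteq> {..<n} \<and> card \<nu> = q. \<eta> \<nu> x * \<sigma> V (theta_section V \<nu>) \<mu> x)"
    by (intro sum.mono_neutral_cong_right) auto
  then show ?thesis
    using sigma_expand[OF is_open_V \<eta>] by simp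
qed

text \<open>
For \<open>q = 1\<close> the action on monomials is close to the identity by assumption, for \<open>q \<ge> 2\<close> it is the identity
in degree \<open>q\<close>, because the displacement of a monomial has order \<open>2 q - 1 > q\<close>.
\<close>

lemma sigma_leading_close:
  assumes \<eta>: "\<eta> \<in> S V" and order: "\<And>y. y \<in> V \<Longrightarrow> of_order n q (\<lambda>\<mu>. \<eta> \<mu> y)"
    and x: "x \<in> V" and \<mu>: "\<mu> \<subseteq> {..<n}" "card \<mu> = q" and q: "q \<ge> 1"
    and diff: "\<And>j. j < n \<Longrightarrow> of_order n q (\<lambda>\<mu>. \<sigma> V (theta_section V {j}) \<mu> x - theta_section V {j} \<mu> x)"
    and close: "\<And>j \<mu>. j < n \<Longrightarrow> \<mu> \<subseteq> {..<n} \<Longrightarrow>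
      cmod (\<sigma> V (theta_section V {j}) \<mu> x - theta_section V {j} \<mu> x) \<le> \<epsilon>" and \<epsilon>: "\<epsilon> \<ge> 0"
  shows "cmod (\<sigma> V \<eta> \<mu> x - \<eta> \<mu> x) \<le> \<epsilon> * (\<Sum>\<nu> | \<nu> \<subseteq> {..<n} \<and> card \<nu> = q. cmod (\<eta> \<nu> x))"
proof -
  let ?P = "{\<nu>. \<nu> \<subseteq> {..<n} \<and> card \<nu> = q}"
  have fin: "finite ?P"
    by (rule finite_subset[of _ "Pow {..<n}"]) auto
  have "cmod (\<sigma> V (theta_section V \<nu>) \<mu> x - theta_section V \<nu> \<mu> x) \<le> \<epsilon>" if \<nu>: "\<nu> \<in> ?P" for \<nu>
  proof (cases "q = 1")
    case True
    then obtain j where "\<nu> = {j}"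
      using \<nu> by (auto simp: card_1_singleton_iff)
    then show ?thesis
      using close[OF _ \<mu>(1)] \<nu> by auto
  next
    case False
    have "of_order n (card \<nu> + q - 1) (\<lambda>\<mu>. \<sigma> V (theta_section V \<nu>) \<mu> x - theta_section V \<nu> \<mu> x)"
      using \<nu> by (intro sigma_theta_diff_order q diff) auto
    then have "\<sigma> V (theta_section V \<nu>) \<mu> x - theta_section V \<nu> \<mu> x = 0"
      unfolding of_order_def using \<mu> \<nu> False q by (elim allE[of _ \<mu>]) auto
    then show ?thesis
      using \<epsilon> by simp
  qed
  note bound = this
  have "(\<Sum>\<nu>\<in>?P. \<eta> \<nu> x * theta_section V \<nu> \<mu> x) = (\<Sum>\<nu>\<in>?P. if \<nu> = \<mu> then \<eta> \<mu> x else 0)"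
    using x by (intro sum.cong) (auto simp: theta_section_def)
  also have "\<dots> = \<eta> \<mu> x"
    using fin \<mu> by simp
  finally have "\<sigma> V \<eta> \<mu> x - \<eta> \<mu> x = (\<Sum>\<nu>\<in>?P. \<eta> \<nu> x * (\<sigma> V (theta_section V \<nu>) \<mu> x - theta_section V \<nu> \<mu> x))"
    using sigma_leading[OF \<eta> order x \<mu>] by (simp add: right_diff_distrib sum_subtractf)
  also have "cmod \<dots> \<le> (\<Sum>\<nu>\<in>?P. cmod (\<eta> \<nu> x) * \<epsilon>)"
    by (intro sum_norm_le) (auto simp: norm_mult intro!: mult_left_mono bound)
  finally show ?thesis
    by (simp add: sum_distrib_left mult.commute)
qed

end

text \<open>
With \<open>\<eta> = \<sigma> \<xi> - \<xi>\<close> one has \<open>\<sigma>\<^sup>2 \<xi> - \<xi> = \<eta> + \<sigma> \<eta>\<close>, and in the lowest degree \<open>q\<close> the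
second summand differs little from \<open>\<eta>\<close>. So the degree-\<open>q\<close> part of the displacement expands under squaring and
must vanish. In degrees above \<open>n\<close> nothing is left.
\<close>

lemma small_endomorphisms_fix_generators:
  fixes M :: "('p, 'x) cmanifold_scheme" and \<sigma> :: "'h \<Rightarrow> 'p set \<Rightarrow> 'p grassmann \<Rightarrow> 'p grassmann"
  assumes endo: "\<And>h. h \<in> H \<Longrightarrow> model_endomorphism M n V (\<sigma> h)"
    and sq: "\<And>h. h \<in> H \<Longrightarrow> sq h \<in> H"
    and \<sigma>_sq: "\<And>h f. h \<in> H \<Longrightarrow> f \<in> model_sections M n V \<Longrightarrow> \<sigma> (sq h) V f = \<sigma> h V (\<sigma> h V f)"
    and gens: "G \<subseteq> model_sections M n V" and theta: "\<And>j. j < n \<Longrightarrow> theta_section V {j} \<in> G"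
    and body: "\<And>h \<xi> x. h \<in> H \<Longrightarrow> \<xi> \<in> G \<Longrightarrow> x \<in> V \<Longrightarrow> \<sigma> h V \<xi> {} x = \<xi> {} x"
    and close: "\<And>h \<xi> x \<mu>. h \<in> H \<Longrightarrow> \<xi> \<in> G \<Longrightarrow> x \<in> V \<Longrightarrow> \<mu> \<subseteq> {..<n} \<Longrightarrow>
      cmod (\<sigma> h V \<xi> \<mu> x - \<xi> \<mu> x) \<le> \<epsilon>"
    and \<epsilon>: "\<epsilon> \<ge> 0" "2 ^ n * \<epsilon> \<le> 1 / 2"
    and h: "h \<in> H" and \<xi>: "\<xi> \<in> G"
  shows "\<sigma> h V \<xi> = \<xi>"
proof -
  have order: "\<forall>h\<in>H. \<forall>\<xi>\<in>G. \<forall>x\<in>V. of_order n q (\<lambda>\<mu>. \<sigma> h V \<xi> \<mu> x - \<xi> \<mu> x)" if "q \<ge> 1" for q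
    using that
  proof (induction q rule: dec_induct)
    case base
    show ?case
      using body unfolding of_order_def
      by (metis card_0_eq finite_lessThan finite_subset less_one right_minus_eq)
  next
    case (step q)
    let ?P = "{\<nu>. \<nu> \<subseteq> {..<n} \<and> card \<nu> = q}"
    have fin: "finite ?P" and card_P: "card ?P \<le> 2 ^ n"
      using card_mono[of "Pow {..<n}" ?P] by (auto simp: card_Pow intro: finite_subset[of _ "Pow {..<n}"])
    have zero: "(\<Sum>\<mu>\<in>?P. cmod (\<sigma> h V \<xi> \<mu> x - \<xi> \<mu> x)) \<le> 0" if h: "h \<in> H" and \<xi>: "\<xi> \<in> G" and x: "x \<in> V" for h \<xi> x
    proof (rule no_bounded_expansion[where H = H and sq = sq and B = "real (card ?P) * \<epsilon>"])
      show "(\<Sum>\<mu>\<in>?P. cmod (\<sigma> h V \<xi> \<mu> x - \<xi> \<mu> x)) \<le> real (card ?P) * \<epsilon>" if "h \<in> H" for h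
        using close[OF that \<xi> x] by (intro sum_bounded_above) auto
      fix h
      assume h: "h \<in> H"
      interpret model_endomorphism M n V "\<sigma> h"
        by (rule endo[OF h])
      define \<eta> where "\<eta> = \<sigma> h V \<xi> \<oplus>\<^bsub>A V\<^esub> ((- 1) \<odot>\<^bsub>A V\<^esub> \<xi>)"
      have \<xi>_in: "\<xi> \<in> S V"
        using \<xi> gens by blast
      have \<eta>_in: "\<eta> \<in> S V"
        unfolding \<eta>_def using closed[OF open_V] sigma_closed[OF is_open_V \<xi>_in] smult_in_S[OF is_open_V \<xi>_in] by blast
      have \<eta>_eq: "\<eta> \<mu> y = \<sigma> h V \<xi> \<mu> y - \<xi> \<mu> y" for \<mu> y
        by (simp add: \<eta>_def model_superalgebra_simps)
      have "\<sigma> h V \<xi> = \<xi> \<oplus>\<^bsub>A V\<^esub> \<eta>"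
        by (simp add: fun_eq_iff model_superalgebra_simps \<eta>_eq)
      then have sq_eq: "\<sigma> (sq h) V \<xi> \<mu> x - \<xi> \<mu> x = \<eta> \<mu> x + \<sigma> h V \<eta> \<mu> x" for \<mu>
        using sigma_add[OF is_open_V \<xi>_in \<eta>_in] \<sigma>_sq[OF h \<xi>_in] by (simp add: \<eta>_eq)
      let ?D = "\<Sum>\<mu>\<in>?P. cmod (\<eta> \<mu> x)"
      have "2 * cmod (\<eta> \<mu> x) - \<epsilon> * ?D \<le> cmod (\<sigma> (sq h) V \<xi> \<mu> x - \<xi> \<mu> x)" if "\<mu> \<in> ?P" for \<mu>
      proof -
        have "cmod (\<sigma> h V \<eta> \<mu> x - \<eta> \<mu> x) \<le> \<epsilon> * ?D"
        proof (rule sigma_leading_close[OF \<eta>_in _ x])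
          show "of_order n q (\<lambda>\<mu>. \<eta> \<mu> y)" if "y \<in> V" for y
            using step.IH h \<xi> that by (simp add: \<eta>_eq)
        qed (use that step h x theta close \<epsilon> in auto)
        moreover have "cmod (2 * \<eta> \<mu> x) \<le> cmod (\<eta> \<mu> x + \<sigma> h V \<eta> \<mu> x) + cmod (\<sigma> h V \<eta> \<mu> x - \<eta> \<mu> x)"
          using norm_triangle_ineq4[of "\<eta> \<mu> x + \<sigma> h V \<eta> \<mu> x" "\<sigma> h V \<eta> \<mu> x - \<eta> \<mu> x"] by simp
        ultimately show ?thesis
          by (simp add: sq_eq norm_mult)
      qed
      then have "(\<Sum>\<mu>\<in>?P. 2 * cmod (\<eta> \<mu> x) - \<epsilon> * ?D) \<le> (\<Sum>\<mu>\<in>?P. cmod (\<sigma> (sq h) V \<xi> \<mu> x - \<xi> \<mu> x))"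
        by (intro sum_mono)
      moreover have "(\<Sum>\<mu>\<in>?P. 2 * cmod (\<eta> \<mu> x) - \<epsilon> * ?D) = 2 * ?D - real (card ?P) * \<epsilon> * ?D"
        by (simp add: sum_subtractf sum_distrib_left mult.assoc)
      moreover have "real (card ?P) * \<epsilon> * ?D \<le> 1 / 2 * ?D"
      proof (intro mult_right_mono)
        have "real (card ?P) \<le> 2 ^ n"
          using card_P by (metis of_nat_le_iff of_nat_numeral of_nat_power)
        then have "real (card ?P) * \<epsilon> \<le> 2 ^ n * \<epsilon>"
          using \<epsilon>(1) by (rule mult_right_mono)
        then show "real (card ?P) * \<epsilon> \<le> 1 / 2"
          using \<epsilon>(2) by linarith
      qed (intro sum_nonneg, simp)
      ultimately show "3 / 2 * (\<Sum>\<mu>\<in>?P. cmod (\<sigma> h V \<xi> \<mu> x - \<xi> \<mu> x)) \<le>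
          (\<Sum>\<mu>\<in>?P. cmod (\<sigma> (sq h) V \<xi> \<mu> x - \<xi> \<mu> x))"
        by (simp add: \<eta>_eq)
    qed (use sq h in auto)
    show ?case
    proof (intro ballI)
      fix h \<xi> x
      assume *: "h \<in> H" "\<xi> \<in> G" "x \<in> V"
      have "(\<Sum>\<mu>\<in>?P. cmod (\<sigma> h V \<xi> \<mu> x - \<xi> \<mu> x)) = 0"
        using zero[OF *] by (intro antisym sum_nonneg) auto
      then have "\<forall>\<mu>\<in>?P. cmod (\<sigma> h V \<xi> \<mu> x - \<xi> \<mu> x) = 0"
        using fin by (subst (asm) sum_nonneg_eq_0_iff) auto
      then show "of_order n (Suc q) (\<lambda>\<mu>. \<sigma> h V \<xi> \<mu> x - \<xi> \<mu> x)"
        using step.IH * unfolding of_order_def by (auto simp: less_Suc_eq)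
    qed
  qed
  interpret model_endomorphism M n V "\<sigma> h"
    by (rule endo[OF h])
  have \<xi>_in: "\<xi> \<in> S V" "\<sigma> h V \<xi> \<in> S V"
    using \<xi> gens sigma_closed[OF is_open_V] by auto
  show ?thesis
  proof (intro ext)
    fix \<mu> x
    show "\<sigma> h V \<xi> \<mu> x = \<xi> \<mu> x"
    proof (cases "\<mu> \<subseteq> {..<n} \<and> x \<in> V")
      case True
      then have "card \<mu> < Suc n"
        using card_mono[of "{..<n}" \<mu>] by simp
      then show ?thesis
        using order[of "Suc n"] True h \<xi> unfolding of_order_def by fastforce
    next
      case False
      then show ?thesis
        using model_sections_outside[OF \<xi>_in(1)] model_sections_outside[OF \<xi>_in(2)] by metis
    qed
  qed
qed

context model_endomorphism
begin

text \<open>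
For a coefficient \<open>b\<close> and a point \<open>x\<close>, the Hadamard expansion of \<open>b\<close> around \<open>x\<close> is mapped by \<open>\<sigma>\<close> to
\<open>b x + \<Sum>\<^sub>i (z\<^sub>i - z\<^sub>i(x)) \<sigma> g\<^sub>i\<close>, whatever \<open>\<sigma> g\<^sub>i\<close> is, and at \<open>x\<close> this is the constant \<open>b x\<close>.
\<close>

lemma identity_from_generators:
  assumes chart: "(U0, \<psi>) \<in> atlas M" and V: "V \<subseteq> U0"
    and even: "\<And>i. i < mdim M \<Longrightarrow> \<sigma> V (body_section V (\<lambda>x. \<psi> x i)) = body_section V (\<lambda>x. \<psi> x i)"
    and odd: "\<And>j. j < n \<Longrightarrow> \<sigma> V (theta_section V {j}) = theta_section V {j}"
    and U: "is_open U" and f: "f \<in> S U"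
  shows "\<sigma> U f = f"
proof -
  interpret c: manifold_chart M U0 \<psi>
    using manifold chart by unfold_locales
  have theta1: "\<sigma> U (theta_section U {j}) \<mu> x = theta_section U {j} \<mu> x" if U: "is_open U" and j: "j < n" for U j \<mu> x
  proof (cases "x \<in> U")
    case True
    have th: "theta_section V {j} \<in> S V"
      using j by (intro theta_section_in_S) auto
    have "\<sigma> U (theta_section U {j}) \<mu> x = \<sigma> V (theta_section V {j}) \<mu> x"
      using U by (intro sigma_restrict[OF is_open_V U _ th True]) (auto simp: is_open_def theta_section_def)
    then show ?thesis
      using True U odd[OF j] by (auto simp: is_open_def theta_section_def)
  next
    case False
    have "theta_section U {j} \<in> S U"
      using j by (intro theta_section_in_S) auto
    from model_sections_outside(1)[OF sigma_closed[OF U this] False] False show ?thesis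
      by (simp add: theta_section_def)
  qed
  have theta: "\<sigma> U (theta_section U \<nu>) \<mu> x = theta_section U \<nu> \<mu> x" if U: "is_open U" and \<nu>: "\<nu> \<subseteq> {..<n}" for U \<nu> \<mu> x
  proof -
    have "finite \<nu>"
      using \<nu> finite_subset by blast
    then show ?thesis
      using \<nu>
    proof (induction \<nu> arbitrary: \<mu> rule: finite_linorder_min_induct)
      case empty
      then show ?case
        by (simp add: sigma_one[OF U])
    next
      case (insert j \<nu>)
      then have "\<sigma> U (theta_section U (insert j \<nu>)) \<mu> x =
          grassmann_mult (\<lambda>\<alpha>. theta_section U {j} \<alpha> x) (\<lambda>\<alpha>. theta_section U \<nu> \<alpha> x) \<mu>"
        using sigma_theta_insert[OF U insert(1,2)] theta1[OF U] by auto
      also have "\<dots> = theta_section U (insert j \<nu>) \<mu> x"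
        by (subst theta_mult[OF insert(2,1), where M = M and n = n, symmetric])
           (rule model_superalgebra_simps(2)[symmetric])
      finally show ?case .
    qed
  qed
  have coord: "\<sigma> U (body_section U (\<lambda>x. \<psi> x i)) \<mu> x = body_section U (\<lambda>x. \<psi> x i) \<mu> x"
    if U: "is_open U" and i: "i < mdim M" and x: "x \<in> U" for U i \<mu> x
  proof -
    have "\<sigma> U (body_section U (\<lambda>x. \<psi> x i)) \<mu> x = \<sigma> V (body_section V (\<lambda>x. \<psi> x i)) \<mu> x"
      using U V i
      by (intro sigma_restrict[OF is_open_V U _ body_section_in_S[OF is_open_V] x] c.holomorphic_coordinate)
         (auto simp: is_open_def body_section_def)
    then show ?thesis
      using x U even[OF i] by (auto simp: is_open_def body_section_def)
  qed
  have body: "\<sigma> U (body_section U b) \<mu> x = (if \<mu> = {} then b x else 0)"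
    if U: "is_open U" and b: "holomorphic_fun M U b" and x: "x \<in> U" for U b \<mu> x
  proof -
    have UU: "openin (mtop M) U" "U \<subseteq> U0"
      using U V by (auto simp: is_open_def)
    obtain r where r: "r > 0" "polydisc (mdim M) (\<psi> x) r \<subseteq> \<psi> ` U"
      by (rule c.small_polydisc[OF UU x])
    let ?P = "polydisc (mdim M) (\<psi> x) r"
    define Q where "Q = {y \<in> U0. \<psi> y \<in> ?P}"
    have QU: "Q \<subseteq> U"
      using r(2) UU(2) c.inj by (auto simp: Q_def dest!: subsetD inj_onD)
    have Q: "is_open Q"
      using c.open_preimage[OF openin_polydisc, of "\<psi> x" r] QU U by (auto simp: is_open_def Q_def)
    have \<psi>x: "\<psi> x \<in> ?P"
      using r(1) c.chart_zero x UU(2) by (intro center_in_polydisc) auto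
    then have xQ: "x \<in> Q"
      using x UU(2) by (auto simp: Q_def)
    have Q_image: "\<psi> ` Q = ?P"
      using r(2) UU(2) by (auto simp: Q_def)
    have QU0: "Q \<subseteq> U0"
      by (auto simp: Q_def)
    have "holomorphic_Cn (mdim M) ?P (\<lambda>z. b (inv_into U0 \<psi> z))"
      using c.holomorphic_fun_in_chart[OF holomorphic_fun_subset[OF b QU] QU0] by (simp add: Q_image)
    from holomorphic_Hadamard[OF this \<psi>x] obtain g where
      g: "\<And>i. i < mdim M \<Longrightarrow> holomorphic_Cn (mdim M) ?P (g i)"
        "\<And>z. z \<in> ?P \<Longrightarrow> b (inv_into U0 \<psi> z) = b (inv_into U0 \<psi> (\<psi> x)) + (\<Sum>i<mdim M. (z i - \<psi> x i) * g i z)"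
      by blast
    have b_eq: "b y = b x + (\<Sum>i<mdim M. (\<psi> y i - \<psi> x i) * g i (\<psi> y))" if "y \<in> Q" for y
      using g(2)[of "\<psi> y"] that xQ QU0 c.inv_chart by (auto simp: Q_def)
    have hol_g: "holomorphic_fun M Q (\<lambda>y. g i (\<psi> y))" if "i < mdim M" for i
    proof (rule c.holomorphic_fun_from_chart[OF _ QU0])
      show "holomorphic_Cn (mdim M) (\<psi> ` Q) (\<lambda>z. g i (\<psi> (inv_into U0 \<psi> z)))"
      proof (rule holomorphic_Cn_cong[THEN iffD1])
        show "holomorphic_Cn (mdim M) (\<psi> ` Q) (g i)"
          unfolding Q_image by (rule g(1)[OF that])
        show "g i z = g i (\<psi> (inv_into U0 \<psi> z))" if "z \<in> \<psi> ` Q" for z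
          using that QU0 c.inv_chart by auto
      qed
    qed
    define e where "e = (\<lambda>i. body_section Q (\<lambda>y. \<psi> y i) \<oplus>\<^bsub>A Q\<^esub> ((- \<psi> x i) \<odot>\<^bsub>A Q\<^esub> theta_section Q {}))"
    define t where "t = (\<lambda>i. e i \<otimes>\<^bsub>A Q\<^esub> body_section Q (\<lambda>y. g i (\<psi> y)))"
    have one: "theta_section Q {} \<in> S Q"
      by (rule theta_section_in_S) simp
    have coord_in: "body_section Q (\<lambda>y. \<psi> y i) \<in> S Q" if "i < mdim M" for i
      using that by (intro body_section_in_S Q c.holomorphic_coordinate QU0)
    have g_in: "body_section Q (\<lambda>y. g i (\<psi> y)) \<in> S Q" if "i < mdim M" for i
      using that by (intro body_section_in_S Q hol_g)
    have e_in: "e i \<in> S Q" if "i < mdim M" for i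
      unfolding e_def using closed[of Q] Q coord_in[OF that] smult_in_S[OF Q one] by (simp add: is_open_def)
    have t_in: "t i \<in> S Q" if "i < mdim M" for i
      unfolding t_def using closed[of Q] Q e_in[OF that] g_in[OF that] by (simp add: is_open_def)
    have e_val: "e i \<nu> y = (if \<nu> = {} \<and> y \<in> Q then \<psi> y i - \<psi> x i else 0)" for i \<nu> y
      by (simp add: e_def model_superalgebra_simps body_section_def theta_section_def)
    have \<sigma>e: "\<sigma> Q (e i) \<nu> x = 0" if "i < mdim M" for i \<nu>
      unfolding e_def using xQ
      by (simp add: sigma_add[OF Q coord_in[OF that] smult_in_S[OF Q one]] sigma_smult[OF Q one]
          sigma_one[OF Q] coord[OF Q that xQ])
         (simp add: body_section_def theta_section_def)
    have \<sigma>t: "\<sigma> Q (t i) \<nu> x = 0" if "i < mdim M" for i \<nu>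
      unfolding t_def
      by (simp add: sigma_mult[OF Q e_in[OF that] g_in[OF that]] \<sigma>e[OF that] grassmann_mult_zero)
    have sum_in: "(\<lambda>\<mu> x. \<Sum>i<mdim M. t i \<mu> x) \<in> S Q"
        and sum_\<sigma>: "\<sigma> Q (\<lambda>\<mu> x. \<Sum>i<mdim M. t i \<mu> x) \<mu> x = 0" for \<mu>
      using sigma_sum[OF Q, of "{..<mdim M}" t] t_in \<sigma>t by auto
    have t_val: "t i \<nu> y = (if \<nu> = {} \<and> y \<in> Q then (\<psi> y i - \<psi> x i) * g i (\<psi> y) else 0)" for i \<nu> y
    proof (cases "finite \<nu>")
      case True
      have e_eq: "e i = body_section Q (\<lambda>y. \<psi> y i - \<psi> x i)"
        by (simp add: fun_eq_iff e_val body_section_def)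
      show ?thesis
        using True by (simp add: t_def model_superalgebra_simps e_eq grassmann_mult_body_section)
          (simp add: body_section_def)
    next
      case False
      then show ?thesis
        by (auto simp: t_def model_superalgebra_simps grassmann_mult_def)
    qed
    have "body_section Q b = (b x \<odot>\<^bsub>A Q\<^esub> theta_section Q {}) \<oplus>\<^bsub>A Q\<^esub> (\<lambda>\<mu> x. \<Sum>i<mdim M. t i \<mu> x)"
    proof (intro ext)
      fix \<mu> y
      show "body_section Q b \<mu> y =
          ((b x \<odot>\<^bsub>A Q\<^esub> theta_section Q {}) \<oplus>\<^bsub>A Q\<^esub> (\<lambda>\<mu> x. \<Sum>i<mdim M. t i \<mu> x)) \<mu> y"
        unfolding model_superalgebra_simps t_val body_section_def theta_section_def
        by (cases "\<mu> = {} \<and> y \<in> Q") (auto simp: b_eq intro!: sum.neutral)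
    qed
    then have "\<sigma> Q (body_section Q b) \<mu> x = b x * theta_section Q {} \<mu> x"
      by (simp add: sigma_add[OF Q smult_in_S[OF Q one] sum_in] sigma_smult[OF Q one] sigma_one[OF Q] sum_\<sigma>)
    moreover have "\<sigma> Q (body_section Q b) \<mu> x = \<sigma> U (body_section U b) \<mu> x"
      using QU by (intro sigma_restrict[OF U Q QU body_section_in_S[OF U b] xQ]) (auto simp: body_section_def)
    ultimately show ?thesis
      using xQ by (simp add: theta_section_def)
  qed
  show ?thesis
  proof (intro ext)
    fix \<mu> x
    show "\<sigma> U f \<mu> x = f \<mu> x"
    proof (cases "\<mu> \<subseteq> {..<n} \<and> x \<in> U")
      case True
      then have fin: "finite \<mu>"
        using finite_subset by blast
      have "grassmann_mult (\<lambda>\<alpha>. \<sigma> U (body_section U (f \<nu>)) \<alpha> x) (\<lambda>\<alpha>. \<sigma> U (theta_section U \<nu>) \<alpha> x) \<mu> =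
          (if \<nu> = \<mu> then f \<mu> x else 0)" if "\<nu> \<in> Pow {..<n}" for \<nu>
      proof -
        have "holomorphic_fun M U (f \<nu>)"
          using f that by (simp add: model_sections_def)
        then have "grassmann_mult (\<lambda>\<alpha>. \<sigma> U (body_section U (f \<nu>)) \<alpha> x) (\<lambda>\<alpha>. \<sigma> U (theta_section U \<nu>) \<alpha> x) \<mu> =
            grassmann_mult (\<lambda>\<alpha>. if \<alpha> = {} then f \<nu> x else 0) (\<lambda>\<alpha>. theta_section U \<nu> \<alpha> x) \<mu>"
          using body[OF U] theta[OF U] that True by simp
        also have "\<dots> = f \<nu> x * theta_section U \<nu> \<mu> x"
          by (rule grassmann_mult_scalar[OF fin])
        finally show ?thesis
          using True by (auto simp: theta_section_def)
      qed
      then have "\<sigma> U f \<mu> x = (\<Sum>\<nu>\<in>Pow {..<n}. if \<nu> = \<mu> then f \<mu> x else 0)"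
        unfolding sigma_expand[OF U f] by (intro sum.cong refl)
      then show ?thesis
        using True by simp
    next
      case False
      then show ?thesis
        using model_sections_outside[OF f] model_sections_outside[OF sigma_closed[OF U f]] by metis
    qed
  qed
qed

end

section \<open>Automorphisms of a supermanifold and neighbourhoods of the identity\<close>

text \<open>
A subbasic set of the automorphism group confines a coefficient to one open set on a whole compact set. Covering the
compact set by finitely many compact pieces on which the functions are almost constant turns this into uniform closeness.
\<close>

lemma fine_compact_cover:
  fixes u :: "'i \<Rightarrow> 'a \<Rightarrow> complex"
  assumes K: "compactin T K" and I: "finite I"
    and u: "\<And>i. i \<in> I \<Longrightarrow> continuous_map (subtopology T K) euclidean (u i)" and \<epsilon>: "\<epsilon> > 0"
  obtains Q where "finite Q" "Q \<subseteq> K" "\<forall>x\<in>K. \<exists>q\<in>Q. \<forall>i\<in>I. cmod (u i x - u i q) \<le> \<epsilon>"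
    "\<forall>q\<in>Q. compactin T {x \<in> K. \<forall>i\<in>I. cmod (u i x - u i q) \<le> \<epsilon>}"
proof -
  let ?T = "subtopology T K"
  have top: "topspace ?T = K"
    using compactin_subset_topspace[OF K] by auto
  have comp: "compact_space ?T"
    using K by (simp add: compactin_subspace)
  have op: "openin ?T {x \<in> K. \<forall>i\<in>I. cmod (u i x - u i q) < \<epsilon>}" for q
  proof -
    have "openin ?T {x \<in> topspace ?T. u i x \<in> ball (u i q) \<epsilon>}" if "i \<in> I" for i
      using u[OF that] by (rule openin_continuous_map_preimage) simp
    then have "openin ?T (\<Inter> (insert (topspace ?T) ((\<lambda>i. {x \<in> topspace ?T. u i x \<in> ball (u i q) \<epsilon>}) ` I)))"
      using I by (intro openin_Inter) (auto simp del: topspace_subtopology)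
    then have "openin ?T (topspace ?T \<inter> (\<Inter>i\<in>I. {x \<in> topspace ?T. u i x \<in> ball (u i q) \<epsilon>}))"
      by (simp only: Inter_insert)
    also have "topspace ?T \<inter> (\<Inter>i\<in>I. {x \<in> topspace ?T. u i x \<in> ball (u i q) \<epsilon>}) =
        {x \<in> K. \<forall>i\<in>I. cmod (u i x - u i q) < \<epsilon>}"
      by (auto simp: top dist_norm norm_minus_commute simp del: topspace_subtopology)
    finally show ?thesis .
  qed
  have cl: "closedin ?T {x \<in> K. \<forall>i\<in>I. cmod (u i x - u i q) \<le> \<epsilon>}" for q
  proof -
    have "closedin ?T {x \<in> topspace ?T. u i x \<in> cball (u i q) \<epsilon>}" if "i \<in> I" for i
      using u[OF that] by (rule closedin_continuous_map_preimage) simp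
    then have "closedin ?T (\<Inter> (insert (topspace ?T) ((\<lambda>i. {x \<in> topspace ?T. u i x \<in> cball (u i q) \<epsilon>}) ` I)))"
      by (intro closedin_Inter) (auto simp del: topspace_subtopology)
    then have "closedin ?T (topspace ?T \<inter> (\<Inter>i\<in>I. {x \<in> topspace ?T. u i x \<in> cball (u i q) \<epsilon>}))"
      by (simp only: Inter_insert)
    also have "topspace ?T \<inter> (\<Inter>i\<in>I. {x \<in> topspace ?T. u i x \<in> cball (u i q) \<epsilon>}) =
        {x \<in> K. \<forall>i\<in>I. cmod (u i x - u i q) \<le> \<epsilon>}"
      by (auto simp: top dist_norm norm_minus_commute simp del: topspace_subtopology)
    finally show ?thesis .
  qed
  let ?U = "(\<lambda>q. {x \<in> K. \<forall>i\<in>I. cmod (u i x - u i q) < \<epsilon>}) ` K"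
  have "K \<subseteq> \<Union> ?U"
    using \<epsilon> by auto
  then obtain \<F> where \<F>: "finite \<F>" "\<F> \<subseteq> ?U" "K \<subseteq> \<Union> \<F>"
    using compactinD[OF comp[unfolded compact_space_def top], of ?U] op by auto
  then obtain Q where Q: "Q \<subseteq> K" "finite Q" "\<F> = (\<lambda>q. {x \<in> K. \<forall>i\<in>I. cmod (u i x - u i q) < \<epsilon>}) ` Q"
    by (meson finite_subset_image)
  show ?thesis
  proof (rule that[OF Q(2,1)])
    show "\<forall>x\<in>K. \<exists>q\<in>Q. \<forall>i\<in>I. cmod (u i x - u i q) \<le> \<epsilon>"
      using \<F>(3) Q(3) by (fastforce intro: less_imp_le)
    show "\<forall>q\<in>Q. compactin T {x \<in> K. \<forall>i\<in>I. cmod (u i x - u i q) \<le> \<epsilon>}"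
      using closedin_compact_space[OF comp cl] by (simp add: compactin_subtopology)
  qed
qed

lemma sheaf_iso_on_subset:
  assumes "sheaf_iso_on T V F G \<Phi>" and "W \<subseteq> V"
  shows "sheaf_iso_on T W F G \<Phi>"
  using assms(1) unfolding sheaf_iso_on_def
  by (elim conj_forward all_forward imp_forward) (use assms(2) in auto)

locale supermanifold =
  fixes M :: "('p, 's) supermanifold"
  assumes M: "complex_supermanifold M"
begin

abbreviation "F \<equiv> sheaf M"
abbreviation "n \<equiv> odim M"
abbreviation "sections U \<equiv> carrier (sec F U)"

lemma manifold: "complex_manifold M"
  and structure_sheaf: "superalgebra_sheaf (mtop M) F"
  using M by (auto simp: complex_supermanifold_def)

lemma presheaf: "superalgebra_presheaf (mtop M) F"
  using structure_sheaf by (simp add: superalgebra_sheaf_def)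

lemma superalgebra_sec: "openin (mtop M) U \<Longrightarrow> superalgebra (sec F U)"
  using presheaf by (simp add: superalgebra_presheaf_def)

lemma ring_sec: "openin (mtop M) U \<Longrightarrow> Ring.ring (sec F U)"
  using superalgebra_sec by (auto simp: superalgebra_def)

lemma part_subset:
  assumes "openin (mtop M) U"
  shows "part (sec F U) i \<subseteq> sections U"
proof (rule module.submoduleE(1))
  show "module (ring_of_type_algebra :: complex ring) (sec F U)"
    and "submodule (part (sec F U) i) (ring_of_type_algebra :: complex ring) (sec F U)"
    using superalgebra_sec[OF assms] by (simp_all add: superalgebra_def)
qed

lemma smult_sec: "openin (mtop M) U \<Longrightarrow> s \<in> sections U \<Longrightarrow> c \<odot>\<^bsub>sec F U\<^esub> s \<in> sections U"
  using superalgebra_sec[of U] module.smult_closed[of ring_of_type_algebra "sec F U" c s]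
  by (simp add: superalgebra_def ring_of_type_algebra_def)

lemma res_hom: "openin (mtop M) U \<Longrightarrow> openin (mtop M) V \<Longrightarrow> V \<subseteq> U \<Longrightarrow>
    res F U V \<in> superalgebra_hom (sec F U) (sec F V)"
  using presheaf by (simp add: superalgebra_presheaf_def)

lemma res_in: "openin (mtop M) U \<Longrightarrow> openin (mtop M) V \<Longrightarrow> V \<subseteq> U \<Longrightarrow> s \<in> sections U \<Longrightarrow>
    res F U V s \<in> sections V"
  using res_hom[of U V] by (auto simp: superalgebra_hom_def ring_hom_def)

lemma res_id: "openin (mtop M) U \<Longrightarrow> s \<in> sections U \<Longrightarrow> res F U U s = s"
  using presheaf by (simp add: superalgebra_presheaf_def)

lemma res_res: "openin (mtop M) U \<Longrightarrow> openin (mtop M) V \<Longrightarrow> openin (mtop M) W \<Longrightarrow> W \<subseteq> V \<Longrightarrow> V \<subseteq> U \<Longrightarrow>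
    s \<in> sections U \<Longrightarrow> res F V W (res F U V s) = res F U W s"
  using presheaf by (simp add: superalgebra_presheaf_def)

lemma sections_eq_on_cover:
  assumes \<U>: "\<And>U. U \<in> \<U> \<Longrightarrow> openin (mtop M) U" and s: "s \<in> sections (\<Union>\<U>)" "t \<in> sections (\<Union>\<U>)"
    and eq: "\<And>U. U \<in> \<U> \<Longrightarrow> res F (\<Union>\<U>) U s = res F (\<Union>\<U>) U t"
  shows "s = t"
proof -
  have op: "openin (mtop M) (\<Union>\<U>)"
    using \<U> by blast
  have 1: "\<forall>U\<in>\<U>. openin (mtop M) U \<and> res F (\<Union>\<U>) U t \<in> sections U"
    using \<U> s(2) op by (auto intro!: res_in)
  have 2: "\<forall>U\<in>\<U>. \<forall>V\<in>\<U>. res F U (U \<inter> V) (res F (\<Union>\<U>) U t) = res F V (U \<inter> V) (res F (\<Union>\<U>) V t)"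
  proof (intro ballI)
    fix U V
    assume "U \<in> \<U>" "V \<in> \<U>"
    then show "res F U (U \<inter> V) (res F (\<Union>\<U>) U t) = res F V (U \<inter> V) (res F (\<Union>\<U>) V t)"
      using res_res[OF op \<U> openin_Int[OF \<U> \<U>] _ _ s(2), of U U V]
        res_res[OF op \<U> openin_Int[OF \<U> \<U>] _ _ s(2), of V U V] Union_upper[of U \<U>] Union_upper[of V \<U>]
      by auto
  qed
  have "\<exists>!t'. t' \<in> sections (\<Union>\<U>) \<and> (\<forall>U\<in>\<U>. res F (\<Union>\<U>) U t' = res F (\<Union>\<U>) U t)"
    using structure_sheaf 1 2 unfolding superalgebra_sheaf_def
    by (elim conjE allE[of _ \<U>] allE[of _ "\<lambda>U. res F (\<Union>\<U>) U t"]) blast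
  then show ?thesis
    using s eq by blast
qed

lemma preimage_identity:
  assumes "openin (mtop M) U" and "\<And>x. x \<in> topspace (mtop M) \<Longrightarrow> h x = x"
  shows "preimage M h U = U"
  using openin_subset[OF assms(1)] assms(2) by (force simp: preimage_def)

lemma fst_one: "fst \<one>\<^bsub>End_monoid M\<^esub> = (\<lambda>x\<in>topspace (mtop M). x)"
  and snd_one: "snd \<one>\<^bsub>End_monoid M\<^esub> = (\<lambda>U\<in>{U. openin (mtop M) U}. \<lambda>s\<in>sections U. s)"
  by (simp_all add: End_monoid_def)

lemma one_endomorphism: "\<one>\<^bsub>End_monoid M\<^esub> \<in> endomorphisms M"
proof -
  let ?h = "\<lambda>x\<in>topspace (mtop M). x" and ?r = "\<lambda>U\<in>{U. openin (mtop M) U}. \<lambda>s\<in>sections U. s"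
  have pre: "preimage M ?h U = U" if "openin (mtop M) U" for U
    using that by (rule preimage_identity) simp
  have "holomorphic_map M ?h"
    unfolding holomorphic_map_def
  proof (intro conjI ballI, goal_cases)
    case 1
    show ?case
      by (rule continuous_map_eq[OF continuous_map_id]) simp
  next
    case (2 c)
    obtain U \<psi> where c: "c = (U, \<psi>)"
      by fastforce
    interpret manifold_chart M U \<psi>
      using manifold 2 c by unfold_locales auto
    have sub: "?h -` U \<inter> topspace (mtop M) \<subseteq> U"
      by auto
    have "holomorphic_fun M (?h -` U \<inter> topspace (mtop M)) (\<lambda>x. \<psi> (?h x) i)" if "i < mdim M" for i
      by (rule holomorphic_fun_cong[OF manifold holomorphic_coordinate[OF that sub]]) simp
    then show ?case
      by (simp add: c)
  qed
  moreover have "?r U \<in> superalgebra_hom (sec F U) (sec F U)" if U: "openin (mtop M) U" for U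
  proof -
    interpret ring "sec F U"
      by (rule ring_sec[OF U])
    show ?thesis
      using U part_subset[OF U] smult_sec[OF U] by (auto simp: superalgebra_hom_def ring_hom_def)
  qed
  ultimately show ?thesis
    unfolding endomorphisms_def by (auto simp: End_monoid_def pre res_in)
qed

lemma one_compose: "compose_morphisms M \<one>\<^bsub>End_monoid M\<^esub> \<one>\<^bsub>End_monoid M\<^esub> = \<one>\<^bsub>End_monoid M\<^esub>"
proof -
  have pre: "preimage M (\<lambda>x\<in>topspace (mtop M). x) U = U" if "openin (mtop M) U" for U
    using that by (rule preimage_identity) simp
  show ?thesis
    by (simp add: compose_morphisms_def fst_one snd_one)
       (auto simp: End_monoid_def compose_def fun_eq_iff pre)
qed

lemma carrier_Aut_subset: "carrier (Aut_group M) \<subseteq> endomorphisms M"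
  by (auto simp: Aut_group_def units_of_def Units_def End_monoid_def)

lemma mult_Aut: "\<phi> \<otimes>\<^bsub>Aut_group M\<^esub> \<psi> = compose_morphisms M \<phi> \<psi>"
  by (simp add: Aut_group_def units_of_def End_monoid_def)

lemma one_Aut: "\<one>\<^bsub>Aut_group M\<^esub> = \<one>\<^bsub>End_monoid M\<^esub>"
  by (simp add: Aut_group_def units_of_def)

lemma one_in_Aut: "\<one>\<^bsub>End_monoid M\<^esub> \<in> carrier (Aut_group M)"
proof -
  have "\<one>\<^bsub>End_monoid M\<^esub> \<otimes>\<^bsub>End_monoid M\<^esub> \<one>\<^bsub>End_monoid M\<^esub> = \<one>\<^bsub>End_monoid M\<^esub>"
    using one_compose by (simp add: End_monoid_def)
  moreover have "\<one>\<^bsub>End_monoid M\<^esub> \<in> carrier (End_monoid M)"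
    using one_endomorphism by (simp add: End_monoid_def)
  ultimately show ?thesis
    unfolding Aut_group_def units_of_def Units_def by auto
qed

definition near_identity :: "('p, 's) morphism set \<Rightarrow> bool" where
  "near_identity N \<longleftrightarrow> (\<exists>V. openin (Aut_topology M) V \<and> \<one>\<^bsub>End_monoid M\<^esub> \<in> V \<and> V \<subseteq> N)"

lemma near_identity_mono: "near_identity N \<Longrightarrow> N \<subseteq> N' \<Longrightarrow> near_identity N'"
  unfolding near_identity_def by blast

lemma near_identity_Int: "near_identity N \<Longrightarrow> near_identity N' \<Longrightarrow> near_identity (N \<inter> N')"
  unfolding near_identity_def by (metis Int_iff Int_mono openin_Int)

lemma near_identity_carrier: "near_identity (carrier (Aut_group M))"
  unfolding near_identity_def Aut_topology_def using one_in_Aut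
  by (intro exI[of _ "carrier (Aut_group M)"]) (auto intro: topology_generated_by_Basis)

lemma near_identity_INT:
  assumes "finite I" and "\<And>i. i \<in> I \<Longrightarrow> near_identity (N i)"
  shows "near_identity (carrier (Aut_group M) \<inter> (\<Inter>i\<in>I. N i))"
  using assms
proof (induction I rule: finite_induct)
  case empty
  then show ?case
    by (simp add: near_identity_carrier)
next
  case (insert i I)
  then have "near_identity (N i \<inter> (carrier (Aut_group M) \<inter> (\<Inter>i\<in>I. N i)))"
    by (intro near_identity_Int[of "N i"]) blast+
  then show ?case
    by (rule near_identity_mono) auto
qed

lemma near_identity_subbasic:
  assumes W: "coordinate_domain M W \<Phi>" and K: "compactin (mtop M) K" "K \<subseteq> W" "K \<subseteq> U"
    and U: "openin (mtop M) U" and f: "f \<in> sections U"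
    and \<Omega>: "\<And>\<nu>. \<nu> \<subseteq> {..<n} \<Longrightarrow> open (\<Omega> \<nu>)"
    and in_\<Omega>: "\<And>\<nu>. \<nu> \<subseteq> {..<n} \<Longrightarrow> \<Phi> (U \<inter> W) (res F U (U \<inter> W) f) \<nu> ` K \<subseteq> \<Omega> \<nu>"
  shows "near_identity (Aut_subbasic M K W \<Phi> U f \<Omega>)"
  unfolding near_identity_def
proof (intro exI conjI)
  show "openin (Aut_topology M) (Aut_subbasic M K W \<Phi> U f \<Omega>)"
    unfolding Aut_topology_def Aut_subbase_def
    by (intro topology_generated_by_Basis insertI2 CollectI exI[of _ K] exI[of _ W] exI[of _ \<Phi>]
        exI[of _ U] exI[of _ f] exI[of _ \<Omega>] conjI allI impI refl W K U f \<Omega>)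
  have pre: "preimage M (\<lambda>x\<in>topspace (mtop M). x) U = U"
    using U by (rule preimage_identity) simp
  show "\<one>\<^bsub>End_monoid M\<^esub> \<in> Aut_subbasic M K W \<Phi> U f \<Omega>"
    unfolding Aut_subbasic_def using one_in_Aut K f U in_\<Omega> compactin_subset_topspace[OF K(1)]
    by (auto simp: fst_one snd_one pre Let_def)
qed auto

lemma coordinate_domainD:
  assumes "coordinate_domain M W \<Phi>"
  shows "openin (mtop M) W" and "sheaf_iso_on (mtop M) W F (model_sheaf M n) \<Phi>"
  using assms by (auto simp: coordinate_domain_def holomorphic_chart_def topological_chart_def)

lemma coordinate_domain_exists:
  assumes p: "p \<in> topspace (mtop M)"
  obtains U \<psi> W \<Phi> where "(U, \<psi>) \<in> atlas M" "W \<subseteq> U" "p \<in> W" "coordinate_domain M W \<Phi>"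
proof -
  have "p \<in> \<Union> (fst ` atlas M)"
    using manifold p by (auto simp: complex_manifold_def)
  then obtain U \<psi> where U: "(U, \<psi>) \<in> atlas M" "p \<in> U"
    by auto
  interpret manifold_chart M U \<psi>
    using manifold U by unfold_locales
  obtain V \<Phi> where V: "openin (mtop M) V" "p \<in> V" "sheaf_iso_on (mtop M) V F (model_sheaf M n) \<Phi>"
    using M p unfolding complex_supermanifold_def by blast
  define W where "W = U \<inter> V"
  have W: "openin (mtop M) W" "W \<subseteq> U"
    using V(1) open_domain by (auto simp: W_def)
  have inj_W: "inj_on \<psi> W"
    using inj W(2) by (rule inj_on_subset)
  have "topological_chart M (W, \<psi>)"
  proof -
    have "homeomorphic_map (subtopology (subtopology (mtop M) U) W)
        (subtopology (subtopology (Complex_space m) (\<psi> ` U)) (\<psi> ` W)) \<psi>"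
    proof (rule homeomorphic_map_subtopologies[OF homeo])
      have "topspace (subtopology (mtop M) U) \<inter> W = W"
        using W(2) domain_subset by auto
      moreover have "topspace (subtopology (Complex_space m) (\<psi> ` U)) \<inter> \<psi> ` W = \<psi> ` W"
        using W(2) openin_subset[OF open_image] by auto
      ultimately show "\<psi> ` (topspace (subtopology (mtop M) U) \<inter> W) =
          topspace (subtopology (Complex_space m) (\<psi> ` U)) \<inter> \<psi> ` W"
        by simp
    qed
    moreover have "U \<inter> W = W" "\<psi> ` U \<inter> \<psi> ` W = \<psi> ` W"
      using W(2) by auto
    ultimately show ?thesis
      using W open_image_of[OF W] by (simp add: topological_chart_def subtopology_subtopology)
  qed
  moreover have "holomorphic_transition m (W, \<psi>) c' \<and> holomorphic_transition m c' (W, \<psi>)" if "c' \<in> atlas M" for c'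
  proof -
    obtain U' \<psi>' where c': "c' = (U', \<psi>')"
      by fastforce
    interpret c': manifold_chart M U' \<psi>'
      using manifold that c' by unfold_locales auto
    have "holomorphic_Cn m (\<psi> ` (W \<inter> U')) (\<lambda>z. \<psi>' (inv_into W \<psi> z) i)" if i: "i < m" for i
    proof (rule holomorphic_Cn_cong[THEN iffD1])
      show "holomorphic_Cn m (\<psi> ` (W \<inter> U')) (\<lambda>z. \<psi>' (inv_into U \<psi> z) i)"
        using W(2) by (intro holomorphic_Cn_subset[OF c'.transition[OF U(1) i]]) auto
      show "\<psi>' (inv_into U \<psi> z) i = \<psi>' (inv_into W \<psi> z) i" if "z \<in> \<psi> ` (W \<inter> U')" for z
        using that W(2) inv_chart inj_W by (auto simp: subset_iff)
    qed
    moreover have "holomorphic_Cn m (\<psi>' ` (U' \<inter> W)) (\<lambda>z. \<psi> (inv_into U' \<psi>' z) i)" if i: "i < m" for i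
      using W(2) c' \<open>c' \<in> atlas M\<close> by (intro holomorphic_Cn_subset[OF transition[OF _ i]]) auto
    ultimately show ?thesis
      by (simp add: c' holomorphic_transition_def)
  qed
  ultimately have "holomorphic_chart M (W, \<psi>)"
    by (simp add: holomorphic_chart_def)
  moreover have "sheaf_iso_on (mtop M) W F (model_sheaf M n) \<Phi>"
    by (rule sheaf_iso_on_subset[OF V(3)]) (simp add: W_def)
  ultimately have "coordinate_domain M W \<Phi>"
    by (auto simp: coordinate_domain_def)
  then show ?thesis
    using that[OF U(1) W(2)] U(2) V(2) by (simp add: W_def)
qed

end

section \<open>Triviality of the underlying maps\<close>

context manifold_chart
begin

text \<open>
With \<open>g = h - id\<close> in the chart, \<open>h\<^sup>2 - id = 2 g + (g \<circ> h - g)\<close>. The last difference is controlled by the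
Schwarz lemma on the complex line through \<open>x\<close> and \<open>h x\<close>, along which \<open>g\<close> is defined on a disc of radius
\<open>r / D\<close>. The bound \<open>r / (4 (m + 1))\<close> makes the sum of the \<open>m\<close> errors at most \<open>D / 2\<close>.
\<close>

lemma displacement_expands:
  assumes h: "holomorphic_map M h" and r: "r > 0" and c: "\<And>i. i \<ge> m \<Longrightarrow> c i = 0"
    and sub: "polydisc m c (2 * r) \<subseteq> \<psi> ` U"
    and close: "\<And>x. x \<in> U \<Longrightarrow> \<psi> x \<in> polydisc m c (2 * r) \<Longrightarrow>
      h x \<in> U \<and> (\<forall>i<m. cmod (\<psi> (h x) i - \<psi> x i) < r / (4 * (real m + 1)))"
    and x: "x \<in> U" "\<psi> x \<in> polydisc m c r"
  shows "3 / 2 * (\<Sum>i<m. cmod (\<psi> (h x) i - \<psi> x i)) \<le> (\<Sum>i<m. cmod (\<psi> (h (h x)) i - \<psi> x i))"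
proof -
  define \<epsilon> where "\<epsilon> = r / (4 * (real m + 1))"
  define P where "P = {x \<in> U. \<psi> x \<in> polydisc m c (2 * r)}"
  define g where "g = (\<lambda>i z. \<psi> (h (inv_into U \<psi> z)) i - z i)"
  have P_image: "\<psi> ` P = polydisc m c (2 * r)"
    using sub by (auto simp: P_def)
  have PU: "P \<subseteq> U"
    by (auto simp: P_def)
  have P_pre: "P \<subseteq> h -` U \<inter> topspace (mtop M)"
    using close domain_subset by (auto simp: P_def)
  have hol_g: "holomorphic_Cn m (polydisc m c (2 * r)) (g i)" if i: "i < m" for i
  proof -
    have "holomorphic_fun M (h -` U \<inter> topspace (mtop M)) (\<lambda>x. \<psi> (h x) i)"
      using h chart i unfolding holomorphic_map_def by fast
    from holomorphic_fun_in_chart[OF holomorphic_fun_subset[OF this P_pre] PU]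
    show ?thesis
      unfolding g_def P_image by (intro holomorphic_Cn_diff holomorphic_Cn_coordinate i)
  qed
  have g_at: "g i (\<psi> y) = \<psi> (h y) i - \<psi> y i" if "y \<in> U" for i y
    using inv_chart[OF that] by (simp add: g_def)
  have g_small: "cmod (g i z) < \<epsilon>" if z: "z \<in> polydisc m c (2 * r)" and i: "i < m" for i z
  proof -
    obtain y where y: "y \<in> U" "z = \<psi> y"
      using z sub by auto
    then show ?thesis
      using close[of y] z i g_at[OF y(1)] by (simp add: \<epsilon>_def)
  qed
  have x2: "\<psi> x \<in> polydisc m c (2 * r)"
    using x(2) polydisc_mono[of r "2 * r" m c] r by auto
  have hx: "h x \<in> U" "\<And>i. i < m \<Longrightarrow> cmod (\<psi> (h x) i - \<psi> x i) < \<epsilon>"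
    using close[OF x(1) x2] by (auto simp: \<epsilon>_def)
  define v where "v = (\<lambda>i. \<psi> (h x) i - \<psi> x i)"
  define D where "D = (\<Sum>i<m. cmod (v i))"
  have D0: "D \<ge> 0"
    unfolding D_def by (intro sum_nonneg) auto
  have v_le: "cmod (v i) \<le> D" if "i < m" for i
    unfolding D_def using that by (intro member_le_sum) auto
  have v0: "v i = 0" if "i \<ge> m" for i
    using chart_zero[OF x(1) that] chart_zero[OF hx(1) that] by (simp add: v_def)
  have g_diff: "cmod (g i (\<psi> (h x)) - g i (\<psi> x)) \<le> 2 * \<epsilon> * D / r" if i: "i < m" for i
  proof (cases "D = 0")
    case True
    then have "v j = 0" for j
      using v_le[of j] v0[of j] by (cases "j < m") auto
    then have "\<psi> (h x) = \<psi> x"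
      by (auto simp: v_def)
    then show ?thesis
      using True by simp
  next
    case False
    \<comment> \<open>The line leaves the polydisc of radius \<open>2 r\<close> not before time \<open>r / D\<close>, as each coordinate moves with speed at most \<open>D\<close>.\<close>
    define R where "R = r / D"
    have R0: "R > 0"
      using False D0 r by (simp add: R_def)
    have line: "(\<lambda>j. \<psi> x j + t * v j) \<in> polydisc m c (2 * r)" if "t \<in> ball 0 R" for t
    proof (rule line_in_polydisc[OF x2 v0 _ that])
      fix j
      assume j: "j < m"
      have "R * cmod (v j) \<le> r"
        using v_le[OF j] False D0 r by (simp add: R_def field_simps)
      moreover have "cmod (\<psi> x j - c j) < r"
        using x(2) j by (simp add: polydisc_def)
      ultimately show "cmod (\<psi> x j - c j) + R * cmod (v j) \<le> 2 * r"
        by simp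
    qed
    have "D \<le> (\<Sum>i<m. \<epsilon>)"
      unfolding D_def using hx(2) by (intro sum_mono) (auto simp: v_def intro: less_imp_le)
    also have "\<dots> < r"
      using r by (simp add: \<epsilon>_def divide_less_eq)
    finally have "(1::complex) \<in> ball 0 R"
      using False D0 by (simp add: R_def)
    then have "cmod (g i (\<lambda>j. \<psi> x j + 1 * v j) - g i (\<lambda>j. \<psi> x j + 0 * v j)) \<le> 2 * \<epsilon> / R * cmod 1"
      by (intro schwarz_disc(1)[where \<gamma> = "\<lambda>t. g i (\<lambda>j. \<psi> x j + t * v j)"]
          holomorphic_Cn_line[OF hol_g[OF i]] line g_small i R0)
    then show ?thesis
      by (simp add: R_def v_def)
  qed
  have "2 * cmod (v i) - 2 * \<epsilon> * D / r \<le> cmod (\<psi> (h (h x)) i - \<psi> x i)" if i: "i < m" for i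
  proof -
    have "\<psi> (h (h x)) i - \<psi> x i = 2 * v i + (g i (\<psi> (h x)) - g i (\<psi> x))"
      by (simp add: g_at[OF hx(1)] g_at[OF x(1)] v_def)
    then have "cmod (2 * v i) \<le> cmod (\<psi> (h (h x)) i - \<psi> x i) + cmod (g i (\<psi> (h x)) - g i (\<psi> x))"
      using norm_triangle_ineq4[of "\<psi> (h (h x)) i - \<psi> x i" "g i (\<psi> (h x)) - g i (\<psi> x)"] by simp
    then show ?thesis
      using g_diff[OF i] by (simp add: norm_mult)
  qed
  then have "(\<Sum>i<m. 2 * cmod (v i) - 2 * \<epsilon> * D / r) \<le> (\<Sum>i<m. cmod (\<psi> (h (h x)) i - \<psi> x i))"
    by (intro sum_mono) auto
  moreover have "(\<Sum>i<m. 2 * cmod (v i) - 2 * \<epsilon> * D / r) = 2 * D - (2 * real m * \<epsilon> / r) * D"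
    by (simp add: sum_subtractf D_def flip: sum_distrib_left)
  moreover have "(2 * real m * \<epsilon> / r) * D \<le> 1 / 2 * D"
    using r D0 by (intro mult_right_mono) (auto simp: \<epsilon>_def divide_simps)
  ultimately show ?thesis
    by (simp add: D_def v_def)
qed

end

context supermanifold
begin

text \<open>
Here the subbasic sets are to confine the underlying map alone, so they are taken with the zero section and
unrestricted coefficients.
\<close>

lemma near_identity_displacement:
  assumes chart: "(U, \<psi>) \<in> atlas M" and WU: "W \<subseteq> U" and W: "coordinate_domain M W \<Phi>"
    and K: "compactin (mtop M) K" "K \<subseteq> W" and \<epsilon>: "\<epsilon> > 0"
  shows "near_identity {\<phi> \<in> carrier (Aut_group M).
    \<forall>x\<in>K. fst \<phi> x \<in> W \<and> (\<forall>i<mdim M. cmod (\<psi> (fst \<phi> x) i - \<psi> x i) < \<epsilon>)}"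
proof -
  interpret c: manifold_chart M U \<psi>
    using manifold chart by unfold_locales
  have cont: "continuous_map (subtopology (mtop M) K) euclidean (\<lambda>x. \<psi> x i)" for i
    by (rule continuous_map_from_subtopology_mono[OF c.continuous_coordinate]) (use K WU in auto)
  obtain Q where Q: "finite Q" "Q \<subseteq> K" "\<forall>x\<in>K. \<exists>q\<in>Q. \<forall>i\<in>{..<mdim M}. cmod (\<psi> x i - \<psi> q i) \<le> \<epsilon> / 4"
    "\<forall>q\<in>Q. compactin (mtop M) {x \<in> K. \<forall>i\<in>{..<mdim M}. cmod (\<psi> x i - \<psi> q i) \<le> \<epsilon> / 4}"
    using fine_compact_cover[OF K(1), of "{..<mdim M}" "\<lambda>i x. \<psi> x i" "\<epsilon> / 4"] cont \<epsilon> by auto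
  define C where "C = (\<lambda>q. {x \<in> K. \<forall>i\<in>{..<mdim M}. cmod (\<psi> x i - \<psi> q i) \<le> \<epsilon> / 4})"
  define O' where "O' = (\<lambda>q. W \<inter> {x \<in> U. \<psi> x \<in> polydisc (mdim M) (\<psi> q) (\<epsilon> / 2)})"
  define N where "N = (\<lambda>q. Aut_subbasic M (C q) W \<Phi> (O' q) \<zero>\<^bsub>sec F (O' q)\<^esub> (\<lambda>\<nu>. UNIV))"
  have O'_open: "openin (mtop M) (O' q)" for q
    unfolding O'_def by (intro openin_Int coordinate_domainD(1)[OF W] c.open_preimage openin_polydisc)
  have "near_identity (N q)" if q: "q \<in> Q" for q
    unfolding N_def
  proof (rule near_identity_subbasic[OF W])
    show "compactin (mtop M) (C q)"
      using Q(4) q by (simp add: C_def)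
    show "C q \<subseteq> W"
      using K by (auto simp: C_def)
    show "C q \<subseteq> O' q"
      using K WU \<epsilon> c.chart_zero by (force simp: C_def O'_def polydisc_def)
    show "\<zero>\<^bsub>sec F (O' q)\<^esub> \<in> sections (O' q)"
      using ring.ring_simprules(2)[OF ring_sec[OF O'_open]] .
  qed (use O'_open in auto)
  then have "near_identity (carrier (Aut_group M) \<inter> (\<Inter>q\<in>Q. N q))"
    by (intro near_identity_INT Q(1))
  then show ?thesis
  proof (rule near_identity_mono, intro subsetI CollectI conjI ballI)
    fix \<phi>
    assume \<phi>: "\<phi> \<in> carrier (Aut_group M) \<inter> (\<Inter>q\<in>Q. N q)"
    then show "\<phi> \<in> carrier (Aut_group M)"
      by blast
    fix x
    assume x: "x \<in> K"
    then obtain q where q: "q \<in> Q" "x \<in> C q"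
      using Q(3) by (auto simp: C_def)
    then have "fst \<phi> x \<in> O' q"
      using \<phi> by (auto simp: N_def Aut_subbasic_def)
    then show "fst \<phi> x \<in> W"
      by (simp add: O'_def)
    show "\<forall>i<mdim M. cmod (\<psi> (fst \<phi> x) i - \<psi> x i) < \<epsilon>"
    proof (intro allI impI)
      fix i
      assume i: "i < mdim M"
      have "cmod (\<psi> (fst \<phi> x) i - \<psi> q i) < \<epsilon> / 2"
        using \<open>fst \<phi> x \<in> O' q\<close> i by (simp add: O'_def polydisc_def)
      moreover have "cmod (\<psi> x i - \<psi> q i) \<le> \<epsilon> / 4"
        using q(2) i by (simp add: C_def)
      ultimately show "cmod (\<psi> (fst \<phi> x) i - \<psi> x i) < \<epsilon>"
        using norm_triangle_ineq4[of "\<psi> (fst \<phi> x) i - \<psi> q i" "\<psi> x i - \<psi> q i"] \<epsilon> by simp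
    qed
  qed
qed

lemma near_identity_coefficients:
  assumes W: "coordinate_domain M W \<Phi>" and K: "compactin (mtop M) K" "K \<subseteq> W"
    and f: "f \<in> sections W" and \<epsilon>: "\<epsilon> > 0"
    and cont: "\<And>\<nu>. \<nu> \<subseteq> {..<n} \<Longrightarrow> continuous_map (subtopology (mtop M) W) euclidean (\<Phi> W f \<nu>)"
  shows "near_identity {\<phi> \<in> carrier (Aut_group M). \<forall>x\<in>K. \<forall>\<nu>. \<nu> \<subseteq> {..<n} \<longrightarrow>
    cmod (\<Phi> (preimage M (fst \<phi>) W \<inter> W) (res F (preimage M (fst \<phi>) W) (preimage M (fst \<phi>) W \<inter> W)
      (snd \<phi> W f)) \<nu> x - \<Phi> W f \<nu> x) < \<epsilon>}"
proof -
  have W_open: "openin (mtop M) W"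
    by (rule coordinate_domainD(1)[OF W])
  have cont_K: "continuous_map (subtopology (mtop M) K) euclidean (\<Phi> W f \<nu>)" if "\<nu> \<in> Pow {..<n}" for \<nu>
    by (rule continuous_map_from_subtopology_mono[OF cont]) (use K that in auto)
  obtain Q where Q: "finite Q" "Q \<subseteq> K"
    "\<forall>x\<in>K. \<exists>q\<in>Q. \<forall>\<nu>\<in>Pow {..<n}. cmod (\<Phi> W f \<nu> x - \<Phi> W f \<nu> q) \<le> \<epsilon> / 4"
    "\<forall>q\<in>Q. compactin (mtop M) {x \<in> K. \<forall>\<nu>\<in>Pow {..<n}. cmod (\<Phi> W f \<nu> x - \<Phi> W f \<nu> q) \<le> \<epsilon> / 4}"
    using fine_compact_cover[OF K(1), of "Pow {..<n}" "\<Phi> W f" "\<epsilon> / 4"] cont_K \<epsilon> by auto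
  define C where "C = (\<lambda>q. {x \<in> K. \<forall>\<nu>\<in>Pow {..<n}. cmod (\<Phi> W f \<nu> x - \<Phi> W f \<nu> q) \<le> \<epsilon> / 4})"
  define N where "N = (\<lambda>q. Aut_subbasic M (C q) W \<Phi> W f (\<lambda>\<nu>. ball (\<Phi> W f \<nu> q) (\<epsilon> / 2)))"
  have "near_identity (N q)" if q: "q \<in> Q" for q
    unfolding N_def
  proof (rule near_identity_subbasic[OF W])
    show "compactin (mtop M) (C q)"
      using Q(4) q by (simp add: C_def)
    show "C q \<subseteq> W" "C q \<subseteq> W"
      using K by (auto simp: C_def)
    show "\<Phi> (W \<inter> W) (res F W (W \<inter> W) f) \<nu> ` C q \<subseteq> ball (\<Phi> W f \<nu> q) (\<epsilon> / 2)" if "\<nu> \<subseteq> {..<n}" for \<nu>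
    proof -
      have "cmod (\<Phi> W f \<nu> x - \<Phi> W f \<nu> q) < \<epsilon> / 2" if "x \<in> C q" for x
      proof -
        have "cmod (\<Phi> W f \<nu> x - \<Phi> W f \<nu> q) \<le> \<epsilon> / 4"
          using that \<open>\<nu> \<subseteq> {..<n}\<close> by (simp add: C_def)
        with \<epsilon> show ?thesis
          by linarith
      qed
      then show ?thesis
        unfolding Int_absorb res_id[OF W_open f] by (auto simp: dist_norm norm_minus_commute)
    qed
  qed (use W_open f in auto)
  then have "near_identity (carrier (Aut_group M) \<inter> (\<Inter>q\<in>Q. N q))"
    by (intro near_identity_INT Q(1))
  then show ?thesis
  proof (rule near_identity_mono, intro subsetI CollectI conjI ballI allI impI)
    fix \<phi>
    assume \<phi>: "\<phi> \<in> carrier (Aut_group M) \<inter> (\<Inter>q\<in>Q. N q)"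
    then show "\<phi> \<in> carrier (Aut_group M)"
      by blast
    fix x \<nu>
    assume x: "x \<in> K" and \<nu>: "\<nu> \<subseteq> {..<n}"
    then obtain q where q: "q \<in> Q" "x \<in> C q"
      using Q(3) by (auto simp: C_def)
    let ?y = "\<Phi> (preimage M (fst \<phi>) W \<inter> W) (res F (preimage M (fst \<phi>) W) (preimage M (fst \<phi>) W \<inter> W)
      (snd \<phi> W f)) \<nu> x"
    have "?y \<in> ball (\<Phi> W f \<nu> q) (\<epsilon> / 2)"
      using \<phi> q \<nu> unfolding N_def Aut_subbasic_def Let_def by blast
    moreover have "cmod (\<Phi> W f \<nu> x - \<Phi> W f \<nu> q) \<le> \<epsilon> / 4"
      using q(2) \<nu> by (simp add: C_def)
    ultimately show "cmod (?y - \<Phi> W f \<nu> x) < \<epsilon>"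
      using norm_triangle_ineq4[of "?y - \<Phi> W f \<nu> q" "\<Phi> W f \<nu> x - \<Phi> W f \<nu> q"] \<epsilon>
      by (simp add: dist_norm norm_minus_commute)
  qed
qed

lemma automorphismD:
  assumes "\<phi> \<in> carrier (Aut_group M)"
  shows "fst \<phi> \<in> extensional (topspace (mtop M))" and "holomorphic_map M (fst \<phi>)"
    and "snd \<phi> \<in> extensional {U. openin (mtop M) U}"
    and "\<And>U. openin (mtop M) U \<Longrightarrow> snd \<phi> U \<in> extensional (sections U)"
    and "\<And>U. openin (mtop M) U \<Longrightarrow>
      snd \<phi> U \<in> superalgebra_hom (sec F U) (sec F (preimage M (fst \<phi>) U))"
    and "\<And>U V s. openin (mtop M) U \<Longrightarrow> openin (mtop M) V \<Longrightarrow> V \<subseteq> U \<Longrightarrow> s \<in> sections U \<Longrightarrow>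
      snd \<phi> V (res F U V s) = res F (preimage M (fst \<phi>) U) (preimage M (fst \<phi>) V) (snd \<phi> U s)"
  using subsetD[OF carrier_Aut_subset assms] by (auto simp: endomorphisms_def)

lemma square_of_member:
  assumes H: "subgroup H (Aut_group M)" and \<phi>: "\<phi> \<in> H"
  shows "compose_morphisms M \<phi> \<phi> \<in> H"
    and "x \<in> topspace (mtop M) \<Longrightarrow> fst (compose_morphisms M \<phi> \<phi>) x = fst \<phi> (fst \<phi> x)"
  using subgroup.m_closed[OF H \<phi> \<phi>] by (simp_all add: mult_Aut) (simp add: compose_morphisms_def compose_def)

lemma underlying_map_trivial:
  assumes H: "subgroup H (Aut_group M)" and chart: "(U, \<psi>) \<in> atlas M" and r: "r > 0"
    and c: "\<And>i. i \<ge> mdim M \<Longrightarrow> c i = 0"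
    and sub: "polydisc (mdim M) c (2 * r) \<subseteq> \<psi> ` U"
    and close: "\<And>\<phi> x. \<phi> \<in> H \<Longrightarrow> x \<in> U \<Longrightarrow> \<psi> x \<in> polydisc (mdim M) c (2 * r) \<Longrightarrow>
      fst \<phi> x \<in> U \<and> (\<forall>i<mdim M. cmod (\<psi> (fst \<phi> x) i - \<psi> x i) < r / (4 * (real (mdim M) + 1)))"
    and x: "x \<in> U" "\<psi> x \<in> polydisc (mdim M) c r" and \<phi>: "\<phi> \<in> H"
  shows "fst \<phi> x = x"
proof -
  interpret c: manifold_chart M U \<psi>
    using manifold chart by unfold_locales
  have x_top: "x \<in> topspace (mtop M)"
    using x(1) c.domain_subset by blast
  have x2: "\<psi> x \<in> polydisc (mdim M) c (2 * r)"
    using x(2) polydisc_mono[of r "2 * r" "mdim M" c] r by auto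
  let ?d = "\<lambda>\<phi>. \<Sum>i<mdim M. cmod (\<psi> (fst \<phi> x) i - \<psi> x i)"
  have "?d \<phi> \<le> 0"
  proof (rule no_bounded_expansion[where H = H and sq = "\<lambda>\<phi>. compose_morphisms M \<phi> \<phi>"])
    show "compose_morphisms M \<phi> \<phi> \<in> H" if "\<phi> \<in> H" for \<phi>
      by (rule square_of_member(1)[OF H that])
    show "?d \<phi> \<le> (\<Sum>i<mdim M. r / (4 * (real (mdim M) + 1)))" if "\<phi> \<in> H" for \<phi>
      using close[OF that x(1) x2] by (intro sum_mono) (auto intro: less_imp_le)
    show "3 / 2 * ?d \<phi> \<le> ?d (compose_morphisms M \<phi> \<phi>)" if "\<phi> \<in> H" for \<phi>
      unfolding square_of_member(2)[OF H that x_top]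
      using subgroup.mem_carrier[OF H that]
      by (intro c.displacement_expands[OF automorphismD(2) r c sub close[OF that] x]) auto
  qed (fact \<phi>)
  then have "?d \<phi> = 0"
    by (intro antisym sum_nonneg) auto
  then have "\<forall>i\<in>{..<mdim M}. cmod (\<psi> (fst \<phi> x) i - \<psi> x i) = 0"
    by (subst (asm) sum_nonneg_eq_0_iff) auto
  moreover have \<phi>x: "fst \<phi> x \<in> U"
    using close[OF \<phi> x(1) x2] by blast
  ultimately have "\<psi> (fst \<phi> x) = \<psi> x"
    using c.chart_zero[OF x(1)] c.chart_zero[OF \<phi>x]
    by (intro ext) (metis lessThan_iff linorder_not_less norm_eq_zero right_minus_eq)
  then show ?thesis
    using c.inj \<phi>x x(1) by (auto dest: inj_onD)
qed

end

section \<open>Rigidity of small subgroups\<close>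

lemma model_endomorphism_subset:
  assumes "model_endomorphism M n W \<sigma>" and "openin (mtop M) V" and VW: "V \<subseteq> W"
  shows "model_endomorphism M n V \<sigma>"
proof -
  interpret model_endomorphism M n W \<sigma>
    by fact
  have sub: "U \<subseteq> W" if "U \<subseteq> V" for U
    using that VW by blast
  show ?thesis
    by unfold_locales
      (simp_all add: manifold assms(2) closed[OF _ sub] hom[OF _ sub] scalar[OF _ sub] restrict[OF _ _ _ sub])
qed

context supermanifold
begin

lemma model_pullback:
  assumes iso: "sheaf_iso_on (mtop M) W F (model_sheaf M n) \<Phi>" and W: "openin (mtop M) W"
    and \<phi>: "\<phi> \<in> carrier (Aut_group M)" and id: "\<forall>x\<in>topspace (mtop M). fst \<phi> x = x"
  shows "model_endomorphism M n W (\<lambda>U f. \<Phi> U (snd \<phi> U (inv_into (sections U) (\<Phi> U) f)))"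
proof -
  have pre: "preimage M (fst \<phi>) U = U" if "openin (mtop M) U" for U
    using that id by (intro preimage_identity) auto
  define g where "g = (\<lambda>U. inv_into (sections U) (\<Phi> U))"
  have \<Phi>_hom: "\<Phi> U \<in> superalgebra_hom (sec F U) (model_superalgebra M n U)"
    and \<Phi>_bij: "bij_betw (\<Phi> U) (sections U) (model_sections M n U)"
    if "openin (mtop M) U" "U \<subseteq> W" for U
    using iso that unfolding sheaf_iso_on_def by (auto simp: model_sheaf_simps model_superalgebra_simps)
  have \<Phi>_res: "\<Phi> V (res F U V s) = res (model_sheaf M n) U V (\<Phi> U s)"
    if "openin (mtop M) U" "openin (mtop M) V" "V \<subseteq> U" "U \<subseteq> W" "s \<in> sections U" for U V s
    using iso that by (simp add: sheaf_iso_on_def)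
  have r_hom: "snd \<phi> U \<in> superalgebra_hom (sec F U) (sec F U)" if "openin (mtop M) U" for U
    using automorphismD(5)[OF \<phi> that] by (simp add: pre[OF that])
  have r_in: "snd \<phi> U s \<in> sections U" if "openin (mtop M) U" "s \<in> sections U" for U s
    using r_hom[OF that(1)] that(2) by (auto simp: superalgebra_hom_def ring_hom_def)
  have g_in: "g U f \<in> sections U" and \<Phi>_g: "\<Phi> U (g U f) = f"
    if "openin (mtop M) U" "U \<subseteq> W" "f \<in> model_sections M n U" for U f
    using \<Phi>_bij[OF that(1,2)] that(3) unfolding g_def bij_betw_def
    by (auto intro: inv_into_into f_inv_into_f)
  have g_\<Phi>: "g U (\<Phi> U s) = s" if "openin (mtop M) U" "U \<subseteq> W" "s \<in> sections U" for U s
    using \<Phi>_bij[OF that(1,2)] that(3) unfolding g_def bij_betw_def by simp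
  have \<Phi>_in: "\<Phi> U s \<in> model_sections M n U" if "openin (mtop M) U" "U \<subseteq> W" "s \<in> sections U" for U s
    using \<Phi>_bij[OF that(1,2)] that(3) unfolding bij_betw_def by auto
  have "model_endomorphism M n W (\<lambda>U f. \<Phi> U (snd \<phi> U (g U f)))"
  proof
    fix U f f'
    assume U: "openin (mtop M) U" "U \<subseteq> W" and f: "f \<in> model_sections M n U" "f' \<in> model_sections M n U"
    interpret ring "sec F U"
      by (rule ring_sec[OF U(1)])
    have "\<Phi> U (g U f \<oplus>\<^bsub>sec F U\<^esub> g U f') = f \<oplus>\<^bsub>model_superalgebra M n U\<^esub> f'"
      "\<Phi> U (g U f \<otimes>\<^bsub>sec F U\<^esub> g U f') = f \<otimes>\<^bsub>model_superalgebra M n U\<^esub> f'"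
      using \<Phi>_hom[OF U] g_in[OF U] \<Phi>_g[OF U] f by (auto simp: superalgebra_hom_def ring_hom_def)
    then show "f \<oplus>\<^bsub>model_superalgebra M n U\<^esub> f' \<in> model_sections M n U \<and>
        f \<otimes>\<^bsub>model_superalgebra M n U\<^esub> f' \<in> model_sections M n U"
      using \<Phi>_in[OF U] g_in[OF U] f by (metis a_closed m_closed)
  next
    fix U
    assume U: "openin (mtop M) U" "U \<subseteq> W"
    interpret ring "sec F U"
      by (rule ring_sec[OF U(1)])
    have g_hom: "g U (f \<oplus>\<^bsub>model_superalgebra M n U\<^esub> f') = g U f \<oplus>\<^bsub>sec F U\<^esub> g U f'"
      "g U (f \<otimes>\<^bsub>model_superalgebra M n U\<^esub> f') = g U f \<otimes>\<^bsub>sec F U\<^esub> g U f'"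
      if "f \<in> model_sections M n U" "f' \<in> model_sections M n U" for f f'
    proof -
      have "\<Phi> U (g U f \<oplus>\<^bsub>sec F U\<^esub> g U f') = f \<oplus>\<^bsub>model_superalgebra M n U\<^esub> f'"
        "\<Phi> U (g U f \<otimes>\<^bsub>sec F U\<^esub> g U f') = f \<otimes>\<^bsub>model_superalgebra M n U\<^esub> f'"
        using \<Phi>_hom[OF U] g_in[OF U] \<Phi>_g[OF U] that by (auto simp: superalgebra_hom_def ring_hom_def)
      then show "g U (f \<oplus>\<^bsub>model_superalgebra M n U\<^esub> f') = g U f \<oplus>\<^bsub>sec F U\<^esub> g U f'"
        "g U (f \<otimes>\<^bsub>model_superalgebra M n U\<^esub> f') = g U f \<otimes>\<^bsub>sec F U\<^esub> g U f'"
        using g_\<Phi>[OF U] g_in[OF U] that by (metis a_closed, metis m_closed)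
    qed
    have g_one: "g U \<one>\<^bsub>model_superalgebra M n U\<^esub> = \<one>\<^bsub>sec F U\<^esub>"
    proof -
      have "\<Phi> U \<one>\<^bsub>sec F U\<^esub> = \<one>\<^bsub>model_superalgebra M n U\<^esub>"
        using \<Phi>_hom[OF U] by (simp add: superalgebra_hom_def ring_hom_def)
      then show ?thesis
        using g_\<Phi>[OF U one_closed] by simp
    qed
    show "(\<lambda>f. \<Phi> U (snd \<phi> U (g U f))) \<in> ring_hom (model_superalgebra M n U) (model_superalgebra M n U)"
      using \<Phi>_hom[OF U] r_hom[OF U(1)] \<Phi>_in[OF U] r_in[OF U(1)] g_in[OF U]
      by (auto intro!: ring_hom_memI simp: model_superalgebra_simps(1) g_hom g_one superalgebra_hom_def
          ring_hom_mult ring_hom_add ring_hom_one)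
    fix c f
    assume f: "f \<in> model_sections M n U"
    have "\<Phi> U (c \<odot>\<^bsub>sec F U\<^esub> g U f) = c \<odot>\<^bsub>model_superalgebra M n U\<^esub> f"
      using \<Phi>_hom[OF U] g_in[OF U f] \<Phi>_g[OF U f] by (simp add: superalgebra_hom_def)
    then have "g U (c \<odot>\<^bsub>model_superalgebra M n U\<^esub> f) = c \<odot>\<^bsub>sec F U\<^esub> g U f"
      using g_\<Phi>[OF U smult_sec[OF U(1) g_in[OF U f]]] by metis
    then show "\<Phi> U (snd \<phi> U (g U (c \<odot>\<^bsub>model_superalgebra M n U\<^esub> f))) =
        c \<odot>\<^bsub>model_superalgebra M n U\<^esub> \<Phi> U (snd \<phi> U (g U f))"
      using \<Phi>_hom[OF U] r_hom[OF U(1)] r_in[OF U(1) g_in[OF U f]] g_in[OF U f]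
      by (simp add: superalgebra_hom_def)
  next
    fix U U' f
    assume U: "openin (mtop M) U" "openin (mtop M) U'" "U' \<subseteq> U" "U \<subseteq> W" and f: "f \<in> model_sections M n U"
    have U'W: "U' \<subseteq> W"
      using U by blast
    let ?s = "g U f"
    have s: "?s \<in> sections U"
      by (rule g_in[OF U(1,4) f])
    have "res (model_sheaf M n) U U' f = \<Phi> U' (res F U U' ?s)"
      using \<Phi>_res[OF U s] \<Phi>_g[OF U(1,4) f] by simp
    then have "g U' (res (model_sheaf M n) U U' f) = res F U U' ?s"
      using g_\<Phi>[OF U(2) U'W res_in[OF U(1-3) s]] by simp
    moreover have "snd \<phi> U' (res F U U' ?s) = res F U U' (snd \<phi> U ?s)"
      using automorphismD(6)[OF \<phi> U(1-3) s] by (simp add: pre U)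
    ultimately show "\<Phi> U' (snd \<phi> U' (g U' (res (model_sheaf M n) U U' f))) =
        res (model_sheaf M n) U U' (\<Phi> U (snd \<phi> U (g U f)))"
      using \<Phi>_res[OF U r_in[OF U(1) s]] by simp
  qed (fact manifold W)+
  then show ?thesis
    by (simp add: g_def)
qed

text \<open>
The second part is conditional on all underlying maps being the identity on the whole manifold: only then the pullback
maps sections over \<open>U\<close> to sections over \<open>U\<close>. This becomes available after the points have been fixed everywhere.
\<close>

definition rigid :: "'p set \<Rightarrow> ('p, 's) morphism set \<Rightarrow> bool" where
  "rigid V N \<longleftrightarrow> openin (mtop M) V \<and> near_identity N \<and>
    (\<forall>H. subgroup H (Aut_group M) \<and> H \<subseteq> N \<longrightarrow>
      (\<forall>\<phi>\<in>H. \<forall>x\<in>V. fst \<phi> x = x) \<and>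
      ((\<forall>\<phi>\<in>H. \<forall>x\<in>topspace (mtop M). fst \<phi> x = x) \<longrightarrow>
        (\<forall>\<phi>\<in>H. \<forall>U. openin (mtop M) U \<and> U \<subseteq> V \<longrightarrow> (\<forall>s\<in>sections U. snd \<phi> U s = s))))"

text \<open>
The neighbourhood controls the underlying map on a compact polydisc around \<open>p\<close> and the pullbacks of the finitely many
coordinates \<open>z\<^sub>i\<close> and \<open>\<theta>\<^sub>j\<close>.
\<close>

lemma local_rigidity:
  assumes p: "p \<in> topspace (mtop M)"
  obtains V N where "p \<in> V" and "rigid V N"
proof -
  obtain U \<psi> W \<Phi> where chart: "(U, \<psi>) \<in> atlas M" and WU: "W \<subseteq> U" and pW: "p \<in> W"
    and W: "coordinate_domain M W \<Phi>"
    using coordinate_domain_exists[OF p] .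
  interpret c: manifold_chart M U \<psi>
    using manifold chart by unfold_locales
  note W_open = coordinate_domainD(1)[OF W] and iso = coordinate_domainD(2)[OF W]
  obtain r0 where r0: "r0 > 0" "polydisc (mdim M) (\<psi> p) r0 \<subseteq> \<psi> ` W"
    by (rule c.small_polydisc[OF W_open WU pW])
  define r where "r = r0 / 3"
  have r: "r > 0" "2 * r < r0"
    using r0(1) by (auto simp: r_def)
  define K where "K = {x \<in> U. \<psi> x \<in> closed_polydisc (mdim M) (\<psi> p) (2 * r)}"
  define V where "V = {x \<in> U. \<psi> x \<in> polydisc (mdim M) (\<psi> p) r}"
  have in_W: "closed_polydisc (mdim M) (\<psi> p) (2 * r) \<subseteq> \<psi> ` W"
    using closed_polydisc_subset[OF r(2)] r0(2) by blast
  then have "closed_polydisc (mdim M) (\<psi> p) (2 * r) \<subseteq> \<psi> ` U"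
    using WU by blast
  then have K: "compactin (mtop M) K"
    unfolding K_def by (intro c.compact_preimage compactin_closed_polydisc)
  have KW: "K \<subseteq> W"
    using in_W WU c.inj by (auto simp: K_def dest!: subsetD inj_onD)
  have V_open: "openin (mtop M) V"
    unfolding V_def by (intro c.open_preimage openin_polydisc)
  have VK: "V \<subseteq> K"
    using polydisc_subset_closed[of "mdim M" "\<psi> p" "2 * r"] polydisc_mono[of r "2 * r" "mdim M" "\<psi> p"] r(1)
    by (auto simp: V_def K_def)
  have VW: "V \<subseteq> W" and VU: "V \<subseteq> U"
    using VK KW WU by auto
  have pV: "p \<in> V"
    using pW WU c.chart_zero r(1) by (auto simp: V_def intro!: center_in_polydisc)
  \<comment> \<open>There are at most \<open>2\<^sup>n\<close> monomials of a given degree, so the errors add up to at most half of the displacement.\<close>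
  define \<epsilon> :: real where "\<epsilon> = 1 / (2 * 2 ^ n)"
  have \<epsilon>: "\<epsilon> > 0" "2 ^ n * \<epsilon> \<le> 1 / 2"
    by (simp_all add: \<epsilon>_def)
  define gens where "gens = (\<lambda>V. (\<lambda>i. body_section V (\<lambda>x. \<psi> x i)) ` {..<mdim M} \<union>
    (\<lambda>j. theta_section V {j}) ` {..<n})"
  have gens_in: "gens V \<subseteq> model_sections M n V" if "V \<subseteq> U" for V
    using that unfolding gens_def
    by (auto intro!: body_section_in_model_sections theta_section_in_model_sections manifold c.holomorphic_coordinate)
  have gens_cont: "continuous_map (subtopology (mtop M) W) euclidean (\<xi> \<nu>)" if \<xi>: "\<xi> \<in> gens W" for \<xi> \<nu>
  proof -
    have coord: "continuous_map (subtopology (mtop M) W) euclidean (\<lambda>x. \<psi> x i)" for i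
      by (rule continuous_map_from_subtopology_mono[OF c.continuous_coordinate WU])
    have const: "continuous_map (subtopology (mtop M) W) euclidean (\<lambda>x. a)" for a :: complex
      by simp
    consider i where "\<xi> = body_section W (\<lambda>x. \<psi> x i)" | j where "\<xi> = theta_section W {j}"
      using \<xi> by (auto simp: gens_def)
    then show ?thesis
    proof cases
      case 1
      show ?thesis
      proof (cases "\<nu> = {}")
        case True
        then show ?thesis
          by (intro continuous_map_eq[OF coord[of i]]) (simp add: 1 body_section_def)
      next
        case False
        then show ?thesis
          by (intro continuous_map_eq[OF const[of 0]]) (simp add: 1 body_section_def)
      qed
    next
      case 2
      show ?thesis
        by (intro continuous_map_eq[OF const[of "if \<nu> = {j} then 1 else 0"]]) (simp add: 2 theta_section_def)
    qed
  qed
  have bij: "bij_betw (\<Phi> U) (sections U) (model_sections M n U)" if "openin (mtop M) U" "U \<subseteq> W" for U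
    using iso that unfolding sheaf_iso_on_def by (auto simp: model_sheaf_simps model_superalgebra_simps)
  \<comment> \<open>The sections of the structure sheaf that correspond to the coordinates.\<close>
  define lift where "lift = inv_into (sections W) (\<Phi> W)"
  have lift: "lift \<xi> \<in> sections W" "\<Phi> W (lift \<xi>) = \<xi>" if "\<xi> \<in> gens W" for \<xi>
    using bij[OF W_open order_refl] gens_in[OF WU] that unfolding lift_def bij_betw_def
    by (auto intro!: inv_into_into f_inv_into_f)
  define N1 where "N1 = {\<phi> \<in> carrier (Aut_group M).
    \<forall>x\<in>K. fst \<phi> x \<in> W \<and> (\<forall>i<mdim M. cmod (\<psi> (fst \<phi> x) i - \<psi> x i) < r / (4 * (real (mdim M) + 1)))}"
  define N2 where "N2 = (\<lambda>\<xi>. {\<phi> \<in> carrier (Aut_group M). \<forall>x\<in>K. \<forall>\<nu>. \<nu> \<subseteq> {..<n} \<longrightarrow>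
    cmod (\<Phi> (preimage M (fst \<phi>) W \<inter> W) (res F (preimage M (fst \<phi>) W) (preimage M (fst \<phi>) W \<inter> W)
      (snd \<phi> W (lift \<xi>))) \<nu> x - \<Phi> W (lift \<xi>) \<nu> x) < \<epsilon>})"
  define N where "N = N1 \<inter> (carrier (Aut_group M) \<inter> (\<Inter>\<xi>\<in>gens W. N2 \<xi>))"
  have "near_identity N1"
    unfolding N1_def using r(1) by (intro near_identity_displacement[OF chart WU W K KW]) simp
  moreover have "near_identity (N2 \<xi>)" if "\<xi> \<in> gens W" for \<xi>
    unfolding N2_def using gens_cont[OF that] lift[OF that]
    by (intro near_identity_coefficients[OF W K KW _ \<epsilon>(1)]) auto
  then have "near_identity (carrier (Aut_group M) \<inter> (\<Inter>\<xi>\<in>gens W. N2 \<xi>))"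
    by (intro near_identity_INT) (auto simp: gens_def)
  ultimately have N: "near_identity N"
    unfolding N_def by (rule near_identity_Int)
  have fixes_points: "fst \<phi> x = x" if H: "subgroup H (Aut_group M)" "H \<subseteq> N" and \<phi>: "\<phi> \<in> H" and x: "x \<in> V" for H \<phi> x
  proof (rule underlying_map_trivial[OF H(1) chart r(1) _ _ _ _ _ \<phi>])
    show "polydisc (mdim M) (\<psi> p) (2 * r) \<subseteq> \<psi> ` U"
      using polydisc_subset_closed in_W WU by blast
    show "fst \<phi> y \<in> U \<and> (\<forall>i<mdim M. cmod (\<psi> (fst \<phi> y) i - \<psi> y i) < r / (4 * (real (mdim M) + 1)))"
      if "\<phi> \<in> H" "y \<in> U" "\<psi> y \<in> polydisc (mdim M) (\<psi> p) (2 * r)" for \<phi> y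
    proof -
      have "y \<in> K"
        using that polydisc_subset_closed unfolding K_def by blast
      moreover have "\<phi> \<in> N1"
        using that(1) H(2) by (auto simp: N_def)
      ultimately show ?thesis
        using WU unfolding N1_def by blast
    qed
  qed (use x pW WU c.chart_zero in \<open>auto simp: V_def\<close>)
  have fixes_sections: "snd \<phi> U' s = s"
    if H: "subgroup H (Aut_group M)" "H \<subseteq> N" and id: "\<forall>\<phi>\<in>H. \<forall>x\<in>topspace (mtop M). fst \<phi> x = x"
      and \<phi>: "\<phi> \<in> H" and U': "openin (mtop M) U'" "U' \<subseteq> V" and s: "s \<in> sections U'" for H \<phi> U' s
  proof -
    define \<sigma> where "\<sigma> = (\<lambda>(\<phi> :: ('p, 's) morphism) U f. \<Phi> U (snd \<phi> U (inv_into (sections U) (\<Phi> U) f)))"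
    have pre: "preimage M (fst \<phi>) U = U" if "\<phi> \<in> H" "openin (mtop M) U" for \<phi> U
      using that id by (intro preimage_identity) auto
    have r_in: "snd \<phi> U s \<in> sections U" if "\<phi> \<in> H" "openin (mtop M) U" "s \<in> sections U" for \<phi> U s
      using automorphismD(5)[OF subgroup.mem_carrier[OF H(1) that(1)] that(2)] that(3)
      by (auto simp: pre[OF that(1,2)] superalgebra_hom_def ring_hom_def)
    have endo_W: "model_endomorphism M n W (\<sigma> \<phi>)" if "\<phi> \<in> H" for \<phi>
      unfolding \<sigma>_def using id that by (intro model_pullback[OF iso W_open subgroup.mem_carrier[OF H(1) that]]) auto
    have endo: "model_endomorphism M n V (\<sigma> \<phi>)" if "\<phi> \<in> H" for \<phi>
      by (rule model_endomorphism_subset[OF endo_W[OF that] V_open VW])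
    have fix_gens: "\<sigma> \<phi> V \<xi> = \<xi>" if \<phi>: "\<phi> \<in> H" and \<xi>: "\<xi> \<in> gens V" for \<phi> \<xi>
    proof (rule small_endomorphisms_fix_generators[OF endo, where H = H and G = "gens V" and \<epsilon> = \<epsilon>
          and sq = "\<lambda>\<phi>. compose_morphisms M \<phi> \<phi>"])
      show "compose_morphisms M \<phi> \<phi> \<in> H" if "\<phi> \<in> H" for \<phi>
        by (rule square_of_member(1)[OF H(1) that])
      show "\<sigma> (compose_morphisms M \<phi> \<phi>) V f = \<sigma> \<phi> V (\<sigma> \<phi> V f)"
        if \<phi>: "\<phi> \<in> H" and f: "f \<in> model_sections M n V" for \<phi> f
      proof -
        let ?s = "inv_into (sections V) (\<Phi> V) f"
        have s: "?s \<in> sections V"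
          using bij[OF V_open VW] f unfolding bij_betw_def by (auto intro: inv_into_into)
        have "inv_into (sections V) (\<Phi> V) (\<Phi> V (snd \<phi> V ?s)) = snd \<phi> V ?s"
          using bij[OF V_open VW] r_in[OF \<phi> V_open s] by (simp add: bij_betw_def)
        then show ?thesis
          using s V_open by (simp add: \<sigma>_def compose_morphisms_def compose_def pre[OF \<phi> V_open])
      qed
      show "gens V \<subseteq> model_sections M n V"
        by (rule gens_in[OF VU])
      show "theta_section V {j} \<in> gens V" if "j < n" for j
        using that by (auto simp: gens_def)
      show "\<sigma> \<phi> V \<xi> {} x = \<xi> {} x" if \<phi>: "\<phi> \<in> H" and \<xi>: "\<xi> \<in> gens V" and x: "x \<in> V" for \<phi> \<xi> x
      proof -
        interpret e: model_endomorphism M n V "\<sigma> \<phi>"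
          by (rule endo[OF \<phi>])
        consider i where "i < mdim M" "\<xi> = body_section V (\<lambda>x. \<psi> x i)"
          | j where "j < n" "\<xi> = theta_section V {j}"
          using \<xi> by (auto simp: gens_def)
        then show ?thesis
        proof cases
          case 1
          then show ?thesis
            using e.sigma_body[OF e.is_open_V c.holomorphic_coordinate[OF 1(1) VU] x] x
            by (simp add: body_section_def)
        next
          case 2
          then show ?thesis
            using e.sigma_theta_order1[OF e.is_open_V 2(1), of x]
            by (simp add: of_order_def theta_section_def)
        qed
      qed
      show "cmod (\<sigma> \<phi> V \<xi> \<mu> x - \<xi> \<mu> x) \<le> \<epsilon>"
        if \<phi>: "\<phi> \<in> H" and \<xi>: "\<xi> \<in> gens V" and x: "x \<in> V" and \<mu>: "\<mu> \<subseteq> {..<n}" for \<phi> \<xi> x \<mu>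
      proof -
        interpret e: model_endomorphism M n W "\<sigma> \<phi>"
          by (rule endo_W[OF \<phi>])
        have "\<exists>\<xi>'\<in>gens W. \<forall>\<mu> x. \<xi> \<mu> x = (if x \<in> V then \<xi>' \<mu> x else 0)"
        proof -
          consider i where "i < mdim M" "\<xi> = body_section V (\<lambda>x. \<psi> x i)"
            | j where "j < n" "\<xi> = theta_section V {j}"
            using \<xi> by (auto simp: gens_def)
          then show ?thesis
          proof cases
            case 1
            then show ?thesis
              using VW by (intro bexI[of _ "body_section W (\<lambda>x. \<psi> x i)"]) (auto simp: gens_def body_section_def)
          next
            case 2
            then show ?thesis
              using VW by (intro bexI[of _ "theta_section W {j}"]) (auto simp: gens_def theta_section_def)
          qed
        qed
        then obtain \<xi>' where \<xi>': "\<xi>' \<in> gens W" "\<And>\<mu> x. \<xi> \<mu> x = (if x \<in> V then \<xi>' \<mu> x else 0)"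
          by blast
        have "\<sigma> \<phi> V \<xi> \<mu> x = \<sigma> \<phi> W \<xi>' \<mu> x"
          using V_open VW \<xi>' gens_in[OF WU] x
          by (intro e.sigma_restrict[OF e.is_open_V]) (auto simp: e.is_open_def)
        also have "\<sigma> \<phi> W \<xi>' = \<Phi> W (snd \<phi> W (lift \<xi>'))"
          by (simp add: \<sigma>_def lift_def)
        finally have eq: "\<sigma> \<phi> V \<xi> \<mu> x = \<Phi> W (snd \<phi> W (lift \<xi>')) \<mu> x" .
        have "\<phi> \<in> N2 \<xi>'"
          using H(2) \<phi> \<xi>'(1) by (auto simp: N_def)
        then have "\<forall>x\<in>K. \<forall>\<nu>. \<nu> \<subseteq> {..<n} \<longrightarrow>
            cmod (\<Phi> W (snd \<phi> W (lift \<xi>')) \<nu> x - \<Phi> W (lift \<xi>') \<nu> x) < \<epsilon>"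
          by (simp add: N2_def pre[OF \<phi> W_open] res_id[OF W_open r_in[OF \<phi> W_open lift(1)[OF \<xi>'(1)]]])
        then have "cmod (\<Phi> W (snd \<phi> W (lift \<xi>')) \<mu> x - \<Phi> W (lift \<xi>') \<mu> x) < \<epsilon>"
          using subsetD[OF VK x] \<mu> by simp
        then show ?thesis
          using x by (simp add: eq lift(2)[OF \<xi>'(1)] \<xi>'(2))
      qed
    qed (use \<epsilon> \<phi> \<xi> in auto)
    interpret e: model_endomorphism M n V "\<sigma> \<phi>"
      by (rule endo[OF \<phi>])
    have U'W: "U' \<subseteq> W"
      using U' VW by blast
    have "\<sigma> \<phi> U' (\<Phi> U' s) = \<Phi> U' s"
    proof (rule e.identity_from_generators[OF chart VU])
      show "\<sigma> \<phi> V (body_section V (\<lambda>x. \<psi> x i)) = body_section V (\<lambda>x. \<psi> x i)" if "i < mdim M" for i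
        using that by (intro fix_gens[OF \<phi>]) (auto simp: gens_def)
      show "\<sigma> \<phi> V (theta_section V {j}) = theta_section V {j}" if "j < n" for j
        using that by (intro fix_gens[OF \<phi>]) (auto simp: gens_def)
      show "e.is_open U'"
        using U' by (simp add: e.is_open_def)
      show "\<Phi> U' s \<in> model_sections M n U'"
        using bij[OF U'(1) U'W] s by (auto simp: bij_betw_def)
    qed
    moreover have "\<sigma> \<phi> U' (\<Phi> U' s) = \<Phi> U' (snd \<phi> U' s)"
      using bij[OF U'(1) U'W] s by (simp add: \<sigma>_def bij_betw_def)
    ultimately show ?thesis
      using bij[OF U'(1) U'W] s r_in[OF \<phi> U'(1) s] by (auto simp: bij_betw_def dest: inj_onD)
  qed
  have "rigid V N"
    unfolding rigid_def using V_open N fixes_points fixes_sections by (intro conjI allI impI ballI) auto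
  then show ?thesis
    by (rule that[OF pV])
qed

text \<open>
Finitely many rigid open sets cover the manifold, and sections that agree on a cover are equal.
\<close>

lemma no_small_subgroups_if_compact:
  assumes compact: "compact_space (mtop M)"
  shows "no_small_subgroups (Aut_group M) (Aut_topology M)"
proof -
  have "\<forall>p\<in>topspace (mtop M). \<exists>V. p \<in> V \<and> (\<exists>N. rigid V N)"
  proof
    fix p
    assume "p \<in> topspace (mtop M)"
    then obtain V N where "p \<in> V" "rigid V N"
      by (rule local_rigidity)
    then show "\<exists>V. p \<in> V \<and> (\<exists>N. rigid V N)"
      by blast
  qed
  from bchoice[OF this] obtain V where V: "\<forall>p\<in>topspace (mtop M). p \<in> V p \<and> (\<exists>N. rigid (V p) N)" ..
  then have "\<forall>p\<in>topspace (mtop M). \<exists>N. rigid (V p) N"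
    by blast
  from bchoice[OF this] obtain N where N: "\<forall>p\<in>topspace (mtop M). rigid (V p) (N p)" ..
  have "\<exists>\<F>. finite \<F> \<and> \<F> \<subseteq> V ` topspace (mtop M) \<and> topspace (mtop M) \<subseteq> \<Union>\<F>"
    using compact V by (intro compactinD[of "mtop M"]) (auto simp: compact_space_def rigid_def)
  then obtain P where P: "finite P" "P \<subseteq> topspace (mtop M)" "topspace (mtop M) \<subseteq> \<Union> (V ` P)"
    by (metis finite_subset_image)
  define N' where "N' = carrier (Aut_group M) \<inter> (\<Inter>p\<in>P. N p)"
  have near: "near_identity N'"
    unfolding N'_def using N P by (intro near_identity_INT) (auto simp: rigid_def)
  have trivial: "H = {\<one>\<^bsub>Aut_group M\<^esub>}" if H: "subgroup H (Aut_group M)" "H \<subseteq> N'" for H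
  proof -
    have rigid_p: "rigid (V p) (N p)" "H \<subseteq> N p" if "p \<in> P" for p
      using that N P H by (auto simp: N'_def)
    have points: "\<forall>\<phi>\<in>H. \<forall>x\<in>topspace (mtop M). fst \<phi> x = x"
    proof (intro ballI)
      fix \<phi> x
      assume "\<phi> \<in> H" "x \<in> topspace (mtop M)"
      then obtain p where "p \<in> P" "x \<in> V p"
        using P by blast
      then show "fst \<phi> x = x"
        using rigid_p[of p] H(1) \<open>\<phi> \<in> H\<close> unfolding rigid_def by blast
    qed
    have fixed_locally: "snd \<phi> U s = s" if "\<phi> \<in> H" "p \<in> P" "openin (mtop M) U" "U \<subseteq> V p" "s \<in> sections U" for \<phi> p U s
      using rigid_p[OF that(2)] H(1) points that unfolding rigid_def by blast
    have "\<phi> = \<one>\<^bsub>End_monoid M\<^esub>" if \<phi>: "\<phi> \<in> H" for \<phi>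
    proof -
      have \<phi>_Aut: "\<phi> \<in> carrier (Aut_group M)"
        using subgroup.mem_carrier[OF H(1) \<phi>] .
      have pre: "preimage M (fst \<phi>) U = U" if "openin (mtop M) U" for U
        using that points \<phi> by (intro preimage_identity) auto
      have sections_fixed: "snd \<phi> U s = s" if U: "openin (mtop M) U" and s: "s \<in> sections U" for U s
      proof -
        define \<U> where "\<U> = (\<lambda>p. U \<inter> V p) ` P"
        have \<U>_open: "openin (mtop M) U'" if "U' \<in> \<U>" for U'
          using that U rigid_p(1) by (auto simp: \<U>_def rigid_def)
        have union: "\<Union>\<U> = U"
          using P(3) openin_subset[OF U] by (auto simp: \<U>_def)
        have r_in: "snd \<phi> U s \<in> sections U"
          using automorphismD(5)[OF \<phi>_Aut U] s by (auto simp: pre[OF U] superalgebra_hom_def ring_hom_def)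
        show ?thesis
        proof (rule sections_eq_on_cover[OF \<U>_open, of \<U>, unfolded union])
          fix U'
          assume U': "U' \<in> \<U>"
          then obtain p where p: "p \<in> P" "U' = U \<inter> V p"
            by (auto simp: \<U>_def)
          have "res F U U' (snd \<phi> U s) = snd \<phi> U' (res F U U' s)"
            using automorphismD(6)[OF \<phi>_Aut U \<U>_open[OF U'] _ s] p(2) pre[OF U] pre[OF \<U>_open[OF U']] by simp
          also have "\<dots> = res F U U' s"
            using p U s by (intro fixed_locally[OF \<phi> p(1) \<U>_open[OF U']] res_in \<U>_open[OF U']) auto
          finally show "res F U U' (snd \<phi> U s) = res F U U' s" .
        qed (use r_in s in auto)
      qed
      show ?thesis
      proof (rule prod_eqI)
        show "fst \<phi> = fst \<one>\<^bsub>End_monoid M\<^esub>"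
          unfolding fst_one
          by (rule extensionalityI[OF automorphismD(1)[OF \<phi>_Aut] restrict_extensional]) (use points \<phi> in auto)
        show "snd \<phi> = snd \<one>\<^bsub>End_monoid M\<^esub>"
          unfolding snd_one
        proof (rule extensionalityI[OF automorphismD(3)[OF \<phi>_Aut] restrict_extensional])
          fix U
          assume "U \<in> {U. openin (mtop M) U}"
          then have U: "openin (mtop M) U"
            by simp
          have "snd \<phi> U = (\<lambda>s\<in>sections U. s)"
            by (rule extensionalityI[OF automorphismD(4)[OF \<phi>_Aut U] restrict_extensional])
               (use sections_fixed[OF U] in auto)
          then show "snd \<phi> U = (\<lambda>U\<in>{U. openin (mtop M) U}. \<lambda>s\<in>sections U. s) U"
            using U by simp
        qed
      qed
    qed
    then show ?thesis
      using subgroup.one_closed[OF H(1)] unfolding one_Aut by blast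
  qed
  show ?thesis
    unfolding no_small_subgroups_def
  proof (rule exI[of _ N'], rule conjI)
    show "\<exists>V. openin (Aut_topology M) V \<and> \<one>\<^bsub>Aut_group M\<^esub> \<in> V \<and> V \<subseteq> N'"
      using near by (simp add: near_identity_def one_Aut)
  qed (use trivial in simp)
qed

end

theorem proposition4p2:
  fixes M :: "('p, 's) supermanifold"
  assumes "complex_supermanifold M"
    and "compact_space (mtop M)"
  shows "no_small_subgroups (Aut_group M) (Aut_topology M)"
proof -
  interpret supermanifold M
    by (rule supermanifold.intro) (rule assms(1))
  show ?thesis
    by (rule no_small_subgroups_if_compact[OF assms(2)])
qed

end
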